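(* Let $f,\ g^{ij}=g^{ji}:[0,\infty)\times\Omega\times\mathbb R\times\mathbb R^d\to\mathbb R$ satisfy assumptions (A0)--(A3), (M) and the convention (L) of the context, and let $T>0$. For each given $\varepsilon>0$ and $y,y'\in\mathbb R$, $z,z'\in\mathbb R^d$, there exist processes $a^\varepsilon_s(y,y',z)$, $c^{ij,\varepsilon}_s(y,y',z)$, $m^\varepsilon_s(y,y',z,z')$, $n^{ij,\varepsilon}_s(y,y',z,z')\in\mathcal H^2_G(0,T)$ and $b^\varepsilon_s(y',z,z')$, $d^{ij,\varepsilon}_s(y',z,z')\in\mathcal H^2_G(0,T;\mathbb R^d)$, $i,j=1,\dots,d$ (families depending on the indicated arguments), such that: (i) $f(s,y,z)-f(s,y',z')=a^\varepsilon_s(y,y',z)(y-y')+b^\varepsilon_s(y',z,z')(z-z')+m^\varepsilon_s(y,y',z,z')$ and $g^{ij}(s,y,z)-g^{ij}(s,y',z')=c^{ij,\varepsilon}_s(y,y',z)(y-y')+d^{ij,\varepsilon}_s(y',z,z')(z-z')+n^{ij,\varepsilon}_s(y,y',z,z')$ for $i,j=1,\dots,d$; (ii) $|\varphi_s(y,y',z)|\le L_y$ for $\varphi=a^\varepsilon,c^{ij,\varepsilon}$; $|\psi_s(y',z,z')|\le2dL_z(1+|z|+|z'|)$ for $\psi=b^\varepsilon,d^{ij,\varepsilon}$; $|\phi_s(y,y',z,z')|\le2L_y\varepsilon+4dL_z(1+|z|+|z'|)\varepsilon$ for $\phi=m^\varepsilon,n^{ij,\varepsilon}$; and $$a^\varepsilon_s(y,y',z)+2G\big((c^{ij,\varepsilon}_s(y,y',z))_{i,j=1}^d\big)\le-\mu;$$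 (iii) for all $Y,Y'\in\mathcal S^2_G(0,T)$ and all $G$-BMO martingale generators $Z,Z'\in\mathcal H^2_G(0,T;\mathbb R^d)$, the processes $a^\varepsilon_s(Y_s,Y'_s,Z_s)$, $c^{ij,\varepsilon}_s(Y_s,Y'_s,Z_s)$, $m^\varepsilon_s(Y_s,Y'_s,Z_s,Z'_s)$, $n^{ij,\varepsilon}_s(Y_s,Y'_s,Z_s,Z'_s)$ belong to $\mathcal H^2_G(0,T)$ and $b^\varepsilon_s(Y'_s,Z_s,Z'_s)$, $d^{ij,\varepsilon}_s(Y'_s,Z_s,Z'_s)$ belong to $\mathcal H^2_G(0,T;\mathbb R^d)$; moreover $b^\varepsilon_s(Y'_s,Z_s,Z'_s)$, $d^{ij,\varepsilon}_s(Y'_s,Z_s,Z'_s)$, $m^\varepsilon_s(Y_s,Y'_s,Z_s,Z'_s)$, $n^{ij,\varepsilon}_s(Y_s,Y'_s,Z_s,Z'_s)$ are $G$-BMO martingale generators.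
   Context: **$G$-framework.** $\Omega$ is the space of continuous $\omega:[0,\infty)\to\mathbb{R}^d$ with $\omega_0=0$, with the metric of locally uniform convergence; $B$ is the canonical process, $\mathbb F$ its natural filtration. $L_{ip}(\Omega_T)$ is the set of random variables $\varphi(B_{t_1\wedge T},\dots,B_{t_n\wedge T})$ with $\varphi$ bounded Lipschitz, and $L_{ip}(\Omega)=\bigcup_{T>0}L_{ip}(\Omega_T)$. $\mathbb{S}(d)$ is the space of symmetric $d\times d$ matrices. $G:\mathbb{S}(d)\to\mathbb{R}$ is $G(A)=\frac12\sup_{\theta\in\Theta}\operatorname{tr}[\theta\theta^\top A]$ for a bounded, convex, closed set $\Theta\subset\mathbb{R}^{d\times d}$ of invertible matrices, and $G$ is non-degenerate: there is $\underline\sigma>0$ with $G(A)-G(A')\ge\frac12\underline\sigma^2\operatorname{tr}[A-A']$ whenever $A\ge A'$. $\hat{\mathbb E}$ is Peng's $G$-expectation on $L_{ip}(\Omega)$: $\hat{\mathbb E}[\varphi(x+B_t)]=u(t,x)$ where $u$ is the viscosity solution of $\partial_tu-G(\partial^2_{xx}u)=0$, $u(0,\cdot)=\varphi$, extended consistently to cylinder functionals. There is a weakly compact family $\mathcal P_G$ of probability measures on $\Omega$ such that $\hat{\mathbb E}[X]=\sup_{\mathbb P\in\mathcal P_G}\mathbb E^{\mathbb P}[X]$ for $X\in\mathbb L^1_G(\Omega)$, the completion of $L_{ip}(\Omega)$ under $\hat{\mathbb E}[|\cdot|]$. **Process spaces.** $\mathcal H^0_G(0,T)$: step processes $\sum_j\xi_j\mathbf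 1_{[t_j,t_{j+1})}$ with $\xi_j\in L_{ip}(\Omega_{t_j})$; $\mathcal H^p_G(0,T)$ is its completion under $(\hat{\mathbb E}[(\int_0^T|\cdot|^2ds)^{p/2}])^{1/p}$; $\mathcal H^p_G(0,T;\mathbb R^k)$ is the set of $\mathbb R^k$-valued processes with components in $\mathcal H^p_G(0,T)$. $\mathcal S^p_G(0,T)$ is the completion of $\{h(t,B_{t_1\wedge t},\dots,B_{t_n\wedge t}): t_i\in[0,T],\ h\text{ bounded Lipschitz}\}$ under $(\hat{\mathbb E}[\sup_{t\le T}|\cdot|^p])^{1/p}$. A process $\lambda\in\mathcal H^2_G(0,T;\mathbb R^k)$ is a $G$-BMO martingale generator if $\sup_{\mathbb P\in\mathcal P_G}\sup_\tau\big\|\mathbb E^{\mathbb P}_\tau[\int_\tau^T|\lambda_t|^2dt]\big\|_{\mathbb L^\infty(\mathbb P)}<\infty$, $\tau$ ranging over $[0,T]$-valued $\mathbb F$-stopping times. The product $b(z-z')$ of vectors in $\mathbb R^d$ is the scalar product. **Assumptions.** For $h=f$ and $h=g^{ij}$ there are constants $M_0,L_y,L_z>0$ and a modulus of continuity $w^h$ such that for every $T>0$: (A0) $h(t,\omega,y,z)=h(t,\omega_{\cdot\wedge t},y,z)$; (A1) $|h(t,\omega,0,0)|\le M_0$ for all $(t,\omega)\in[0,T]\times\Omega$; (A2) $|h(t,\omega,y,z)-h(t',\omega',y,z)|\le w^h(|t-t'|+\max_{s\in[0,T]}|\omega_s-\omega'_s|)$ for all $t,t'\in[0,T]$, $\omega,\omega'\in\Omega$,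 and all $(y,z)$ ($w^h$ independent of $(y,z)$); (A3) $|h(t,\omega,y,z)-h(t,\omega,y',z')|\le L_y|y-y'|+L_z(1+|z|+|z'|)|z-z'|$ for all $(t,\omega)\in[0,T]\times\Omega$ and all $y,y',z,z'$. (M) There is a constant $\mu>0$ such that for all $(t,\omega)\in[0,\infty)\times\Omega$, $y,y'\in\mathbb R$, $z\in\mathbb R^d$, $$(y-y')\big(f(t,y,z)-f(t,y',z)\big)+2G\Big((y-y')\big(g^{ij}(t,y,z)-g^{ij}(t,y',z)\big)_{i,j=1}^d\Big)\le-\mu|y-y'|^2 .$$ (L) $L_y\ge\frac{\mu}{1-2G(-J_d)}$, where $J_d$ is the $d\times d$ matrix with all entries equal to $1$. *)

theory Defs
  imports "HOL-Probability.Probability"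
begin

section \<open>The path space\<close>

text \<open>
  A path \<open>\<omega> : [0,\<infinity>) \<rightarrow> \<real>\<^sup>d\<close> with \<open>\<omega>\<^sub>0 = 0\<close> is represented by its extension by \<open>0\<close> to the negative
  half-line; because \<open>\<omega>\<^sub>0 = 0\<close>, continuity on \<open>[0,\<infinity>)\<close> and on \<open>\<real>\<close> are the same.
\<close>

typedef ('d::finite) path =
  "{\<omega> :: real \<Rightarrow> real^'d. continuous_on UNIV \<omega> \<and> (\<forall>t\<le>0. \<omega> t = 0)}"
  morphisms path_at Abs_path
  by (rule exI[of _ "\<lambda>_. 0"]) auto

lemma continuous_on_path_at: "continuous_on A (path_at \<omega>)"
  using path_at[of \<omega>] continuous_on_subset[of UNIV "path_at \<omega>" A] by auto

lemma path_at_nonpos: "t \<le> 0 \<Longrightarrow> path_at \<omega> t = 0"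
  using path_at[of \<omega>] by auto

text \<open>The stopped path \<open>\<omega>\<^bsub>\<cdot>\<and>t\<^esub>\<close>.\<close>

definition stopped_path :: "real \<Rightarrow> ('d::finite) path \<Rightarrow> 'd path" where
  "stopped_path t \<omega> = Abs_path (\<lambda>s. path_at \<omega> (min s t))"

lemma path_at_stopped_path: "path_at (stopped_path t \<omega>) s = path_at \<omega> (min s t)"
proof -
  have "continuous_on UNIV (\<lambda>s. path_at \<omega> (min s t))"
    by (rule continuous_on_compose2[OF continuous_on_path_at[of UNIV]]) (auto intro!: continuous_intros)
  then have "(\<lambda>s. path_at \<omega> (min s t)) \<in> {\<omega>. continuous_on UNIV \<omega> \<and> (\<forall>t\<le>0. \<omega> t = 0)}"
    by (auto simp: path_at_nonpos)
  then show ?thesis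
    unfolding stopped_path_def by (simp add: Abs_path_inverse)
qed

definition sup_dist :: "real \<Rightarrow> ('d::finite) path \<Rightarrow> 'd path \<Rightarrow> real" where
  "sup_dist T \<omega> \<omega>' = (SUP t\<in>{0..T}. dist (path_at \<omega> t) (path_at \<omega>' t))"

lemma bdd_above_path_dist: "bdd_above ((\<lambda>t. dist (path_at \<omega> t) (path_at \<omega>' t)) ` {0..T})"
  by (intro bounded_imp_bdd_above compact_imp_bounded compact_continuous_image
      continuous_intros continuous_on_path_at) auto

lemma dist_le_sup_dist: "0 \<le> t \<Longrightarrow> t \<le> T \<Longrightarrow> dist (path_at \<omega> t) (path_at \<omega>' t) \<le> sup_dist T \<omega> \<omega>'"
  unfolding sup_dist_def by (rule cSUP_upper[OF _ bdd_above_path_dist]) auto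

lemma sup_dist_le:
  "0 \<le> T \<Longrightarrow> (\<And>t. 0 \<le> t \<Longrightarrow> t \<le> T \<Longrightarrow> dist (path_at \<omega> t) (path_at \<omega>' t) \<le> c) \<Longrightarrow> sup_dist T \<omega> \<omega>' \<le> c"
  unfolding sup_dist_def by (rule cSUP_least) auto

lemma sup_dist_nonneg: "0 \<le> T \<Longrightarrow> 0 \<le> sup_dist T \<omega> \<omega>'"
  using dist_le_sup_dist[of 0 T \<omega> \<omega>'] by (simp add: path_at_nonpos)

lemma sup_dist_triangle: "0 \<le> T \<Longrightarrow> sup_dist T \<omega> \<omega>'' \<le> sup_dist T \<omega> \<omega>' + sup_dist T \<omega>'' \<omega>'"
proof (rule sup_dist_le)
  fix t assume "0 \<le> t" "t \<le> T"
  then show "dist (path_at \<omega> t) (path_at \<omega>'' t) \<le> sup_dist T \<omega> \<omega>' + sup_dist T \<omega>'' \<omega>'"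
    using dist_triangle2[of "path_at \<omega> t" "path_at \<omega>'' t" "path_at \<omega>' t"]
      dist_le_sup_dist[of t T \<omega> \<omega>'] dist_le_sup_dist[of t T \<omega>'' \<omega>'] by linarith
qed auto

instantiation path :: (finite) metric_space
begin

definition dist_path :: "'a path \<Rightarrow> 'a path \<Rightarrow> real" where
  "dist_path \<omega> \<omega>' = (\<Sum>k. (1/2) ^ Suc k * min 1 (sup_dist (real (Suc k)) \<omega> \<omega>'))"

definition uniformity_path :: "('a path \<times> 'a path) filter" where
  "uniformity_path = (INF e\<in>{0 <..}. principal {(x, y). dist x y < e})"

definition open_path :: "'a path set \<Rightarrow> bool" where
  "open_path S = (\<forall>x\<in>S. \<forall>\<^sub>F (x', y) in uniformity. x' = x \<longrightarrow> y \<in> S)"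

instance
proof
  have summ: "summable (\<lambda>k. (1/2::real) ^ Suc k * min 1 (sup_dist (real (Suc k)) \<omega> \<omega>'))"
    for \<omega> \<omega>' :: "'a path"
  proof (rule summable_comparison_test')
    show "summable (\<lambda>k. (1/2::real) ^ Suc k)"
      by (subst summable_Suc_iff) (auto intro: summable_geometric)
    show "norm ((1/2::real) ^ Suc k * min 1 (sup_dist (real (Suc k)) \<omega> \<omega>')) \<le> (1/2) ^ Suc k" for k
      using sup_dist_nonneg[of "real (Suc k)" \<omega> \<omega>']
      by (simp add: abs_mult mult_le_cancel_left1)
  qed
  fix x y z :: "'a path"
  show "dist x y = 0 \<longleftrightarrow> x = y"
  proof
    assume "dist x y = 0"
    then have "(1/2::real) ^ Suc k * min 1 (sup_dist (real (Suc k)) x y) = 0" for k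
      unfolding dist_path_def
      by (subst (asm) suminf_eq_zero_iff[OF summ]) (auto simp: sup_dist_nonneg)
    then have *: "sup_dist (real (Suc k)) x y = 0" for k
      by (smt (verit) mult_eq_0_iff power_eq_0_iff zero_neq_one divide_eq_0_iff)
    have "path_at x t = path_at y t" for t
    proof (cases "t \<le> 0")
      case False
      obtain k where "t \<le> real k" using real_arch_simple by blast
      then have "t \<le> real (Suc k)" by simp
      with False have "dist (path_at x t) (path_at y t) \<le> 0"
        using dist_le_sup_dist[of t "real (Suc k)" x y] * by simp
      then show ?thesis by simp
    qed (simp add: path_at_nonpos)
    then show "x = y" by (simp add: path_at_inject[symmetric] fun_eq_iff)
  next
    assume "x = y"
    then have "sup_dist (real (Suc k)) x y = 0" for k
      unfolding sup_dist_def by (simp add: image_constant_conv)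
    then show "dist x y = 0" by (simp add: dist_path_def)
  qed
  have "dist x y \<le> (\<Sum>k. (1/2) ^ Suc k * min 1 (sup_dist (real (Suc k)) x z)
      + (1/2) ^ Suc k * min 1 (sup_dist (real (Suc k)) y z))"
    unfolding dist_path_def
  proof (rule suminf_le[OF _ summ summable_add[OF summ summ]])
    fix k
    have "min 1 (sup_dist (real (Suc k)) x y)
        \<le> min 1 (sup_dist (real (Suc k)) x z) + min 1 (sup_dist (real (Suc k)) y z)"
      using sup_dist_triangle[of "real (Suc k)" x y z] sup_dist_nonneg[of "real (Suc k)" x z]
        sup_dist_nonneg[of "real (Suc k)" y z] by linarith
    then show "(1/2) ^ Suc k * min 1 (sup_dist (real (Suc k)) x y)
        \<le> (1/2) ^ Suc k * min 1 (sup_dist (real (Suc k)) x z)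
          + (1/2) ^ Suc k * min 1 (sup_dist (real (Suc k)) y z)"
      unfolding distrib_left[symmetric] by (intro mult_left_mono) auto
  qed
  also have "\<dots> = dist x z + dist y z"
    unfolding dist_path_def by (rule suminf_add[OF summ summ, symmetric])
  finally show "dist x y \<le> dist x z + dist y z" .
qed (simp_all only: uniformity_path_def open_path_def)

end


section \<open>The generator and the G-expectation\<close>

definition loewner_le :: "real^'n^'n \<Rightarrow> real^'n^'n \<Rightarrow> bool" where
  "loewner_le A' A \<longleftrightarrow> (\<forall>x. 0 \<le> x \<bullet> ((A - A') *v x))"

definition symmetric_matrix :: "real^'n^'n \<Rightarrow> bool" where
  "symmetric_matrix A \<longleftrightarrow> transpose A = A"

text \<open>
  \<open>\<Theta>\<close> is the uncertainty set and \<open>G\<close> its generator.  The formula for \<open>G\<close> is kept on all square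
  matrices, but only its values on symmetric ones are ever used.
\<close>

definition nondegenerate_generator :: "(real^'d^'d) set \<Rightarrow> (real^'d^'d \<Rightarrow> real) \<Rightarrow> bool" where
  "nondegenerate_generator \<Theta> G \<longleftrightarrow>
     \<Theta> \<noteq> {} \<and> bounded \<Theta> \<and> convex \<Theta> \<and> closed \<Theta> \<and> (\<forall>\<theta>\<in>\<Theta>. invertible \<theta>) \<and>
     (\<forall>A. G A = 1/2 * (SUP \<theta>\<in>\<Theta>. trace (\<theta> ** transpose \<theta> ** A))) \<and>
     (\<exists>\<sigma>>0. \<forall>A A'. symmetric_matrix A \<and> symmetric_matrix A' \<and> loewner_le A' A \<longrightarrow>
        G A - G A' \<ge> 1/2 * \<sigma>\<^sup>2 * trace (A - A'))"

text \<open>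
  \<open>\<psi>\<close> is of class \<open>C\<^sup>1\<^sup>,\<^sup>2\<close> on \<open>(0,\<infinity>) \<times> \<real>\<^sup>d\<close> with time derivative \<open>\<psi>t\<close>, gradient \<open>D\<close> and Hessian \<open>H\<close>.
\<close>

definition C12_test_function ::
  "(real \<Rightarrow> real^'d \<Rightarrow> real) \<Rightarrow> (real \<Rightarrow> real^'d \<Rightarrow> real) \<Rightarrow> (real \<Rightarrow> real^'d \<Rightarrow> real^'d)
    \<Rightarrow> (real \<Rightarrow> real^'d \<Rightarrow> real^'d^'d) \<Rightarrow> bool" where
  "C12_test_function \<psi> \<psi>t D H \<longleftrightarrow>
     (\<forall>t>0. \<forall>x. ((\<lambda>s. \<psi> s x) has_real_derivative \<psi>t t x) (at t) \<and>
        (\<psi> t has_derivative (\<lambda>h. D t x \<bullet> h)) (at x) \<and>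
        (D t has_derivative (\<lambda>h. H t x *v h)) (at x)) \<and>
     continuous_on ({0<..} \<times> UNIV) (\<lambda>(t, x). \<psi> t x) \<and>
     continuous_on ({0<..} \<times> UNIV) (\<lambda>(t, x). \<psi>t t x) \<and>
     continuous_on ({0<..} \<times> UNIV) (\<lambda>(t, x). D t x) \<and>
     continuous_on ({0<..} \<times> UNIV) (\<lambda>(t, x). H t x)"

text \<open>
  Viscosity solutions of \<open>\<partial>\<^sub>t u - G(\<partial>\<^sup>2\<^sub>x\<^sub>x u) = 0\<close>, \<open>u(0,\<cdot>) = \<phi>\<close>.  For bounded Lipschitz \<open>\<phi>\<close> there is
  exactly one in the class of bounded continuous functions on \<open>[0,\<infinity>) \<times> \<real>\<^sup>d\<close>.
\<close>

definition G_heat_viscosity_solution ::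
  "(real^'d^'d \<Rightarrow> real) \<Rightarrow> (real^'d \<Rightarrow> real) \<Rightarrow> (real \<Rightarrow> real^'d \<Rightarrow> real) \<Rightarrow> bool" where
  "G_heat_viscosity_solution G \<phi> u \<longleftrightarrow>
     continuous_on ({0..} \<times> UNIV) (\<lambda>(t, x). u t x) \<and>
     bounded ((\<lambda>(t, x). u t x) ` ({0..} \<times> UNIV)) \<and>
     (\<forall>x. u 0 x = \<phi> x) \<and>
     (\<forall>\<psi> \<psi>t D H t x. C12_test_function \<psi> \<psi>t D H \<and> 0 < t \<and> \<psi> t x = u t x \<and>
        (\<forall>s>0. \<forall>y. u s y \<le> \<psi> s y) \<longrightarrow> \<psi>t t x - G (H t x) \<le> 0) \<and>
     (\<forall>\<psi> \<psi>t D H t x. C12_test_function \<psi> \<psi>t D H \<and> 0 < t \<and> \<psi> t x = u t x \<and>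
        (\<forall>s>0. \<forall>y. \<psi> s y \<le> u s y) \<longrightarrow> \<psi>t t x - G (H t x) \<ge> 0)"

definition G_heat :: "(real^'d^'d \<Rightarrow> real) \<Rightarrow> (real^'d \<Rightarrow> real) \<Rightarrow> real \<Rightarrow> real^'d \<Rightarrow> real" where
  "G_heat G \<phi> t x = (THE r. \<exists>u. G_heat_viscosity_solution G \<phi> u \<and> r = u t x)"

text \<open>
  Bounded Lipschitz functions of the first \<open>n\<close> vectors \<open>x\<^sub>0, \<dots>, x\<^bsub>n-1\<^esub>\<close>; the Lipschitz bound forces
  \<open>\<phi>\<close> to depend on these only.
\<close>

definition bounded_Lipschitz :: "nat \<Rightarrow> ((nat \<Rightarrow> real^'d) \<Rightarrow> real) \<Rightarrow> bool" where
  "bounded_Lipschitz n \<phi> \<longleftrightarrow> bounded (range \<phi>) \<and>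
     (\<exists>C. \<forall>x x'. \<bar>\<phi> x - \<phi> x'\<bar> \<le> C * (\<Sum>i<n. norm (x i - x' i)))"

definition L_ip :: "real \<Rightarrow> (('d::finite) path \<Rightarrow> real) set" where
  "L_ip T = {X. \<exists>n t \<phi>. bounded_Lipschitz n \<phi> \<and> (\<forall>i<n. 0 \<le> t i) \<and>
     X = (\<lambda>\<omega>. \<phi> (\<lambda>i. path_at \<omega> (min (t i) T)))}"

definition L_ip_Omega :: "(('d::finite) path \<Rightarrow> real) set" where
  "L_ip_Omega = (\<Union>T\<in>{0<..}. L_ip T)"

text \<open>
  The G-expectation of \<open>\<phi>(B\<^bsub>t 0\<^esub>, \<dots>, B\<^bsub>t (n-1)\<^esub>)\<close> for \<open>0 \<le> t 0 \<le> \<dots> \<le> t (n-1)\<close>: the last variable is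
  integrated out first, conditionally on the earlier ones, by means of the G-heat equation run for
  the length of the last time step and started from the previous position.
\<close>

primrec cylinder_G_expectation ::
  "(real^'d^'d \<Rightarrow> real) \<Rightarrow> (nat \<Rightarrow> real) \<Rightarrow> nat \<Rightarrow> ((nat \<Rightarrow> real^'d) \<Rightarrow> real) \<Rightarrow> real" where
  "cylinder_G_expectation G t 0 \<phi> = \<phi> (\<lambda>_. 0)"
| "cylinder_G_expectation G t (Suc n) \<phi> =
     cylinder_G_expectation G t n (\<lambda>x. case n of
         0 \<Rightarrow> G_heat G (\<lambda>y. \<phi> (x(0 := y))) (t 0) 0
       | Suc k \<Rightarrow> G_heat G (\<lambda>y. \<phi> (x(n := y))) (t n - t k) (x k))"

definition G_expectation :: "(real^'d^'d \<Rightarrow> real) \<Rightarrow> (('d::finite) path \<Rightarrow> real) \<Rightarrow> real" where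
  "G_expectation G X = (THE r. \<exists>n t \<phi>. bounded_Lipschitz n \<phi> \<and> (\<forall>i<n. 0 \<le> t i) \<and>
     (\<forall>i j. i \<le> j \<and> j < n \<longrightarrow> t i \<le> t j) \<and>
     X = (\<lambda>\<omega>. \<phi> (\<lambda>i. path_at \<omega> (t i))) \<and> r = cylinder_G_expectation G t n \<phi>)"

definition borel_probabilities :: "('a::topological_space) measure set" where
  "borel_probabilities = {P. prob_space P \<and> sets P = sets borel}"

definition weak_topology :: "('a::topological_space) measure topology" where
  "weak_topology = topology_generated_by
     {{P \<in> borel_probabilities. (\<integral>x. \<phi> x \<partial>P) \<in> U} |\<phi> U.
        continuous_on UNIV \<phi> \<and> bounded (range \<phi>) \<and> open (U :: real set)}"

text \<open>
  A weakly compact family representing the G-expectation.  Representation on the bounded Lipschitz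
  cylinder functionals extends by continuity to their completion.
\<close>

definition represents_G_expectation ::
  "(real^'d^'d \<Rightarrow> real) \<Rightarrow> ('d::finite) path measure set \<Rightarrow> bool" where
  "represents_G_expectation G \<P> \<longleftrightarrow>
     \<P> \<noteq> {} \<and> \<P> \<subseteq> borel_probabilities \<and> compactin weak_topology \<P> \<and>
     (\<forall>X\<in>L_ip_Omega. G_expectation G X = (SUP P\<in>\<P>. \<integral>\<omega>. X \<omega> \<partial>P))"


section \<open>Process spaces\<close>

text \<open>
  The extension of the sublinear expectation to \<open>[0,\<infinity>]\<close>-valued random variables.  The infimum over
  measurable majorants matters only for suprema over uncountably many times, which need not be Borel
  measurable; for measurable \<open>X\<close> it is \<open>sup\<^bsub>P \<in> \<P>\<^esub> E\<^sup>P[X]\<close>.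
\<close>

definition upper_expectation ::
  "('d::finite) path measure set \<Rightarrow> ('d path \<Rightarrow> ennreal) \<Rightarrow> ennreal" where
  "upper_expectation \<P> X =
     (SUP P\<in>\<P>. INF V\<in>{V \<in> borel_measurable P. \<forall>\<omega>. X \<omega> \<le> V \<omega>}. \<integral>\<^sup>+\<omega>. V \<omega> \<partial>P)"

definition ennreal_powr :: "ennreal \<Rightarrow> real \<Rightarrow> ennreal" where
  "ennreal_powr x r = (if x = \<top> then \<top> else ennreal (enn2real x powr r))"

definition jointly_measurable ::
  "real \<Rightarrow> (real \<Rightarrow> ('d::finite) path \<Rightarrow> real) \<Rightarrow> bool" where
  "jointly_measurable T \<eta> \<longleftrightarrow>
     (\<lambda>(s, \<omega>). \<eta> s \<omega>) \<in> borel_measurable (restrict_space borel {0..T} \<Otimes>\<^sub>M borel)"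

definition H0_G :: "real \<Rightarrow> (real \<Rightarrow> ('d::finite) path \<Rightarrow> real) set" where
  "H0_G T = {\<eta>. \<exists>N t \<xi>. t 0 = 0 \<and> t N = T \<and> (\<forall>j<N. t j < t (Suc j)) \<and>
     (\<forall>j<N. \<xi> j \<in> L_ip (t j)) \<and>
     \<eta> = (\<lambda>s \<omega>. \<Sum>j<N. \<xi> j \<omega> * indicator {t j..<t (Suc j)} s)}"

definition H_G_norm ::
  "('d::finite) path measure set \<Rightarrow> real \<Rightarrow> real \<Rightarrow> (real \<Rightarrow> 'd path \<Rightarrow> real) \<Rightarrow> ennreal" where
  "H_G_norm \<P> p T \<eta> = ennreal_powr
     (upper_expectation \<P>
        (\<lambda>\<omega>. ennreal_powr (\<integral>\<^sup>+s\<in>{0..T}. ennreal (\<bar>\<eta> s \<omega>\<bar>\<^sup>2) \<partial>lborel) (p/2))) (1/p)"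

text \<open>
  The completions are realised as sets of processes rather than as sets of equivalence classes: a
  process belongs to the space when it is a measurable representative of an element of the abstract
  completion, that is, a limit of elements of the dense subspace in the completing norm.  Only
  times in \<open>[0,T]\<close> are relevant.
\<close>

definition H_G ::
  "('d::finite) path measure set \<Rightarrow> real \<Rightarrow> real \<Rightarrow> (real \<Rightarrow> 'd path \<Rightarrow> real) set" where
  "H_G \<P> p T = {\<eta>. jointly_measurable T \<eta> \<and>
     (\<exists>h. (\<forall>n. h n \<in> H0_G T) \<and> (\<lambda>n. H_G_norm \<P> p T (\<lambda>s \<omega>. \<eta> s \<omega> - h n s \<omega>)) \<longlonglongrightarrow> 0)}"

text \<open>Vector-valued version, with components taken along \<open>Basis\<close>; it also covers \<open>k = 1\<close>.\<close>

definition H_G_vec ::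
  "('d::finite) path measure set \<Rightarrow> real \<Rightarrow> real \<Rightarrow> (real \<Rightarrow> 'd path \<Rightarrow> 'k::euclidean_space) set" where
  "H_G_vec \<P> p T = {\<eta>. \<forall>e\<in>Basis. (\<lambda>s \<omega>. \<eta> s \<omega> \<bullet> e) \<in> H_G \<P> p T}"

definition S0_G :: "real \<Rightarrow> (real \<Rightarrow> ('d::finite) path \<Rightarrow> real) set" where
  "S0_G T = {Y. \<exists>(n::nat) t h. (\<forall>i<n. t i \<in> {0..T}) \<and>
     bounded (range (\<lambda>(s, x). h s x)) \<and>
     (\<exists>C. \<forall>s s' x x'. \<bar>h s x - h s' x'\<bar> \<le> C * (\<bar>s - s'\<bar> + (\<Sum>i<n. norm (x i - x' i)))) \<and>
     Y = (\<lambda>s \<omega>. h s (\<lambda>i. path_at \<omega> (min (t i) s)))}"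

definition S_G_norm ::
  "('d::finite) path measure set \<Rightarrow> real \<Rightarrow> real \<Rightarrow> (real \<Rightarrow> 'd path \<Rightarrow> real) \<Rightarrow> ennreal" where
  "S_G_norm \<P> p T Y = ennreal_powr
     (upper_expectation \<P> (\<lambda>\<omega>. SUP s\<in>{0..T}. ennreal (\<bar>Y s \<omega>\<bar> powr p))) (1/p)"

definition S_G ::
  "('d::finite) path measure set \<Rightarrow> real \<Rightarrow> real \<Rightarrow> (real \<Rightarrow> 'd path \<Rightarrow> real) set" where
  "S_G \<P> p T = {Y. jointly_measurable T Y \<and>
     (\<exists>h. (\<forall>n. h n \<in> S0_G T) \<and> (\<lambda>n. S_G_norm \<P> p T (\<lambda>s \<omega>. Y s \<omega> - h n s \<omega>)) \<longlonglongrightarrow> 0)}"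


section \<open>G-BMO martingale generators\<close>

definition natural_filtration :: "real \<Rightarrow> ('d::finite) path measure" where
  "natural_filtration t = sigma UNIV {(\<lambda>\<omega>. path_at \<omega> s) -` A |s A. 0 \<le> s \<and> s \<le> t \<and> A \<in> sets borel}"

lemma filtration_natural_filtration: "filtration UNIV natural_filtration"
proof
  fix i j :: real assume "i \<le> j"
  then show "sets (natural_filtration i :: 'a path measure) \<subseteq> sets (natural_filtration j)"
    unfolding natural_filtration_def
    by simp (intro sigma_sets_mono' Collect_mono; metis order_trans)
qed (simp add: natural_filtration_def)

abbreviation stopped_sigma :: "(('d::finite) path \<Rightarrow> real) \<Rightarrow> 'd path measure" where
  "stopped_sigma \<tau> \<equiv> filtration.pre_sigma UNIV natural_filtration \<tau>"

definition G_BMO_generator ::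
  "('d::finite) path measure set \<Rightarrow> real \<Rightarrow> (real \<Rightarrow> 'd path \<Rightarrow> 'k::euclidean_space) \<Rightarrow> bool" where
  "G_BMO_generator \<P> T l \<longleftrightarrow> l \<in> H_G_vec \<P> 2 T \<and>
     (SUP P\<in>\<P>. SUP \<tau>\<in>{\<tau>. stopping_time natural_filtration \<tau> \<and> (\<forall>\<omega>. \<tau> \<omega> \<in> {0..T})}.
        esssup P (nn_cond_exp P (stopped_sigma \<tau>)
          (\<lambda>\<omega>. \<integral>\<^sup>+s\<in>{\<tau> \<omega>..T}. ennreal ((norm (l s \<omega>))\<^sup>2) \<partial>lborel))) < \<infinity>"


section \<open>Assumptions on the coefficients\<close>

type_synonym 'd coefficient = "real \<Rightarrow> 'd path \<Rightarrow> real \<Rightarrow> real^'d \<Rightarrow> real"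

definition modulus_of_continuity :: "(real \<Rightarrow> real) \<Rightarrow> bool" where
  "modulus_of_continuity w \<longleftrightarrow>
     w 0 = 0 \<and> mono_on {0..} w \<and> (w \<longlongrightarrow> 0) (at_right 0)"

definition A0 :: "('d::finite) coefficient \<Rightarrow> bool" where
  "A0 h \<longleftrightarrow> (\<forall>T>0. \<forall>t\<in>{0..T}. \<forall>\<omega> y z. h t \<omega> y z = h t (stopped_path t \<omega>) y z)"

definition A1 :: "real \<Rightarrow> ('d::finite) coefficient \<Rightarrow> bool" where
  "A1 M\<^sub>0 h \<longleftrightarrow> (\<forall>T>0. \<forall>t\<in>{0..T}. \<forall>\<omega>. \<bar>h t \<omega> 0 0\<bar> \<le> M\<^sub>0)"

definition A2 :: "(real \<Rightarrow> real) \<Rightarrow> ('d::finite) coefficient \<Rightarrow> bool" where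
  "A2 w h \<longleftrightarrow> (\<forall>T>0. \<forall>t\<in>{0..T}. \<forall>t'\<in>{0..T}. \<forall>\<omega> \<omega>' y z.
     \<bar>h t \<omega> y z - h t' \<omega>' y z\<bar> \<le> w (\<bar>t - t'\<bar> + sup_dist T \<omega> \<omega>'))"

definition A3 :: "real \<Rightarrow> real \<Rightarrow> ('d::finite) coefficient \<Rightarrow> bool" where
  "A3 L\<^sub>y L\<^sub>z h \<longleftrightarrow> (\<forall>T>0. \<forall>t\<in>{0..T}. \<forall>\<omega> y y' z z'.
     \<bar>h t \<omega> y z - h t \<omega> y' z'\<bar> \<le> L\<^sub>y * \<bar>y - y'\<bar> + L\<^sub>z * (1 + norm z + norm z') * norm (z - z'))"

definition assumptions_A :: "real \<Rightarrow> real \<Rightarrow> real \<Rightarrow> ('d::finite) coefficient \<Rightarrow> bool" where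
  "assumptions_A M\<^sub>0 L\<^sub>y L\<^sub>z h \<longleftrightarrow>
     A0 h \<and> A1 M\<^sub>0 h \<and> (\<exists>w. modulus_of_continuity w \<and> A2 w h) \<and> A3 L\<^sub>y L\<^sub>z h"

definition assumption_M ::
  "(real^'d^'d \<Rightarrow> real) \<Rightarrow> real \<Rightarrow> ('d::finite) coefficient \<Rightarrow> ('d \<Rightarrow> 'd \<Rightarrow> 'd coefficient) \<Rightarrow> bool" where
  "assumption_M G \<mu> f g \<longleftrightarrow> (\<forall>t\<ge>0. \<forall>\<omega> y y' z.
     (y - y') * (f t \<omega> y z - f t \<omega> y' z)
       + 2 * G (\<chi> i j. (y - y') * (g i j t \<omega> y z - g i j t \<omega> y' z))
     \<le> - \<mu> * \<bar>y - y'\<bar>\<^sup>2)"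

end

theory Submission
  imports Defs
begin

text \<open>
  For \<open>\<bar>y - y'\<bar> \<ge> \<epsilon>\<close> the coefficient \<open>a\<close> is the difference quotient of \<open>f\<close> in \<open>y\<close>; for smaller increments
  it is a convex combination of this quotient and the constant \<open>-L\<^sub>y\<close>, and likewise for \<open>c\<close>.  The quotients
  satisfy \<open>a + 2 G(c) \<le> -\<mu>\<close> by (M), the constants by (L), and convexity of \<open>G\<close> carries the inequality
  over to the combination.  The coefficients \<open>b\<close> and \<open>d\<close> come from the increment in \<open>z\<close> in the same way, and
  \<open>m\<close>, \<open>n\<close> collect what is cut off, which is of order \<open>\<epsilon>\<close>.

  All these are random fields that are uniformly continuous in time, path and (on bounded sets) space, with
  at most linear growth.  Substituting processes of \<open>H\<^sup>2\<^sub>G\<close> into such a field gives again a process of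
  \<open>H\<^sup>2\<^sub>G\<close>: truncate in space, interpolate the path linearly on a grid, and regularise by inf-convolution to
  obtain Lipschitz cylinder functionals.  The interpolation error is bounded by the oscillation of the path,
  whose expectation tends to 0 uniformly over the weakly compact family by Dini's theorem.
\<close>

text \<open>Over a family of measures without a dominating one, pointwise convergence gives no
  convergence in the norm, so membership in \<open>H_G\<close> has to come from moduli that are
  uniform in the path. A bare difference quotient has none near y = y'; this is why it is blended
  into a default value by a continuous weight and not switched off. The default
  -\<open>L\<^sub>y\<close> is the extreme value allowed by the bound on a and c. Placed in a and in
  every entry of c it gives -\<open>L\<^sub>y\<close> (1 - 2 G(-J)) with J the matrix of ones, and
  (L) says exactly that this is at most -\<mu>. The increment is split at the point (y', z), which
  explains why a and c do not see z' and b and d do not see y. All moduli are expressed through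
  stopped paths: (A0) and (A2) merge into one estimate, and an approximation at time t is
  automatically a functional of positions before t. The oscillation enters only truncated at 1,
  because weak compactness tests measures against bounded continuous functions; no moments of the
  paths are used.\<close>

section \<open>Uniform distance and metric on the path space\<close>

lemma sup_dist_commute: "sup_dist T \<omega> \<omega>' = sup_dist T \<omega>' \<omega>"
  unfolding sup_dist_def by (simp add: dist_commute)

text \<open>One term of the series defining the metric suffices: for k >= T the k-th term already
  dominates the uniform distance on [0,T], up to its weight and the truncation at 1.\<close>

lemma sup_dist_less_if_dist_path:
  assumes "0 \<le> T" "0 < e"
  shows "\<exists>d>0. \<forall>\<omega> \<omega>'. dist \<omega> \<omega>' < d \<longrightarrow> sup_dist T \<omega> \<omega>' < e"
proof -
  obtain k :: nat where k: "T \<le> real k" using real_arch_simple by blast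
  define d where "d = (1/2::real) ^ Suc k * min 1 e"
  have "sup_dist T \<omega> \<omega>' < e" if "dist \<omega> \<omega>' < d" for \<omega> \<omega>' :: "'a path"
  proof -
    have summ: "summable (\<lambda>k. (1/2::real) ^ Suc k * min 1 (sup_dist (real (Suc k)) \<omega> \<omega>'))"
    proof (rule summable_comparison_test')
      show "summable (\<lambda>k. (1/2::real) ^ Suc k)"
        by (subst summable_Suc_iff) (auto intro: summable_geometric)
      show "norm ((1/2::real) ^ Suc k * min 1 (sup_dist (real (Suc k)) \<omega> \<omega>')) \<le> (1/2) ^ Suc k" for k
        using sup_dist_nonneg[of "real (Suc k)" \<omega> \<omega>'] by (simp add: abs_mult mult_le_cancel_left1)
    qed
    have "(\<Sum>k\<in>{k}. (1/2::real) ^ Suc k * min 1 (sup_dist (real (Suc k)) \<omega> \<omega>')) \<le> dist \<omega> \<omega>'"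
      unfolding dist_path_def by (rule sum_le_suminf[OF summ]) (auto simp: sup_dist_nonneg)
    then have "(1/2::real) ^ Suc k * min 1 (sup_dist (real (Suc k)) \<omega> \<omega>') \<le> dist \<omega> \<omega>'"
      by (simp only: sum.insert finite.emptyI empty_iff not_False_eq_True sum.empty add_0_right)
    also note that[unfolded d_def]
    finally have "(1/2::real) ^ Suc k * min 1 (sup_dist (real (Suc k)) \<omega> \<omega>') < (1/2) ^ Suc k * min 1 e" .
    then have "min 1 (sup_dist (real (Suc k)) \<omega> \<omega>') < min 1 e"
      by (rule mult_left_less_imp_less) simp
    then have "sup_dist (real (Suc k)) \<omega> \<omega>' < e" by linarith
    moreover have "sup_dist T \<omega> \<omega>' \<le> sup_dist (real (Suc k)) \<omega> \<omega>'"
      using assms k by (intro sup_dist_le dist_le_sup_dist) auto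
    ultimately show ?thesis by simp
  qed
  moreover have "0 < d" using assms by (simp add: d_def)
  ultimately show ?thesis by blast
qed

text \<open>The bridge from estimates in \<open>sup_dist\<close> to continuity for the metric, hence
  to Borel measurability and to test functions of the weak topology.\<close>

lemma continuous_on_if_le_sup_dist:
  fixes X :: "('d::finite) path \<Rightarrow> 'a::metric_space"
  assumes "0 \<le> T" and "\<And>\<omega> \<omega>'. dist (X \<omega>) (X \<omega>') \<le> C * sup_dist T \<omega> \<omega>'"
  shows "continuous_on UNIV X"
  unfolding continuous_on_iff
proof (intro ballI allI impI)
  fix \<omega> :: "'d path" and e :: real assume "0 < e"
  \<comment> \<open>The given constant may be zero or negative, but the radius is obtained by
    dividing by it.\<close>
  define c where "c = max C 1"
  have c: "0 < c" "C \<le> c" by (auto simp: c_def)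
  obtain d where d: "d > 0" "\<And>\<omega> \<omega>'::'d path. dist \<omega> \<omega>' < d \<Longrightarrow> sup_dist T \<omega> \<omega>' < e / c"
    using sup_dist_less_if_dist_path[of T "e / c"] assms(1) c \<open>0 < e\<close> by auto
  have "dist (X \<omega>') (X \<omega>) < e" if "dist \<omega>' \<omega> < d" for \<omega>'
  proof -
    have "dist (X \<omega>') (X \<omega>) \<le> C * sup_dist T \<omega>' \<omega>" by (rule assms(2))
    also have "\<dots> \<le> c * sup_dist T \<omega>' \<omega>"
      using c sup_dist_nonneg[OF assms(1)] by (intro mult_right_mono) auto
    also have "\<dots> < c * (e / c)" using d(2)[OF that] c by (intro mult_strict_left_mono) auto
    finally show ?thesis using c by simp
  qed
  then show "\<exists>d>0. \<forall>\<omega>'\<in>UNIV. dist \<omega>' \<omega> < d \<longrightarrow> dist (X \<omega>') (X \<omega>) < e" using d(1) by auto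
qed

lemma continuous_on_path_eval: "continuous_on UNIV (\<lambda>\<omega>. path_at \<omega> t)"
proof (rule continuous_on_if_le_sup_dist[of "max t 0" _ 1])
  show "dist (path_at \<omega> t) (path_at \<omega>' t) \<le> 1 * sup_dist (max t 0) \<omega> \<omega>'" for \<omega> \<omega>' :: "'a path"
    using dist_le_sup_dist[of t "max t 0" \<omega> \<omega>'] sup_dist_nonneg[of "max t 0" \<omega> \<omega>']
    by (cases "t < 0") (auto simp: path_at_nonpos)
qed auto

lemma sup_dist_stopped_path_le:
  "0 \<le> T \<Longrightarrow> 0 \<le> t \<Longrightarrow> sup_dist T (stopped_path t \<omega>) (stopped_path t \<omega>') \<le> sup_dist T \<omega> \<omega>'"
  by (rule sup_dist_le) (auto simp: path_at_stopped_path intro!: dist_le_sup_dist)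

text \<open>Stopping both paths builds non-anticipation into the distance: a field that is uniformly
  continuous for it sees the path only up to its own time.\<close>

abbreviation path_time_dist :: "real \<Rightarrow> real \<Rightarrow> ('d::finite) path \<Rightarrow> real \<Rightarrow> 'd path \<Rightarrow> real" where
  "path_time_dist T s \<omega> s' \<omega>' \<equiv> \<bar>s - s'\<bar> + sup_dist T (stopped_path s \<omega>) (stopped_path s' \<omega>')"

section \<open>The modulus of continuity of a path\<close>

definition osc :: "real \<Rightarrow> real \<Rightarrow> ('d::finite) path \<Rightarrow> real" where
  "osc T \<delta> \<omega> = (SUP (u, v)\<in>{(u, v). u \<in> {0..T} \<and> v \<in> {0..T} \<and> \<bar>u - v\<bar> \<le> \<delta>}. dist (path_at \<omega> u) (path_at \<omega> v))"

text \<open>A path is bounded on the compact interval, so the supremum in \<open>osc\<close> is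
  taken over a bounded set.\<close>

lemma dist_le_osc:
  assumes "u \<in> {0..T}" "v \<in> {0..T}" "\<bar>u - v\<bar> \<le> \<delta>"
  shows "dist (path_at \<omega> u) (path_at \<omega> v) \<le> osc T \<delta> \<omega>"
proof -
  have "compact (path_at \<omega> ` {0..T})"
    by (intro compact_continuous_image continuous_on_path_at) auto
  then have "bounded (path_at \<omega> ` {0..T})" by (rule compact_imp_bounded)
  then have "\<exists>C. \<forall>u\<in>{0..T}. norm (path_at \<omega> u) \<le> C"
    unfolding bounded_iff by simp
  then obtain C where C: "\<And>u. u \<in> {0..T} \<Longrightarrow> norm (path_at \<omega> u) \<le> C"
    by blast
  have "dist (path_at \<omega> u) (path_at \<omega> v) \<le> C + C" if "u \<in> {0..T}" "v \<in> {0..T}" for u v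
    using norm_triangle_ineq4[of "path_at \<omega> u" "path_at \<omega> v"] C[OF that(1)] C[OF that(2)]
    unfolding dist_norm by linarith
  then show ?thesis unfolding osc_def
    by (intro cSUP_upper2[where x="(u, v)"] bdd_aboveI2[where M="C + C"]) (use assms in auto)
qed

lemma osc_le:
  assumes "0 \<le> T" "0 \<le> \<delta>"
    "\<And>u v. u \<in> {0..T} \<Longrightarrow> v \<in> {0..T} \<Longrightarrow> \<bar>u - v\<bar> \<le> \<delta> \<Longrightarrow> dist (path_at \<omega> u) (path_at \<omega> v) \<le> c"
  shows "osc T \<delta> \<omega> \<le> c"
  unfolding osc_def
  by (rule cSUP_least) (use assms in \<open>auto intro!: exI[of _ "0::real"] exI[of _ "(0::real, 0::real)"]\<close>)

lemma osc_nonneg: "0 \<le> T \<Longrightarrow> 0 \<le> \<delta> \<Longrightarrow> 0 \<le> osc T \<delta> \<omega>"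
  using dist_le_osc[of 0 T 0 \<delta> \<omega>] by simp

lemma osc_mono: "0 \<le> T \<Longrightarrow> 0 \<le> \<delta> \<Longrightarrow> \<delta> \<le> \<delta>' \<Longrightarrow> osc T \<delta> \<omega> \<le> osc T \<delta>' \<omega>"
  by (rule osc_le) (auto intro: dist_le_osc)

lemma osc_stopped_path_le:
  assumes "0 \<le> T" "0 \<le> \<delta>" "0 \<le> t"
  shows "osc T \<delta> (stopped_path t \<omega>) \<le> osc T \<delta> \<omega>"
  using assms by (intro osc_le) (auto simp: path_at_stopped_path intro!: dist_le_osc)

text \<open>Each of the two endpoints moves by at most the uniform distance; this makes
  \<open>osc\<close> a Lipschitz functional of the path.\<close>

lemma osc_le_sup_dist:
  assumes "0 \<le> T" "0 \<le> \<delta>"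
  shows "osc T \<delta> \<omega> \<le> osc T \<delta> \<omega>' + 2 * sup_dist T \<omega> \<omega>'"
proof (rule osc_le[OF assms])
  fix u v assume uv: "u \<in> {0..T}" "v \<in> {0..T}" "\<bar>u - v\<bar> \<le> \<delta>"
  have "dist (path_at \<omega> u) (path_at \<omega> v) \<le> dist (path_at \<omega> u) (path_at \<omega>' u)
      + dist (path_at \<omega>' u) (path_at \<omega>' v) + dist (path_at \<omega> v) (path_at \<omega>' v)"
    by metric
  then show "dist (path_at \<omega> u) (path_at \<omega> v) \<le> osc T \<delta> \<omega>' + 2 * sup_dist T \<omega> \<omega>'"
    using dist_le_osc[OF uv, of \<omega>'] dist_le_sup_dist[of u T \<omega> \<omega>'] dist_le_sup_dist[of v T \<omega> \<omega>'] uv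
    by auto
qed

lemma continuous_on_osc: "0 \<le> T \<Longrightarrow> 0 \<le> \<delta> \<Longrightarrow> continuous_on UNIV (osc T \<delta> :: ('d::finite) path \<Rightarrow> real)"
proof (rule continuous_on_if_le_sup_dist[of T _ 2])
  fix \<omega> \<omega>' :: "'d path" assume "0 \<le> T" "0 \<le> \<delta>"
  then show "dist (osc T \<delta> \<omega>) (osc T \<delta> \<omega>') \<le> 2 * sup_dist T \<omega> \<omega>'"
    using osc_le_sup_dist[of T \<delta> \<omega> \<omega>'] osc_le_sup_dist[of T \<delta> \<omega>' \<omega>]
    by (simp add: dist_real_def sup_dist_commute[of T \<omega>' \<omega>])
qed auto

text \<open>Uniform continuity of a single path on [0,T]; it supplies the pointwise convergence
  needed for Dini's theorem.\<close>

lemma osc_tendsto_0: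
  assumes "0 \<le> T" "0 < e"
  shows "\<exists>d>0. osc T d \<omega> \<le> e"
proof -
  have "uniformly_continuous_on {0..T} (path_at \<omega>)"
    by (intro compact_uniformly_continuous continuous_on_path_at) auto
  then obtain d where d: "d > 0" "\<And>u v. u \<in> {0..T} \<Longrightarrow> v \<in> {0..T} \<Longrightarrow> dist v u < d
      \<Longrightarrow> dist (path_at \<omega> v) (path_at \<omega> u) < e"
    unfolding uniformly_continuous_on_def using assms(2) by metis
  have "osc T (d/2) \<omega> \<le> e"
    using assms d(1) by (intro osc_le less_imp_le[OF d(2)]) (auto simp: dist_real_def)
  with d(1) show ?thesis by (intro exI[of _ "d/2"]) auto
qed

section \<open>Dini's theorem for weakly compact families\<close>

text \<open>The measures for which the n-th integral lies below e form a weakly open set. Dominated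
  convergence under each single measure shows that these sets cover the family; a finite subcover
  exists, and since the functions decrease in n its largest index works for all measures.\<close>

lemma weak_topology_nn_integral_small:
  fixes X :: "nat \<Rightarrow> ('a::{topological_space}) \<Rightarrow> real"
  assumes comp: "compactin weak_topology \<P>"
    and cont: "\<And>n. continuous_on UNIV (X n)"
    and range: "\<And>n \<omega>. X n \<omega> \<in> {0..1}"
    and decr: "\<And>n \<omega>. X (Suc n) \<omega> \<le> X n \<omega>"
    and lim: "\<And>\<omega>. (\<lambda>n. X n \<omega>) \<longlonglongrightarrow> 0"
    and e: "0 < e"
  shows "\<exists>n. \<forall>P\<in>\<P> \<inter> borel_probabilities. (\<integral>\<^sup>+\<omega>. ennreal (X n \<omega>) \<partial>P) \<le> ennreal e"
proof -
  define U where "U n = {P \<in> borel_probabilities. (\<integral>\<omega>. X n \<omega> \<partial>P) \<in> {..<e}}" for n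
  have int: "integrable P (X n)" if "P \<in> borel_probabilities" for P n
  proof -
    interpret prob_space P using that by (auto simp: borel_probabilities_def)
    have "X n \<in> borel_measurable P"
      using that borel_measurable_continuous_onI[OF cont]
      by (simp add: borel_probabilities_def cong: measurable_cong_sets)
    then show ?thesis using range by (intro integrable_const_bound[of _ 1]) simp_all
  qed
  have sub: "\<P> \<subseteq> topspace weak_topology" using comp by (simp add: compactin_def)
  also have "\<dots> \<subseteq> borel_probabilities"
    unfolding weak_topology_def topology_generated_by_topspace by auto
  finally have PB: "\<P> \<subseteq> borel_probabilities" .
  have "openin weak_topology (U n)" for n
  proof -
    have "bounded (range (X n))"
    proof (rule boundedI)
      fix x assume "x \<in> range (X n)"
      then show "norm x \<le> 1" using range[of n] by auto
    qed
    then show ?thesis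
      unfolding weak_topology_def U_def
      using cont[of n] by (intro topology_generated_by_Basis CollectI exI[of _ "X n"] exI[of _ "{..<e}"]) simp
  qed
  moreover have "\<P> \<subseteq> \<Union>(range U)"
  proof
    fix P assume "P \<in> \<P>"
    then have P: "P \<in> borel_probabilities" using PB by auto
    then interpret prob_space P by (auto simp: borel_probabilities_def)
    have "(\<lambda>n. \<integral>\<omega>. X n \<omega> \<partial>P) \<longlonglongrightarrow> (\<integral>\<omega>. 0 \<partial>P)"
      using int[OF P] range lim
      by (intro integral_dominated_convergence[where w="\<lambda>_. 1"]) auto
    then have "eventually (\<lambda>n. (\<integral>\<omega>. X n \<omega> \<partial>P) < e) sequentially"
      using e by (intro order_tendstoD(2)) auto
    then show "P \<in> \<Union>(range U)"
      using P by (auto simp: U_def eventually_sequentially)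
  qed
  ultimately have "\<exists>\<F>. finite \<F> \<and> \<F> \<subseteq> range U \<and> \<P> \<subseteq> \<Union>\<F>"
    using comp[unfolded compactin_def, THEN conjunct2, rule_format, of "range U"] by blast
  then obtain \<F> where F: "finite \<F>" "\<F> \<subseteq> range U" "\<P> \<subseteq> \<Union>\<F>" by blast
  obtain N where N: "finite N" "\<P> \<subseteq> \<Union>(U ` N)"
    using finite_subset_image[OF F(1,2)] F(3) by blast
  \<comment> \<open>Inserting 0 covers the case of an empty subcover.\<close>
  define n where "n = Max (insert 0 N)"
  have decr': "X n \<omega> \<le> X k \<omega>" if "k \<in> N" for k \<omega>
    using lift_Suc_antimono_le[of "\<lambda>n. X n \<omega>" k n] decr N(1) that by (auto simp: n_def)
  have "(\<integral>\<^sup>+\<omega>. ennreal (X n \<omega>) \<partial>P) \<le> ennreal e" if PP: "P \<in> \<P>" for P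
  proof -
    have P: "P \<in> borel_probabilities" using PB PP by auto
    obtain k where k: "k \<in> N" "P \<in> U k" using N(2) PP by auto
    have "(\<integral>\<omega>. X n \<omega> \<partial>P) \<le> (\<integral>\<omega>. X k \<omega> \<partial>P)"
      by (rule integral_mono[OF int[OF P] int[OF P]]) (rule decr'[OF k(1)])
    then have "(\<integral>\<omega>. X n \<omega> \<partial>P) \<le> e" using k(2) by (auto simp: U_def)
    then show ?thesis
      using range by (subst nn_integral_eq_integral[OF int[OF P]]) (simp_all add: ennreal_leI)
  qed
  then show ?thesis by blast
qed

text \<open>The truncation at 1 makes the oscillation an admissible bounded test function. The upper
  limit r on \<delta> lets the caller keep the time mesh small at the same time.\<close>

lemma osc_small_uniformly:
  fixes \<P> :: "('d::finite) path measure set"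
  assumes "compactin weak_topology \<P>" "\<P> \<subseteq> borel_probabilities" "0 \<le> T" "0 < e" "0 < r"
  shows "\<exists>\<delta>>0. \<delta> \<le> r \<and> (\<forall>P\<in>\<P>. (\<integral>\<^sup>+\<omega>. ennreal (min 1 (osc T \<delta> \<omega>)) \<partial>P) \<le> ennreal e)"
proof -
  define \<delta> where "\<delta> n = r / real (Suc n)" for n
  have \<delta>: "0 < \<delta> n" "\<delta> (Suc n) \<le> \<delta> n" "\<delta> n \<le> r" for n
    using \<open>0 < r\<close> by (auto simp: \<delta>_def field_simps)
  have "\<exists>n. \<forall>P\<in>\<P> \<inter> borel_probabilities.
      (\<integral>\<^sup>+\<omega>. ennreal (min 1 (osc T (\<delta> n) \<omega>)) \<partial>P) \<le> ennreal e"
  proof (rule weak_topology_nn_integral_small[OF assms(1) _ _ _ _ assms(4)])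
    show "continuous_on UNIV (\<lambda>\<omega>::'d path. min 1 (osc T (\<delta> n) \<omega>))" for n
      using assms(3) \<delta>(1)[of n] by (intro continuous_intros continuous_on_osc) auto
    show "min 1 (osc T (\<delta> n) \<omega>) \<in> {0..1}" for n and \<omega> :: "'d path"
      using osc_nonneg[OF assms(3), of "\<delta> n" \<omega>] \<delta>(1)[of n] by auto
    show "min 1 (osc T (\<delta> (Suc n)) \<omega>) \<le> min 1 (osc T (\<delta> n) \<omega>)" for n and \<omega> :: "'d path"
      using osc_mono[OF assms(3), of "\<delta> (Suc n)" "\<delta> n" \<omega>] \<delta>(1)[of "Suc n"] \<delta>(2)[of n]
      by (auto simp: min_def)
    fix \<omega> :: "'d path"
    show "(\<lambda>n. min 1 (osc T (\<delta> n) \<omega>)) \<longlonglongrightarrow> 0"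
    proof (rule LIMSEQ_I)
      fix c :: real assume "0 < c"
      then obtain d where d: "d > 0" "osc T d \<omega> \<le> c/2"
        using osc_tendsto_0[OF assms(3), of "c/2" \<omega>] by auto
      have "\<delta> \<longlonglongrightarrow> 0" unfolding \<delta>_def by (rule LIMSEQ_Suc[OF lim_const_over_n])
      then obtain N where N: "\<And>n. n \<ge> N \<Longrightarrow> \<delta> n < d"
        using order_tendstoD(2)[of \<delta> 0 sequentially d] d(1) by (auto simp: eventually_sequentially)
      have "norm (min 1 (osc T (\<delta> n) \<omega>) - 0) < c" if "n \<ge> N" for n
        using osc_mono[OF assms(3), of "\<delta> n" d \<omega>] N[OF that] \<delta>(1)[of n] d(2) \<open>0 < c\<close>
          osc_nonneg[OF assms(3), of "\<delta> n" \<omega>] by auto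
      then show "\<exists>N. \<forall>n\<ge>N. norm (min 1 (osc T (\<delta> n) \<omega>) - 0) < c" by blast
    qed
  qed
  then obtain n where n: "\<forall>P\<in>\<P> \<inter> borel_probabilities.
      (\<integral>\<^sup>+\<omega>. ennreal (min 1 (osc T (\<delta> n) \<omega>)) \<partial>P) \<le> ennreal e" ..
  show ?thesis
  proof (intro exI conjI ballI)
    show "0 < \<delta> n" "\<delta> n \<le> r" by (fact \<delta>)+
  qed (use n assms(2) in blast)
qed

section \<open>Piecewise linear interpolation\<close>

text \<open>The clamp is 0 before the k-th cell, 1 after it and linear inside, so this is the
  polygon through the values x k - x 0 at the times k T / n. Continuity in time and dependence on
  the nodes can be read off without a case distinction over cells.\<close>

definition interp :: "real \<Rightarrow> nat \<Rightarrow> (nat \<Rightarrow> real^'d::finite) \<Rightarrow> 'd path" where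
  "interp T n x = Abs_path (\<lambda>u. \<Sum>k<n. max 0 (min 1 (u * n / T - k)) *\<^sub>R (x (Suc k) - x k))"

lemma path_at_interp:
  assumes "0 < T"
  shows "path_at (interp T n x) u = (\<Sum>k<n. max 0 (min 1 (u * n / T - k)) *\<^sub>R (x (Suc k) - x k))"
proof -
  have "continuous_on UNIV (\<lambda>u::real. \<Sum>k<n. max 0 (min 1 (u * n / T - k)) *\<^sub>R (x (Suc k) - x k))"
    using assms by (intro continuous_intros) auto
  moreover have "(\<Sum>k<n. max 0 (min 1 (u * n / T - k)) *\<^sub>R (x (Suc k) - x k)) = 0" if "u \<le> 0" for u :: real
  proof -
    have "u * n / T \<le> 0" using assms that by (simp add: divide_nonpos_pos mult_nonpos_nonneg)
    then have "min 1 (u * n / T - real k) \<le> 0" for k by (intro min.coboundedI2) linarith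
    then show ?thesis by (simp add: max_absorb1)
  qed
  ultimately have "(\<lambda>u::real. \<Sum>k<n. max 0 (min 1 (u * n / T - k)) *\<^sub>R (x (Suc k) - x k))
      \<in> {\<omega>. continuous_on UNIV \<omega> \<and> (\<forall>t\<le>0. \<omega> t = 0)}"
    by blast
  from Abs_path_inverse[OF this] show ?thesis unfolding interp_def by simp
qed

text \<open>All clamps lie in [0,1]. The bound grows with n, which is harmless because n is fixed
  before a radius is chosen.\<close>

lemma sup_dist_interp_le:
  assumes "0 < T"
  shows "sup_dist T (interp T n x) (interp T n x') \<le> (\<Sum>k<n. norm (x (Suc k) - x' (Suc k)) + norm (x k - x' k))"
proof (rule sup_dist_le)
  fix u :: real
  have "dist (path_at (interp T n x) u) (path_at (interp T n x') u)
      = norm (\<Sum>k<n. max 0 (min 1 (u * n / T - k)) *\<^sub>R ((x (Suc k) - x k) - (x' (Suc k) - x' k)))"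
    by (simp add: path_at_interp[OF assms] dist_norm scaleR_diff_right sum_subtractf)
  also have "\<dots> \<le> (\<Sum>k<n. norm (x (Suc k) - x' (Suc k)) + norm (x k - x' k))"
  proof (rule sum_norm_le)
    fix k
    have "norm (max 0 (min 1 (u * n / T - k)) *\<^sub>R ((x (Suc k) - x k) - (x' (Suc k) - x' k)))
        \<le> 1 * norm ((x (Suc k) - x' (Suc k)) - (x k - x' k))"
      unfolding norm_scaleR by (intro mult_mono) (auto simp: algebra_simps)
    also have "\<dots> \<le> norm (x (Suc k) - x' (Suc k)) + norm (x k - x' k)"
      using norm_triangle_ineq4 by auto
    finally show "norm (max 0 (min 1 (u * n / T - k)) *\<^sub>R ((x (Suc k) - x k) - (x' (Suc k) - x' k)))
        \<le> norm (x (Suc k) - x' (Suc k)) + norm (x k - x' k)" .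
  qed
  finally show "dist (path_at (interp T n x) u) (path_at (interp T n x') u)
      \<le> (\<Sum>k<n. norm (x (Suc k) - x' (Suc k)) + norm (x k - x' k))" .
qed (use assms in auto)

lemma sum_clamp_telescope:
  fixes a :: "nat \<Rightarrow> 'a::real_vector"
  assumes "real n \<le> v"
  shows "(\<Sum>k<n. max 0 (min 1 (v - real k)) *\<^sub>R (a (Suc k) - a k)) = a n - a 0"
proof -
  have "(\<Sum>k<n. max 0 (min 1 (v - real k)) *\<^sub>R (a (Suc k) - a k)) = (\<Sum>k<n. a (Suc k) - a k)"
  proof (rule sum.cong[OF refl])
    fix k assume "k \<in> {..<n}"
    then have "real k + 1 \<le> v" using assms by auto
    then have "max 0 (min 1 (v - real k)) = 1" by (simp add: min_absorb1)
    then show "max 0 (min 1 (v - real k)) *\<^sub>R (a (Suc k) - a k) = a (Suc k) - a k" by simp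
  qed
  then show ?thesis by (simp add: sum_lessThan_telescope)
qed

text \<open>Induction on the number of cells: either v lies in an earlier cell and the last clamp
  vanishes, or v lies in the last cell and all previous increments telescope.\<close>

lemma sum_clamp_between:
  fixes a :: "nat \<Rightarrow> 'a::real_vector"
  assumes "0 \<le> v" "v \<le> real n" "0 < n" "a 0 = 0"
  shows "\<exists>k<n. \<exists>l\<in>{0..1}. real k \<le> v \<and> v \<le> real (Suc k)
    \<and> (\<Sum>k<n. max 0 (min 1 (v - real k)) *\<^sub>R (a (Suc k) - a k)) = (1 - l) *\<^sub>R a k + l *\<^sub>R a (Suc k)"
  using assms(2,3)
proof (induction n)
  case (Suc n)
  show ?case
  proof (cases "0 < n \<and> v \<le> real n")
    case True
    then obtain k l where kl: "k < n" "l \<in> {0..1}" "real k \<le> v" "v \<le> real (Suc k)"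
      "(\<Sum>k<n. max 0 (min 1 (v - real k)) *\<^sub>R (a (Suc k) - a k)) = (1 - l) *\<^sub>R a k + l *\<^sub>R a (Suc k)"
      using Suc.IH by blast
    moreover have "max 0 (min 1 (v - real n)) = 0" using True by (intro max_absorb1 min.coboundedI2) simp
    ultimately show ?thesis by (intro exI[of _ k] conjI bexI[of _ l]) simp_all
  next
    case False
    then have v: "real n \<le> v" using assms(1) by auto
    have "(\<Sum>k<Suc n. max 0 (min 1 (v - real k)) *\<^sub>R (a (Suc k) - a k))
        = a n + (v - real n) *\<^sub>R (a (Suc n) - a n)"
      using sum_clamp_telescope[OF v, of a] v Suc.prems assms(4) by (simp add: max_absorb2 min_absorb2)
    also have "\<dots> = (1 - (v - real n)) *\<^sub>R a n + (v - real n) *\<^sub>R a (Suc n)"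
      by (simp add: algebra_simps)
    finally show ?thesis
      using v Suc.prems by (intro exI[of _ n] conjI bexI[of _ "v - real n"]) simp_all
  qed
qed simp

lemma grid_point:
  assumes "0 < T" "0 < n" "0 \<le> s"
  defines "k \<equiv> nat \<lfloor>s * real n / T\<rfloor>"
  shows "real k * T / n \<le> s" "s \<le> (real k + 1) * T / n"
proof -
  have "0 \<le> s * real n / T" using assms by simp
  then have "real k \<le> s * real n / T" "s * real n / T \<le> real k + 1" unfolding k_def by linarith+
  then have "real k * T \<le> s * n" "s * n \<le> (real k + 1) * T"
    using assms(1) by (simp_all only: pos_le_divide_eq pos_divide_le_eq)
  then show "real k * T / n \<le> s" "s \<le> (real k + 1) * T / n"
    using assms(2) by (simp_all only: pos_le_divide_eq pos_divide_le_eq of_nat_0_less_iff)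
qed

text \<open>The polygon at u is a convex combination of the path at the two neighbouring grid times,
  both within T / n of u.\<close>

lemma dist_interp_le_osc:
  fixes T :: real
  assumes "0 < T" "0 < n" "T / n \<le> \<delta>" "u \<in> {0..T}"
  shows "dist (path_at (interp T n (\<lambda>k. path_at \<omega> (k * T / n))) u) (path_at \<omega> u) \<le> osc T \<delta> \<omega>"
proof -
  define a where "a = (\<lambda>k. path_at \<omega> (real k * T / n))"
  have "a 0 = 0" by (simp add: a_def path_at_nonpos)
  moreover have "0 \<le> u * n / T" "u * n / T \<le> real n" using assms by (auto simp: field_simps)
  ultimately obtain k l where kl: "k < n" "l \<in> {0..1}" "real k \<le> u * n / T" "u * n / T \<le> real (Suc k)"
    "(\<Sum>k<n. max 0 (min 1 (u * n / T - real k)) *\<^sub>R (a (Suc k) - a k)) = (1 - l) *\<^sub>R a k + l *\<^sub>R a (Suc k)"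
    using sum_clamp_between[of "u * n / T" n a] assms(2) by blast
  have "k * T \<le> u * n" "u * n \<le> Suc k * T"
    using kl(3,4) assms(1) by (auto simp: pos_le_divide_eq pos_divide_le_eq)
  then have b: "k * T / n \<le> u" "u \<le> Suc k * T / n" "Suc k * T / n = k * T / n + T / n"
    using assms(2) by (simp_all add: divide_le_eq le_divide_eq add_divide_distrib[symmetric] distrib_left mult.commute)
  have "real (Suc k) * T \<le> real n * T" using kl(1) assms(1) by (intro mult_right_mono) auto
  then have "Suc k * T / n \<le> T" using assms(2) by (simp add: field_simps)
  moreover have "0 \<le> k * T / n" using assms(1) by simp
  ultimately have "k * T / n \<in> {0..T}" "Suc k * T / n \<in> {0..T}"
    "\<bar>k * T / n - u\<bar> \<le> \<delta>" "\<bar>Suc k * T / n - u\<bar> \<le> \<delta>"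
    unfolding atLeastAtMost_iff abs_le_iff using b assms(3,4) by linarith+
  then have ak: "dist (a k) (path_at \<omega> u) \<le> osc T \<delta> \<omega>" "dist (a (Suc k)) (path_at \<omega> u) \<le> osc T \<delta> \<omega>"
    unfolding a_def using assms(4) by (auto intro!: dist_le_osc)
  have "path_at (interp T n a) u - path_at \<omega> u
      = (1 - l) *\<^sub>R (a k - path_at \<omega> u) + l *\<^sub>R (a (Suc k) - path_at \<omega> u)"
    unfolding path_at_interp[OF assms(1)] kl(5) by (simp add: algebra_simps)
  also have "norm \<dots> \<le> (1 - l) * osc T \<delta> \<omega> + l * osc T \<delta> \<omega>"
    using ak kl(2) unfolding dist_norm
    by (intro order_trans[OF norm_triangle_ineq] add_mono) (auto intro!: mult_left_mono)
  also have "\<dots> = osc T \<delta> \<omega>" by (simp add: algebra_simps)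
  finally show ?thesis unfolding a_def dist_norm .
qed

text \<open>One oscillation pays for moving the stopping time from s to t, the other for the
  interpolation. The nodes are positions of the path stopped at t, so the polygon uses nothing after
  t.\<close>

lemma sup_dist_stopped_interp_le:
  fixes T :: real
  assumes "0 < T" "0 < n" "T / n \<le> \<delta>" "s \<in> {0..T}" "t \<in> {0..T}" "\<bar>s - t\<bar> \<le> \<delta>"
  shows "sup_dist T (stopped_path s \<omega>) (stopped_path t (interp T n (\<lambda>k. path_at \<omega> (min (k * T / n) t))))
    \<le> 2 * osc T \<delta> \<omega>"
proof (rule sup_dist_le)
  fix u assume u: "0 \<le> u" "u \<le> T"
  let ?v = "min u t" and ?\<omega> = "stopped_path t \<omega>"
  have "0 < T / n" using assms by simp
  then have \<delta>: "0 \<le> \<delta>" using assms(3) by linarith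
  have "dist (path_at \<omega> (min u s)) (path_at \<omega> ?v) \<le> osc T \<delta> \<omega>"
    using assms u by (intro dist_le_osc) auto
  moreover have "dist (path_at (interp T n (\<lambda>k. path_at ?\<omega> (k * T / n))) ?v) (path_at ?\<omega> ?v) \<le> osc T \<delta> ?\<omega>"
    using assms u by (intro dist_interp_le_osc) auto
  moreover have "osc T \<delta> ?\<omega> \<le> osc T \<delta> \<omega>"
    using assms \<delta> by (intro osc_stopped_path_le) auto
  ultimately show "dist (path_at (stopped_path s \<omega>) u)
      (path_at (stopped_path t (interp T n (\<lambda>k. path_at \<omega> (min (k * T / n) t)))) u) \<le> 2 * osc T \<delta> \<omega>"
    using dist_triangle2[of "path_at \<omega> (min u s)" "path_at (interp T n (\<lambda>k. path_at \<omega> (min (k * T / n) t))) ?v" "path_at \<omega> ?v"]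
    unfolding path_at_stopped_path min.assoc min.idem by linarith
qed (use assms in auto)

section \<open>The squared norm of the process space\<close>

lemma jointly_measurable_iff:
  "jointly_measurable T \<eta> \<longleftrightarrow>
    (\<lambda>p. \<eta> (fst p) (snd p)) \<in> borel_measurable (restrict_space borel {0..T} \<Otimes>\<^sub>M borel)"
  unfolding jointly_measurable_def by (simp add: case_prod_beta')

lemma jointly_measurableI:
  assumes "(\<lambda>p. F (fst p) (snd p)) \<in> borel_measurable (borel \<Otimes>\<^sub>M borel)"
    and "\<And>s \<omega>. s \<in> {0..T} \<Longrightarrow> \<eta> s \<omega> = F s \<omega>"
  shows "jointly_measurable T \<eta>"
proof -
  have "(\<lambda>p. (fst p, snd p)) \<in> restrict_space borel {0..T} \<Otimes>\<^sub>M borel \<rightarrow>\<^sub>M borel \<Otimes>\<^sub>M borel"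
    by (intro measurable_Pair measurable_compose[OF measurable_fst] measurable_snd measurable_restrict_space1) auto
  from measurable_compose[OF this assms(1)]
  have "(\<lambda>p. F (fst p) (snd p)) \<in> borel_measurable (restrict_space borel {0..T} \<Otimes>\<^sub>M borel)" by simp
  then show ?thesis unfolding jointly_measurable_iff
    by (rule measurable_cong[THEN iffD1, rotated]) (auto simp: space_pair_measure assms(2))
qed

text \<open>Clamping time extends a process from [0,T] to the whole line without changing it on
  [0,T], so that results on integrals over \<open>lborel\<close> apply.\<close>

lemma jointly_measurable_clamp:
  assumes "0 \<le> T" "jointly_measurable T \<eta>"
  shows "(\<lambda>p. \<eta> (max 0 (min T (fst p))) (snd p)) \<in> borel_measurable (borel \<Otimes>\<^sub>M borel)"
proof -
  have "(\<lambda>p. (max 0 (min T (fst p)), snd p)) \<in> borel \<Otimes>\<^sub>M borel \<rightarrow>\<^sub>M restrict_space borel {0..T} \<Otimes>\<^sub>M borel"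
    using assms(1) by (intro measurable_Pair measurable_restrict_space2) auto
  from measurable_compose[OF this assms(2)[unfolded jointly_measurable_iff]] show ?thesis by simp
qed

lemma jointly_measurable_diff:
  "jointly_measurable T \<eta> \<Longrightarrow> jointly_measurable T \<zeta> \<Longrightarrow> jointly_measurable T (\<lambda>s \<omega>. \<eta> s \<omega> - \<zeta> s \<omega>)"
  unfolding jointly_measurable_iff by (rule borel_measurable_diff)

lemma jointly_measurable_path_functional:
  "X \<in> borel_measurable borel \<Longrightarrow> jointly_measurable T (\<lambda>s. X)"
  unfolding jointly_measurable_iff by (rule measurable_compose[OF measurable_snd])

text \<open>The random lower limit serves two purposes: the constant 0 for the norm of the process
  space, a stopping time for the BMO condition.\<close>

lemma borel_measurable_time_integral:
  assumes "0 \<le> T" "jointly_measurable T \<eta>" "\<tau> \<in> borel_measurable borel"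
  shows "(\<lambda>\<omega>. \<integral>\<^sup>+s. ennreal ((\<eta> (max 0 (min T s)) \<omega>)\<^sup>2) * indicator {\<tau> \<omega>..T} s \<partial>lborel) \<in> borel_measurable borel"
proof -
  have [measurable]: "\<tau> \<in> borel_measurable borel" by fact
  have "(\<lambda>p. (snd p, fst p)) \<in> borel \<Otimes>\<^sub>M lborel \<rightarrow>\<^sub>M (borel :: real measure) \<Otimes>\<^sub>M (borel :: 'a path measure)"
    by measurable
  from measurable_compose[OF this jointly_measurable_clamp[OF assms(1,2)]]
  have [measurable]: "(\<lambda>p. \<eta> (max 0 (min T (snd p))) (fst p)) \<in> borel_measurable (borel \<Otimes>\<^sub>M lborel)" by simp
  have "(\<lambda>p. ennreal ((\<eta> (max 0 (min T (snd p))) (fst p))\<^sup>2) * indicator {\<tau> (fst p)..T} (snd p))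
      \<in> borel_measurable (borel \<Otimes>\<^sub>M lborel)"
    unfolding indicator_def atLeastAtMost_iff by measurable
  then show ?thesis by (intro lborel.borel_measurable_nn_integral) (simp add: case_prod_beta')
qed

lemma borel_measurable_square_integral:
  assumes "0 \<le> T" "jointly_measurable T \<eta>"
  shows "(\<lambda>\<omega>. \<integral>\<^sup>+s\<in>{0..T}. ennreal ((\<eta> s \<omega>)\<^sup>2) \<partial>lborel) \<in> borel_measurable borel"
proof -
  have "(\<integral>\<^sup>+s. ennreal ((\<eta> (max 0 (min T s)) \<omega>)\<^sup>2) * indicator {0..T} s \<partial>lborel)
      = (\<integral>\<^sup>+s\<in>{0..T}. ennreal ((\<eta> s \<omega>)\<^sup>2) \<partial>lborel)" for \<omega>
    by (rule nn_integral_cong) (auto simp: indicator_def max_def min_def)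
  then show ?thesis using borel_measurable_time_integral[OF assms, of "\<lambda>_. 0"] by simp
qed

lemma borel_measurable_time_slice:
  assumes "0 \<le> T" "jointly_measurable T \<eta>"
  shows "(\<lambda>s. ennreal ((\<eta> s \<omega>)\<^sup>2) * indicator {0..T} s) \<in> borel_measurable borel"
proof -
  have "(\<lambda>s. (s, \<omega>)) \<in> borel \<rightarrow>\<^sub>M borel \<Otimes>\<^sub>M borel" by measurable
  from measurable_compose[OF this jointly_measurable_clamp[OF assms]]
  have [measurable]: "(\<lambda>s. \<eta> (max 0 (min T s)) \<omega>) \<in> borel_measurable borel" by simp
  have "(\<lambda>s. ennreal ((\<eta> (max 0 (min T s)) \<omega>)\<^sup>2) * indicator {0..T} s) \<in> borel_measurable borel"
    by measurable
  also have "(\<lambda>s. ennreal ((\<eta> (max 0 (min T s)) \<omega>)\<^sup>2) * indicator {0..T} s)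
      = (\<lambda>s. ennreal ((\<eta> s \<omega>)\<^sup>2) * indicator {0..T} s)"
    by (auto simp: indicator_def max_def min_def)
  finally show ?thesis .
qed

lemma ennreal_powr_one [simp]: "ennreal_powr x 1 = x"
  by (cases x) (auto simp: ennreal_powr_def)

lemma ennreal_powr_ennreal: "0 \<le> a \<Longrightarrow> ennreal_powr (ennreal a) r = ennreal (a powr r)"
  by (simp add: ennreal_powr_def)

lemma ennreal_powr_mono: "0 \<le> r \<Longrightarrow> x \<le> y \<Longrightarrow> ennreal_powr x r \<le> ennreal_powr y r"
  by (cases x; cases y) (auto simp: ennreal_powr_def top_unique intro!: ennreal_leI powr_mono2)

lemma ennreal_powr_less_imp_le:
  assumes "0 < r" "0 < e" "ennreal_powr x r < ennreal (e powr r)"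
  shows "x \<le> ennreal e"
proof (rule ccontr)
  assume "\<not> x \<le> ennreal e"
  then have "ennreal_powr (ennreal e) r \<le> ennreal_powr x r"
    using assms(1) by (intro ennreal_powr_mono) auto
  with assms(2,3) show False by (simp add: ennreal_powr_ennreal)
qed

lemma sets_borel_probabilities: "P \<in> borel_probabilities \<Longrightarrow> sets P = sets borel"
  by (simp add: borel_probabilities_def)

text \<open>A measurable variable is its own smallest measurable majorant.\<close>

lemma upper_expectation_eq:
  assumes "\<P> \<subseteq> borel_probabilities" "X \<in> borel_measurable borel"
  shows "upper_expectation \<P> X = (SUP P\<in>\<P>. \<integral>\<^sup>+\<omega>. X \<omega> \<partial>P)"
  unfolding upper_expectation_def
proof (intro SUP_cong refl antisym)
  fix P assume "P \<in> \<P>"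
  then have "X \<in> borel_measurable P"
    using assms by (simp add: sets_borel_probabilities subset_iff cong: measurable_cong_sets)
  then show "(INF V\<in>{V \<in> borel_measurable P. \<forall>\<omega>. X \<omega> \<le> V \<omega>}. \<integral>\<^sup>+\<omega>. V \<omega> \<partial>P) \<le> (\<integral>\<^sup>+\<omega>. X \<omega> \<partial>P)"
    by (intro INF_lower) auto
  show "(\<integral>\<^sup>+\<omega>. X \<omega> \<partial>P) \<le> (INF V\<in>{V \<in> borel_measurable P. \<forall>\<omega>. X \<omega> \<le> V \<omega>}. \<integral>\<^sup>+\<omega>. V \<omega> \<partial>P)"
    by (intro INF_greatest nn_integral_mono) auto
qed

section \<open>Calculus of the squared norm over a weakly compact family\<close>

locale compact_family =
  fixes \<P> :: "('d::finite) path measure set" and T :: real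
  assumes compact: "compactin weak_topology \<P>"
    and borel_prob: "\<P> \<subseteq> borel_probabilities"
    and T_pos: "0 < T"
begin

lemma T_nonneg [simp]: "0 \<le> T"
  using T_pos by simp

text \<open>Working with the square postpones the root to \<open>H_G_norm_eq\<close> and turns
  pointwise bounds between squares into bounds between norms.\<close>

definition Q :: "(real \<Rightarrow> 'd path \<Rightarrow> real) \<Rightarrow> ennreal" where
  "Q \<eta> = (SUP P\<in>\<P>. \<integral>\<^sup>+\<omega>. (\<integral>\<^sup>+s\<in>{0..T}. ennreal ((\<eta> s \<omega>)\<^sup>2) \<partial>lborel) \<partial>P)"

lemma measurable_P: "P \<in> \<P> \<Longrightarrow> X \<in> borel_measurable borel \<Longrightarrow> X \<in> borel_measurable P"
  using borel_prob by (simp add: sets_borel_probabilities subset_iff cong: measurable_cong_sets)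

lemma prob_space_P: "P \<in> \<P> \<Longrightarrow> prob_space P"
  using borel_prob by (auto simp: borel_probabilities_def)

lemma H_G_norm_eq: "jointly_measurable T \<eta> \<Longrightarrow> H_G_norm \<P> 2 T \<eta> = ennreal_powr (Q \<eta>) (1/2)"
  unfolding H_G_norm_def Q_def
  by (simp add: upper_expectation_eq[OF borel_prob borel_measurable_square_integral])

lemma Q_leI: "(\<And>P. P \<in> \<P> \<Longrightarrow> (\<integral>\<^sup>+\<omega>. (\<integral>\<^sup>+s\<in>{0..T}. ennreal ((\<eta> s \<omega>)\<^sup>2) \<partial>lborel) \<partial>P) \<le> c) \<Longrightarrow> Q \<eta> \<le> c"
  unfolding Q_def by (rule SUP_least)

text \<open>The time T is a null set. Leaving it out matters because step processes carry no
  information there.\<close>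

lemma Q_mono:
  assumes "\<And>s \<omega>. 0 \<le> s \<Longrightarrow> s < T \<Longrightarrow> \<bar>\<eta> s \<omega>\<bar> \<le> \<bar>\<zeta> s \<omega>\<bar>"
  shows "Q \<eta> \<le> Q \<zeta>"
  unfolding Q_def
proof (rule SUP_mono', rule nn_integral_mono, rule nn_integral_mono_AE)
  fix \<omega>
  show "AE s in lborel. ennreal ((\<eta> s \<omega>)\<^sup>2) * indicator {0..T} s \<le> ennreal ((\<zeta> s \<omega>)\<^sup>2) * indicator {0..T} s"
    using AE_lborel_singleton[of T]
  proof eventually_elim
    case (elim s)
    then show ?case using assms[of s \<omega>] by (auto simp: indicator_def abs_le_square_iff intro!: ennreal_leI)
  qed
qed

lemma Q_cong:
  assumes "\<And>s \<omega>. 0 \<le> s \<Longrightarrow> s < T \<Longrightarrow> \<eta> s \<omega> = \<zeta> s \<omega>"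
  shows "Q \<eta> = Q \<zeta>"
  by (intro antisym Q_mono) (simp_all add: assms)

text \<open>This replaces Minkowski's inequality: a bound between squares passes through both
  integrals, and the supremum of a sum is at most the sum of the suprema.\<close>

lemma Q_le_sum:
  assumes "finite I" and jm: "\<And>i. i \<in> I \<Longrightarrow> jointly_measurable T (\<zeta> i)"
    and le: "\<And>s \<omega>. 0 \<le> s \<Longrightarrow> s < T \<Longrightarrow> (\<eta> s \<omega>)\<^sup>2 \<le> (\<Sum>i\<in>I. (\<zeta> i s \<omega>)\<^sup>2)"
  shows "Q \<eta> \<le> (\<Sum>i\<in>I. Q (\<zeta> i))"
proof (rule Q_leI)
  fix P assume P: "P \<in> \<P>"
  have "(\<integral>\<^sup>+s\<in>{0..T}. ennreal ((\<eta> s \<omega>)\<^sup>2) \<partial>lborel)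
      \<le> (\<integral>\<^sup>+s. (\<Sum>i\<in>I. ennreal ((\<zeta> i s \<omega>)\<^sup>2) * indicator {0..T} s) \<partial>lborel)" for \<omega>
  proof (rule nn_integral_mono_AE)
    show "AE s in lborel. ennreal ((\<eta> s \<omega>)\<^sup>2) * indicator {0..T} s
        \<le> (\<Sum>i\<in>I. ennreal ((\<zeta> i s \<omega>)\<^sup>2) * indicator {0..T} s)"
      using AE_lborel_singleton[of T]
    proof eventually_elim
      case (elim s)
      then show ?case using le[of s \<omega>] by (auto simp: indicator_def intro!: ennreal_leI)
    qed
  qed
  also have "\<dots> \<omega> = (\<Sum>i\<in>I. \<integral>\<^sup>+s\<in>{0..T}. ennreal ((\<zeta> i s \<omega>)\<^sup>2) \<partial>lborel)" for \<omega>
    using borel_measurable_time_slice[OF T_nonneg jm] by (intro nn_integral_sum) simp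
  finally have "(\<integral>\<^sup>+\<omega>. (\<integral>\<^sup>+s\<in>{0..T}. ennreal ((\<eta> s \<omega>)\<^sup>2) \<partial>lborel) \<partial>P)
      \<le> (\<integral>\<^sup>+\<omega>. (\<Sum>i\<in>I. \<integral>\<^sup>+s\<in>{0..T}. ennreal ((\<zeta> i s \<omega>)\<^sup>2) \<partial>lborel) \<partial>P)"
    by (rule nn_integral_mono)
  also have "\<dots> = (\<Sum>i\<in>I. \<integral>\<^sup>+\<omega>. (\<integral>\<^sup>+s\<in>{0..T}. ennreal ((\<zeta> i s \<omega>)\<^sup>2) \<partial>lborel) \<partial>P)"
    by (intro nn_integral_sum measurable_P[OF P] borel_measurable_square_integral jm) auto
  also have "\<dots> \<le> (\<Sum>i\<in>I. Q (\<zeta> i))"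
    unfolding Q_def by (intro sum_mono SUP_upper P)
  finally show "(\<integral>\<^sup>+\<omega>. (\<integral>\<^sup>+s\<in>{0..T}. ennreal ((\<eta> s \<omega>)\<^sup>2) \<partial>lborel) \<partial>P) \<le> (\<Sum>i\<in>I. Q (\<zeta> i))" .
qed

lemma Q_cmult_le: "Q (\<lambda>s \<omega>. c * \<eta> s \<omega>) \<le> ennreal (c\<^sup>2) * Q \<eta>" if "jointly_measurable T \<eta>"
proof (rule Q_leI)
  fix P assume P: "P \<in> \<P>"
  have "(\<integral>\<^sup>+s\<in>{0..T}. ennreal ((c * \<eta> s \<omega>)\<^sup>2) \<partial>lborel)
      = ennreal (c\<^sup>2) * (\<integral>\<^sup>+s\<in>{0..T}. ennreal ((\<eta> s \<omega>)\<^sup>2) \<partial>lborel)" for \<omega>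
    using borel_measurable_time_slice[OF T_nonneg that, of \<omega>]
    by (subst nn_integral_cmult[symmetric]) (auto simp: power_mult_distrib ennreal_mult mult.assoc)
  then have "(\<integral>\<^sup>+\<omega>. (\<integral>\<^sup>+s\<in>{0..T}. ennreal ((c * \<eta> s \<omega>)\<^sup>2) \<partial>lborel) \<partial>P)
      = ennreal (c\<^sup>2) * (\<integral>\<^sup>+\<omega>. (\<integral>\<^sup>+s\<in>{0..T}. ennreal ((\<eta> s \<omega>)\<^sup>2) \<partial>lborel) \<partial>P)"
    using measurable_P[OF P borel_measurable_square_integral[OF T_nonneg that]]
    by (simp add: nn_integral_cmult)
  also have "\<dots> \<le> ennreal (c\<^sup>2) * Q \<eta>"
    unfolding Q_def by (intro mult_left_mono SUP_upper P) auto
  finally show "(\<integral>\<^sup>+\<omega>. (\<integral>\<^sup>+s\<in>{0..T}. ennreal ((c * \<eta> s \<omega>)\<^sup>2) \<partial>lborel) \<partial>P) \<le> ennreal (c\<^sup>2) * Q \<eta>" .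
qed

lemma Q_path_functional_le:
  assumes "X \<in> borel_measurable borel" "\<And>P. P \<in> \<P> \<Longrightarrow> (\<integral>\<^sup>+\<omega>. ennreal ((X \<omega>)\<^sup>2) \<partial>P) \<le> c"
  shows "Q (\<lambda>s. X) \<le> ennreal T * c"
proof (rule Q_leI)
  fix P assume P: "P \<in> \<P>"
  have [measurable]: "X \<in> borel_measurable P" using measurable_P[OF P assms(1)] .
  have "(\<integral>\<^sup>+\<omega>. (\<integral>\<^sup>+s\<in>{0..T}. ennreal ((X \<omega>)\<^sup>2) \<partial>lborel) \<partial>P) = (\<integral>\<^sup>+\<omega>. ennreal T * ennreal ((X \<omega>)\<^sup>2) \<partial>P)"
    by (subst nn_integral_cmult_indicator) (simp_all add: mult.commute)
  also have "\<dots> = ennreal T * (\<integral>\<^sup>+\<omega>. ennreal ((X \<omega>)\<^sup>2) \<partial>P)" by (rule nn_integral_cmult) measurable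
  also have "\<dots> \<le> ennreal T * c" using assms(2)[OF P] by (rule mult_left_mono) simp
  finally show "(\<integral>\<^sup>+\<omega>. (\<integral>\<^sup>+s\<in>{0..T}. ennreal ((X \<omega>)\<^sup>2) \<partial>lborel) \<partial>P) \<le> ennreal T * c" .
qed

lemma Q_const_le: "Q (\<lambda>s \<omega>. c) \<le> ennreal (T * c\<^sup>2)"
proof -
  have "Q (\<lambda>s \<omega>. c) \<le> ennreal T * ennreal (c\<^sup>2)"
    by (rule Q_path_functional_le) (simp_all add: prob_space.emeasure_space_1[OF prob_space_P])
  then show ?thesis by (simp add: ennreal_mult)
qed

end

section \<open>Lipschitz cylinder functionals and step processes\<close>

abbreviation pos_dist :: "real set \<Rightarrow> ('d::finite) path \<Rightarrow> 'd path \<Rightarrow> real" where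
  "pos_dist S \<omega> \<omega>' \<equiv> \<Sum>u\<in>S. norm (path_at \<omega> u - path_at \<omega>' u)"

text \<open>Intrinsic form of a bounded Lipschitz cylinder functional, without a representing
  function: sums and inf-convolutions stay in the class, and vector values are allowed.
  \<open>cyl_imp_L_ip\<close> and \<open>L_ip_imp_cyl\<close> connect it with
  \<open>L_ip\<close>.\<close>

definition cyl :: "real \<Rightarrow> (('d::finite) path \<Rightarrow> 'b::real_normed_vector) \<Rightarrow> bool" where
  "cyl t X \<longleftrightarrow> bounded (range X) \<and> (\<exists>S C. finite S \<and> S \<subseteq> {0..t} \<and>
     (\<forall>\<omega> \<omega>'. norm (X \<omega> - X \<omega>') \<le> C * pos_dist S \<omega> \<omega>'))"

lemma cylE:
  assumes "cyl t X"
  obtains M S C where "\<And>\<omega>. norm (X \<omega>) \<le> M" "0 \<le> M" "finite S" "S \<subseteq> {0..t}" "0 \<le> C"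
    "\<And>\<omega> \<omega>'. norm (X \<omega> - X \<omega>') \<le> C * pos_dist S \<omega> \<omega>'"
proof -
  obtain M where M: "\<And>\<omega>. norm (X \<omega>) \<le> M"
    using assms unfolding cyl_def bounded_iff by auto
  obtain S C where SC: "finite S" "S \<subseteq> {0..t}"
    "\<And>\<omega> \<omega>'. norm (X \<omega> - X \<omega>') \<le> C * pos_dist S \<omega> \<omega>'"
    using assms unfolding cyl_def by blast
  have "norm (X \<omega> - X \<omega>') \<le> max C 0 * pos_dist S \<omega> \<omega>'" for \<omega> \<omega>'
    by (rule order_trans[OF SC(3)]) (auto intro!: mult_right_mono sum_nonneg)
  moreover have "0 \<le> M" using M[of undefined] norm_ge_zero order_trans by blast
  ultimately show ?thesis using M SC(1,2) by (intro that[of M S "max C 0"]) auto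
qed

lemma cylI:
  assumes "\<And>\<omega>. norm (X \<omega>) \<le> M" "finite S" "S \<subseteq> {0..t}"
    "\<And>\<omega> \<omega>'. norm (X \<omega> - X \<omega>') \<le> C * pos_dist S \<omega> \<omega>'"
  shows "cyl t X"
  unfolding cyl_def bounded_iff using assms by blast

lemma cyl_mono: "cyl t X \<Longrightarrow> t \<le> t' \<Longrightarrow> cyl t' X"
  by (erule cylE, rule cylI) (auto dest: subsetD)

lemma cyl_const: "cyl t (\<lambda>\<omega>. c)"
  by (rule cylI[of _ "norm c" "{}"]) auto

lemma cyl_scaleR: "cyl t X \<Longrightarrow> cyl t (\<lambda>\<omega>. X \<omega> *\<^sub>R b)"
proof (elim cylE)
  fix M S C
  assume *: "\<And>\<omega>. norm (X \<omega>) \<le> M" "0 \<le> C" "finite S" "S \<subseteq> {0..t}"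
    "\<And>\<omega> \<omega>'. norm (X \<omega> - X \<omega>') \<le> C * pos_dist S \<omega> \<omega>'"
  show "cyl t (\<lambda>\<omega>. X \<omega> *\<^sub>R b)"
  proof (rule cylI[OF _ *(3,4)])
    show "norm (X \<omega> *\<^sub>R b) \<le> M * norm b" for \<omega> using *(1)[of \<omega>] by (auto intro: mult_right_mono)
    show "norm (X \<omega> *\<^sub>R b - X \<omega>' *\<^sub>R b) \<le> (norm b * C) * pos_dist S \<omega> \<omega>'" for \<omega> \<omega>'
      using mult_left_mono[OF *(5)[of \<omega> \<omega>'], of "norm b"]
      by (simp add: scaleR_left_diff_distrib[symmetric] mult.assoc mult.commute[of _ "norm b"])
  qed
qed

lemma cyl_add:
  assumes "cyl t X" "cyl t Y"
  shows "cyl t (\<lambda>\<omega>. X \<omega> + Y \<omega>)"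
proof -
  obtain M S C where X: "\<And>\<omega>. norm (X \<omega>) \<le> M" "0 \<le> M" "finite S" "S \<subseteq> {0..t}" "0 \<le> C"
    "\<And>\<omega> \<omega>'. norm (X \<omega> - X \<omega>') \<le> C * pos_dist S \<omega> \<omega>'"
    by (rule cylE[OF assms(1)]) blast
  obtain M' S' C' where Y: "\<And>\<omega>. norm (Y \<omega>) \<le> M'" "0 \<le> M'" "finite S'" "S' \<subseteq> {0..t}" "0 \<le> C'"
    "\<And>\<omega> \<omega>'. norm (Y \<omega> - Y \<omega>') \<le> C' * pos_dist S' \<omega> \<omega>'"
    by (rule cylE[OF assms(2)]) blast
  show ?thesis
  proof (rule cylI)
    show "norm (X \<omega> + Y \<omega>) \<le> M + M'" for \<omega> by (rule norm_triangle_mono[OF X(1) Y(1)])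
    show "finite (S \<union> S')" "S \<union> S' \<subseteq> {0..t}" using X Y by auto
    fix \<omega> \<omega>' :: "'a path"
    let ?\<rho> = "\<lambda>S. pos_dist S \<omega> \<omega>'"
    have "?\<rho> S \<le> ?\<rho> (S \<union> S')" "?\<rho> S' \<le> ?\<rho> (S \<union> S')"
      using X Y by (auto intro!: sum_mono2)
    then have "C * ?\<rho> S \<le> C * ?\<rho> (S \<union> S')" "C' * ?\<rho> S' \<le> C' * ?\<rho> (S \<union> S')"
      using X(5) Y(5) by (auto intro: mult_left_mono)
    then show "norm (X \<omega> + Y \<omega> - (X \<omega>' + Y \<omega>')) \<le> (C + C') * ?\<rho> (S \<union> S')"
      using X(6)[of \<omega> \<omega>'] Y(6)[of \<omega> \<omega>'] norm_triangle_ineq[of "X \<omega> - X \<omega>'" "Y \<omega> - Y \<omega>'"]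
      unfolding add_diff_add distrib_right by linarith
  qed
qed

lemma cyl_sum: "finite I \<Longrightarrow> (\<And>i. i \<in> I \<Longrightarrow> cyl t (X i)) \<Longrightarrow> cyl t (\<lambda>\<omega>. \<Sum>i\<in>I. X i \<omega>)"
  by (induction I rule: finite_induct) (auto intro: cyl_const cyl_add)

lemma cyl_continuous:
  fixes X :: "('d::finite) path \<Rightarrow> 'b::real_normed_vector"
  assumes "cyl t X" "0 \<le> t"
  shows "continuous_on UNIV X"
proof -
  obtain M S C where X: "finite S" "S \<subseteq> {0..t}" "0 \<le> C"
    "\<And>\<omega> \<omega>'. norm (X \<omega> - X \<omega>') \<le> C * pos_dist S \<omega> \<omega>'"
    by (rule cylE[OF assms(1)]) blast
  show ?thesis
  proof (rule continuous_on_if_le_sup_dist[OF assms(2)])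
    fix \<omega> \<omega>' :: "'d path"
    have "pos_dist S \<omega> \<omega>' \<le> real (card S) * sup_dist t \<omega> \<omega>'"
    proof (rule sum_bounded_above)
      fix u assume "u \<in> S"
      then show "norm (path_at \<omega> u - path_at \<omega>' u) \<le> sup_dist t \<omega> \<omega>'"
        using dist_le_sup_dist[of u t \<omega> \<omega>'] X(2) by (auto simp: dist_norm)
    qed
    then have "C * pos_dist S \<omega> \<omega>' \<le> C * (real (card S) * sup_dist t \<omega> \<omega>')"
      by (rule mult_left_mono) (rule X(3))
    then show "dist (X \<omega>) (X \<omega>') \<le> (C * real (card S)) * sup_dist t \<omega> \<omega>'"
      using X(4)[of \<omega> \<omega>'] by (simp add: dist_norm mult.assoc)
  qed
qed

section \<open>Inf-convolution, and cylinder functionals as elements of \<open>L_ip\<close>\<close>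

text \<open>J is the Lipschitz envelope of H with slope C; the lower bound on H keeps the infimum
  finite, and changing x changes every competitor by at most C \<delta>. The types of x and \<omega>
  differ because x is a tuple of positions in McShane's extension and a path in the
  regularisation.\<close>

lemma inf_convolution:
  fixes H :: "'p \<Rightarrow> real" and \<rho> :: "'x \<Rightarrow> 'p \<Rightarrow> real"
  assumes H: "\<And>\<omega>. - M \<le> H \<omega>" and \<rho>: "\<And>x \<omega>. 0 \<le> \<rho> x \<omega>" and C: "0 \<le> C"
  defines "J \<equiv> \<lambda>x. INF \<omega>. H \<omega> + C * \<rho> x \<omega>"
  shows inf_convolution_le: "J x \<le> H \<omega> + C * \<rho> x \<omega>"
    and inf_convolution_ge: "(\<And>\<omega>. c \<le> H \<omega> + C * \<rho> x \<omega>) \<Longrightarrow> c \<le> J x"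
    and inf_convolution_Lipschitz: "(\<And>\<omega>. \<bar>\<rho> x \<omega> - \<rho> x' \<omega>\<bar> \<le> \<delta>) \<Longrightarrow> \<bar>J x - J x'\<bar> \<le> C * \<delta>"
proof -
  have le: "J x \<le> H \<omega> + C * \<rho> x \<omega>" for x \<omega>
    unfolding J_def
  proof (rule cINF_lower)
    show "bdd_below (range (\<lambda>\<omega>. H \<omega> + C * \<rho> x \<omega>))"
      by (rule bdd_belowI2[of _ "- M"]) (use H \<rho> C in \<open>auto intro: add_increasing2\<close>)
  qed auto
  have ge: "c \<le> J x" if "\<And>\<omega>. c \<le> H \<omega> + C * \<rho> x \<omega>" for c x
    unfolding J_def by (rule cINF_greatest) (use that in auto)
  show "J x \<le> H \<omega> + C * \<rho> x \<omega>" by (rule le)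
  show "(\<And>\<omega>. c \<le> H \<omega> + C * \<rho> x \<omega>) \<Longrightarrow> c \<le> J x" by (rule ge)
  assume \<delta>: "\<And>\<omega>. \<bar>\<rho> x \<omega> - \<rho> x' \<omega>\<bar> \<le> \<delta>"
  have "J y - C * \<delta> \<le> J y'" if "\<And>\<omega>. \<rho> y \<omega> \<le> \<rho> y' \<omega> + \<delta>" for y y'
  proof (rule ge)
    fix \<omega>
    have "C * \<rho> y \<omega> \<le> C * (\<rho> y' \<omega> + \<delta>)" using that C by (rule mult_left_mono)
    then show "J y - C * \<delta> \<le> H \<omega> + C * \<rho> y' \<omega>" using le[of y \<omega>] by (simp add: distrib_left)
  qed
  from this[of x x'] this[of x' x] show "\<bar>J x - J x'\<bar> \<le> C * \<delta>"
    using \<delta> by (smt (verit))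
qed

lemma abs_sum_norm_diff_le:
  "\<bar>(\<Sum>i\<in>I. norm (x i - z i)) - (\<Sum>i\<in>I. norm (y i - z i))\<bar> \<le> (\<Sum>i\<in>I. norm (x i - y i))"
proof -
  have "\<bar>(\<Sum>i\<in>I. norm (x i - z i)) - (\<Sum>i\<in>I. norm (y i - z i))\<bar> \<le> (\<Sum>i\<in>I. \<bar>norm (x i - z i) - norm (y i - z i)\<bar>)"
    unfolding sum_subtractf[symmetric] by (rule sum_abs)
  also have "\<dots> \<le> (\<Sum>i\<in>I. norm (x i - y i))"
  proof (rule sum_mono)
    show "\<bar>norm (x i - z i) - norm (y i - z i)\<bar> \<le> norm (x i - y i)" for i
      using norm_triangle_ineq3[of "x i - z i" "y i - z i"] by simp
  qed
  finally show ?thesis .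
qed

text \<open>McShane's extension turns a Lipschitz bound in terms of finitely many positions into a
  Lipschitz function of these positions.\<close>

lemma cyl_imp_L_ip:
  fixes X :: "('d::finite) path \<Rightarrow> real"
  assumes "cyl t X"
  shows "X \<in> L_ip t"
proof -
  obtain M S C where X: "\<And>\<omega>. norm (X \<omega>) \<le> M" "0 \<le> M" "finite S" "S \<subseteq> {0..t}" "0 \<le> C"
    "\<And>\<omega> \<omega>'. norm (X \<omega> - X \<omega>') \<le> C * pos_dist S \<omega> \<omega>'"
    by (rule cylE[OF assms]) blast
  obtain h where h: "bij_betw h {0..<card S} S" using ex_bij_betw_nat_finite[OF X(3)] by blast
  define n where "n = card S"
  have hS: "h i \<in> S" if "i < n" for i using h that by (auto simp: bij_betw_def n_def)
  have sum_h: "(\<Sum>u\<in>S. g u) = (\<Sum>i<n. g (h i))" for g :: "real \<Rightarrow> real"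
    using sum.reindex_bij_betw[OF h, of g] by (simp add: n_def lessThan_atLeast0)
  define \<rho> where "\<rho> = (\<lambda>(x :: nat \<Rightarrow> real^'d) \<omega>. \<Sum>i<n. norm (x i - path_at \<omega> (h i)))"
  define J where "J x = (INF \<omega>. X \<omega> + C * \<rho> x \<omega>)" for x
  have H: "- M \<le> X \<omega>" "X \<omega> \<le> M" for \<omega> using X(1)[of \<omega>] by auto
  have \<rho>: "0 \<le> \<rho> x \<omega>" for x \<omega> unfolding \<rho>_def by (intro sum_nonneg) auto
  note J = inf_convolution[of M X \<rho> C, OF H(1) \<rho> X(5), folded J_def]
  \<comment> \<open>The envelope is bounded below by -M but may be large at tuples far from the
    positions of any path; the cap at M restores boundedness and does not alter values at actual
    positions, where the envelope equals \<open>X\<close>.\<close>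
  define \<phi> where "\<phi> x = min M (J x)" for x
  have "bounded_Lipschitz n \<phi>"
    unfolding bounded_Lipschitz_def
  proof (intro conjI exI allI)
    have "- M \<le> J x" for x
      by (rule J(2)) (use H \<rho> X(5) in \<open>auto intro: add_increasing2\<close>)
    then have "\<bar>\<phi> x\<bar> \<le> M" for x using X(2) by (auto simp: \<phi>_def min_def abs_le_iff minus_le_iff)
    then show "bounded (range \<phi>)" by (auto simp: bounded_iff)
    show "\<bar>\<phi> x - \<phi> x'\<bar> \<le> C * (\<Sum>i<n. norm (x i - x' i))" for x x'
    proof -
      have "\<bar>J x - J x'\<bar> \<le> C * (\<Sum>i<n. norm (x i - x' i))"
        by (rule J(3)) (unfold \<rho>_def, rule abs_sum_norm_diff_le)
      then show ?thesis unfolding \<phi>_def by linarith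
    qed
  qed
  moreover have "X \<omega> = \<phi> (\<lambda>i. path_at \<omega> (min (max 0 (h i)) t))" for \<omega>
  proof -
    let ?x = "\<lambda>i. path_at \<omega> (min (max 0 (h i)) t)"
    have x: "?x i = path_at \<omega> (h i)" if "i < n" for i
      using hS[OF that] X(4) by (auto simp: min_def max_def subset_iff)
    then have \<rho>x: "\<rho> ?x \<omega>' = pos_dist S \<omega> \<omega>'" for \<omega>'
      unfolding \<rho>_def sum_h by (intro sum.cong) auto
    have "X \<omega> \<le> J ?x"
    proof (rule J(2))
      show "X \<omega> \<le> X \<omega>' + C * \<rho> ?x \<omega>'" for \<omega>'
        using X(6)[of \<omega> \<omega>'] unfolding \<rho>x real_norm_def by linarith
    qed
    moreover have "J ?x \<le> X \<omega>" using J(1)[of ?x \<omega>] by (simp add: \<rho>x)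
    ultimately show ?thesis using H(2)[of \<omega>] by (simp add: \<phi>_def)
  qed
  ultimately show ?thesis unfolding L_ip_def
    by (intro CollectI exI[of _ n] exI[of _ "\<lambda>i. max 0 (h i)"] exI[of _ \<phi>]) auto
qed

lemma L_ip_imp_cyl:
  fixes X :: "('d::finite) path \<Rightarrow> real"
  assumes "X \<in> L_ip T" "0 \<le> T"
  shows "cyl T X"
proof -
  obtain n t \<phi> where \<phi>: "bounded_Lipschitz n \<phi>" "\<And>i. i < n \<Longrightarrow> 0 \<le> t i"
    and X: "X = (\<lambda>\<omega>. \<phi> (\<lambda>i. path_at \<omega> (min (t i) T)))"
    using assms(1) unfolding L_ip_def by blast
  obtain C where C: "\<And>x x'. \<bar>\<phi> x - \<phi> x'\<bar> \<le> C * (\<Sum>i<n. norm (x i - x' i))"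
    using \<phi>(1) unfolding bounded_Lipschitz_def by blast
  define S where "S = (\<lambda>i. min (t i) T) ` {..<n}"
  have S: "finite S" "S \<subseteq> {0..T}" using \<phi>(2) assms(2) by (auto simp: S_def)
  have "bounded (range \<phi>)" using \<phi>(1) unfolding bounded_Lipschitz_def by blast
  then have "bounded (range X)" unfolding X by (rule bounded_subset) auto
  \<comment> \<open>Different indices may name the same position, so each of the n terms is bounded
    by the whole sum over S; hence the factor n.\<close>
  moreover have "norm (X \<omega> - X \<omega>') \<le> (\<bar>C\<bar> * n) * pos_dist S \<omega> \<omega>'" for \<omega> \<omega>'
  proof -
    let ?\<rho> = "pos_dist S \<omega> \<omega>'"
    have "norm (X \<omega> - X \<omega>') \<le> C * (\<Sum>i<n. norm (path_at \<omega> (min (t i) T) - path_at \<omega>' (min (t i) T)))"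
      using C unfolding X by simp
    also have "\<dots> \<le> \<bar>C\<bar> * (\<Sum>i<n. norm (path_at \<omega> (min (t i) T) - path_at \<omega>' (min (t i) T)))"
      by (intro mult_right_mono sum_nonneg) auto
    also have "\<dots> \<le> \<bar>C\<bar> * (\<Sum>i<n. ?\<rho>)"
    proof (intro mult_left_mono sum_mono)
      fix i assume "i \<in> {..<n}"
      then show "norm (path_at \<omega> (min (t i) T) - path_at \<omega>' (min (t i) T)) \<le> ?\<rho>"
        using S(1) by (intro member_le_sum[of "min (t i) T" S "\<lambda>u. norm (path_at \<omega> u - path_at \<omega>' u)"])
          (auto simp: S_def)
    qed auto
    finally show ?thesis by (simp add: mult.assoc)
  qed
  ultimately show ?thesis unfolding cyl_def using S by blast
qed

text \<open>The inf-convolution stays below H. A competitor closer than d loses less than e by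
  uniform continuity, and a competitor farther away pays more than the total variation of H.\<close>

lemma cyl_approx:
  fixes H :: "('d::finite) path \<Rightarrow> real"
  assumes M: "\<And>\<omega>. \<bar>H \<omega>\<bar> \<le> M" and S: "finite S" "S \<subseteq> {0..t}" and e: "0 < e"
    and unif: "\<exists>d>0. \<forall>\<omega> \<omega>'. pos_dist S \<omega> \<omega>' < d \<longrightarrow> \<bar>H \<omega> - H \<omega>'\<bar> < e"
  shows "\<exists>X. cyl t X \<and> (\<forall>\<omega>. \<bar>H \<omega> - X \<omega>\<bar> \<le> e)"
proof -
  obtain d where d: "0 < d"
    "\<And>\<omega> \<omega>'. pos_dist S \<omega> \<omega>' < d \<Longrightarrow> \<bar>H \<omega> - H \<omega>'\<bar> < e"
    using unif by blast
  define \<rho> where "\<rho> = (\<lambda>\<omega> \<omega>' :: 'd path. pos_dist S \<omega> \<omega>')"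
  \<comment> \<open>The slope for which moving by d costs 2 M, the largest possible gain.\<close>
  define C where "C = 2 * M / d"
  have "0 \<le> M" using M[of undefined] by linarith
  then have C: "0 \<le> C" using d(1) by (simp add: C_def)
  have \<rho>: "0 \<le> \<rho> \<omega> \<omega>'" for \<omega> \<omega>' unfolding \<rho>_def by (intro sum_nonneg) auto
  have H: "- M \<le> H \<omega>" "H \<omega> \<le> M" for \<omega> using M[of \<omega>] by auto
  define J where "J \<omega> = (INF \<omega>'. H \<omega>' + C * \<rho> \<omega> \<omega>')" for \<omega>
  note J = inf_convolution[of M H \<rho> C, OF H(1) \<rho> C, folded J_def]
  have "\<rho> \<omega> \<omega> = 0" for \<omega> by (simp add: \<rho>_def)
  then have J_le: "J \<omega> \<le> H \<omega>" for \<omega> using J(1)[of \<omega> \<omega>] by simp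
  have J_ge: "H \<omega> - e \<le> J \<omega>" for \<omega>
  proof (rule J(2))
    fix \<omega>'
    show "H \<omega> - e \<le> H \<omega>' + C * \<rho> \<omega> \<omega>'"
    proof (cases "\<rho> \<omega> \<omega>' < d")
      case True
      then have "\<bar>H \<omega> - H \<omega>'\<bar> < e" using d(2) by (simp add: \<rho>_def)
      moreover have "0 \<le> C * \<rho> \<omega> \<omega>'" using C \<rho> by simp
      ultimately show ?thesis by linarith
    next
      case False
      then have "C * d \<le> C * \<rho> \<omega> \<omega>'" using C by (intro mult_left_mono) auto
      moreover have "C * d = 2 * M" using d(1) by (simp add: C_def)
      ultimately show ?thesis using H(1)[of \<omega>'] H(2)[of \<omega>] e by linarith
    qed
  qed
  have "cyl t J"
  proof (rule cylI[OF _ S])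
    have "- M \<le> J \<omega>" for \<omega>
      by (rule J(2)) (use H \<rho> C in \<open>auto intro: add_increasing2\<close>)
    then show "norm (J \<omega>) \<le> M" for \<omega> using J_le[of \<omega>] H(2)[of \<omega>] by (smt (verit) real_norm_def)
    show "norm (J \<omega> - J \<omega>') \<le> C * pos_dist S \<omega> \<omega>'" for \<omega> \<omega>'
      unfolding real_norm_def by (rule J(3)) (unfold \<rho>_def, rule abs_sum_norm_diff_le)
  qed
  moreover have "\<bar>H \<omega> - J \<omega>\<bar> \<le> e" for \<omega> using J_le[of \<omega>] J_ge[of \<omega>] e by linarith
  ultimately show ?thesis by blast
qed

section \<open>Step processes and approximation in the process space\<close>

text \<open>Elements of \<open>H0_G\<close> without an enumeration of the partition: the process may
  change only when a point of D is passed. Grids can then be united without renumbering. The point 0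
  guarantees a last grid point before each time, and values outside [0,T) are left free.\<close>

definition step_process :: "real \<Rightarrow> real set \<Rightarrow> (real \<Rightarrow> ('d::finite) path \<Rightarrow> 'b::real_normed_vector) \<Rightarrow> bool" where
  "step_process T D X \<longleftrightarrow> finite D \<and> 0 \<in> D \<and> D \<subseteq> {0..<T} \<and> (\<forall>t\<in>D. cyl t (X t)) \<and>
     (\<forall>s s'. 0 \<le> s \<and> s < T \<and> 0 \<le> s' \<and> s' < T \<and> (\<forall>t\<in>D. t \<le> s \<longleftrightarrow> t \<le> s') \<longrightarrow> X s = X s')"

lemma step_processD:
  assumes "step_process T D X"
  shows "finite D" "0 \<in> D" "D \<subseteq> {0..<T}" "\<And>t. t \<in> D \<Longrightarrow> cyl t (X t)"
    "\<And>s s'. 0 \<le> s \<Longrightarrow> s < T \<Longrightarrow> 0 \<le> s' \<Longrightarrow> s' < T \<Longrightarrow> (\<And>t. t \<in> D \<Longrightarrow> t \<le> s \<longleftrightarrow> t \<le> s') \<Longrightarrow> X s = X s'"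
  using assms unfolding step_process_def by auto

lemma last_point:
  fixes D :: "real set"
  assumes "finite D" "0 \<in> D" "0 \<le> s"
  defines "l \<equiv> Max {t\<in>D. t \<le> s}"
  shows "l \<in> D" "l \<le> s" "\<And>t. t \<in> D \<Longrightarrow> t \<le> s \<longleftrightarrow> t \<le> l"
proof -
  have "l \<in> {t\<in>D. t \<le> s}" unfolding l_def by (rule Max_in) (use assms in auto)
  then show "l \<in> D" "l \<le> s" by auto
  show "t \<le> s \<longleftrightarrow> t \<le> l" if "t \<in> D" for t
    using \<open>l \<le> s\<close> that assms(1) by (auto simp: l_def)
qed

lemma step_process_last_point:
  assumes "step_process T D X" "0 \<le> s" "s < T"
  shows "X s = X (Max {t\<in>D. t \<le> s})"
proof -
  have D: "finite D" "0 \<in> D" "D \<subseteq> {0..<T}" using assms(1) by (auto simp: step_process_def)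
  have "Max {t\<in>D. t \<le> s} \<in> {0..<T}" using last_point[OF D(1,2) assms(2)] D(3) by blast
  then show ?thesis
    using last_point(3)[OF D(1,2) assms(2)] assms unfolding step_process_def by auto
qed

text \<open>At a new grid point the value is the one at the last old grid point, a cylinder
  functional of an earlier and hence also of the present time.\<close>

lemma step_process_refine:
  assumes "step_process T D X" "D \<subseteq> D'" "finite D'" "D' \<subseteq> {0..<T}"
  shows "step_process T D' X"
  unfolding step_process_def
proof (intro conjI ballI allI impI)
  fix t assume "t \<in> D'"
  then have t: "0 \<le> t" "t < T" using assms(4) by auto
  have D: "finite D" "0 \<in> D" using assms(1) by (auto simp: step_process_def)
  have "cyl (Max {u\<in>D. u \<le> t}) (X (Max {u\<in>D. u \<le> t}))"
    using last_point(1)[OF D t(1)] assms(1) by (auto simp: step_process_def)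
  then show "cyl t (X t)"
    unfolding step_process_last_point[OF assms(1) t] by (rule cyl_mono) (rule last_point(2)[OF D t(1)])
next
  show "0 \<in> D'" using step_processD(2)[OF assms(1)] assms(2) by auto
  fix s s' assume *: "0 \<le> s \<and> s < T \<and> 0 \<le> s' \<and> s' < T \<and> (\<forall>t\<in>D'. (t \<le> s) = (t \<le> s'))"
  then show "X s = X s'" using assms(2) by (intro step_processD(5)[OF assms(1)]) auto
qed (use assms in auto)

lemma H0_G_imp_step_process:
  assumes "\<eta> \<in> H0_G T" "0 < T"
  shows "\<exists>D. step_process T D \<eta>"
proof -
  obtain N t \<xi> where t: "t 0 = 0" "t N = T" "\<And>j. j < N \<Longrightarrow> t j < t (Suc j)"
    and \<xi>: "\<And>j. j < N \<Longrightarrow> \<xi> j \<in> L_ip (t j)"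
    and \<eta>: "\<eta> = (\<lambda>s \<omega>. \<Sum>j<N. \<xi> j \<omega> * indicator {t j..<t (Suc j)} s)"
    using assms(1) unfolding H0_G_def by blast
  have N: "0 < N" using t(1,2) assms(2) by (cases N) auto
  have mono: "t i \<le> t j" if "i \<le> j" "j \<le> N" for i j
    using that(1,2)
  proof (induction rule: dec_induct)
    case (step n)
    then show ?case using t(3)[of n] by simp
  qed simp
  have tT: "t j < T" "0 \<le> t j" if "j < N" for j
    using mono[of "Suc j" N] mono[of 0 j] t(1,2) t(3)[OF that] that by auto
  have "step_process T (t ` {..<N}) \<eta>"
    unfolding step_process_def
  proof (intro conjI ballI allI impI)
    show "0 \<in> t ` {..<N}" using t(1) N by (intro image_eqI[of _ _ 0]) auto
    show "t ` {..<N} \<subseteq> {0..<T}" using tT by auto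
    fix r assume "r \<in> t ` {..<N}"
    \<comment> \<open>A summand that has started by time r uses positions up to \<open>t j\<close>,
      hence up to r; a summand that has not started has indicator 0.\<close>
    have "cyl r (\<lambda>\<omega>. \<xi> j \<omega> * indicator {t j..<t (Suc j)} r)" if "j < N" for j
    proof (cases "t j \<le> r")
      case True
      have "cyl (t j) (\<xi> j)" by (rule L_ip_imp_cyl[OF \<xi>[OF that] tT(2)[OF that]])
      then have "cyl r (\<xi> j)" using True by (rule cyl_mono)
      from cyl_scaleR[OF this, of "indicator {t j..<t (Suc j)} r :: real"] show ?thesis by simp
    next
      case False
      then show ?thesis using cyl_const[of r "0::real"] by simp
    qed
    then show "cyl r (\<eta> r)" unfolding \<eta> by (intro cyl_sum) auto
  next
    fix s s' assume *: "0 \<le> s \<and> s < T \<and> 0 \<le> s' \<and> s' < T \<and> (\<forall>r\<in>t ` {..<N}. (r \<le> s) = (r \<le> s'))"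
    \<comment> \<open>The last point \<open>t N\<close> = T is not in the grid, but it cannot
      separate two times that are both below T.\<close>
    have "(t j \<le> s) = (t j \<le> s')" if "j \<le> N" for j
      using * that t(2) by (cases "j = N") simp_all
    then have "s \<in> {t j..<t (Suc j)} \<longleftrightarrow> s' \<in> {t j..<t (Suc j)}" if "j < N" for j
      using that unfolding atLeastLessThan_iff not_le[symmetric] by (simp add: Suc_le_eq)
    then show "\<eta> s = \<eta> s'"
      unfolding \<eta> by (intro ext sum.cong refl arg_cong2[where f="(*)"]) (simp add: indicator_def)
  qed auto
  then show ?thesis ..
qed

text \<open>Sorting D gives the partition, closed by T. The indicator removes the unconstrained
  values outside [0,T), where the sum in \<open>H0_G\<close> vanishes.\<close>

lemma step_process_imp_H0_G:
  fixes X :: "real \<Rightarrow> ('d::finite) path \<Rightarrow> real"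
  assumes X: "step_process T D X"
  shows "(\<lambda>s \<omega>. X s \<omega> * indicator {0..<T} s) \<in> H0_G T"
proof -
  have D: "finite D" "0 \<in> D" "D \<subseteq> {0..<T}" "\<And>t. t \<in> D \<Longrightarrow> cyl t (X t)"
    and const: "\<And>s s'. 0 \<le> s \<Longrightarrow> s < T \<Longrightarrow> 0 \<le> s' \<Longrightarrow> s' < T \<Longrightarrow> (\<And>t. t \<in> D \<Longrightarrow> t \<le> s \<longleftrightarrow> t \<le> s') \<Longrightarrow> X s = X s'"
    using X by (auto simp: step_process_def)
  define xs where "xs = sorted_list_of_set D"
  define N where "N = length xs"
  define t where "t j = (if j < N then xs ! j else T)" for j
  have xs: "set xs = D" "sorted_wrt (<) xs"
    using D(1) by (simp_all add: xs_def)
  have N: "0 < N" using xs(1) D(2) by (cases xs) (auto simp: N_def)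
  have tD: "t j \<in> D" if "j < N" for j using that xs(1) by (auto simp: t_def N_def)
  have strict: "t i < t j" if "i < j" "j \<le> N" for i j
  proof (cases "j < N")
    case True
    then show ?thesis using sorted_wrt_nth_less[OF xs(2), of i j] that by (simp add: t_def N_def)
  next
    case False
    then show ?thesis using tD[of i] D(3) that by (auto simp: t_def)
  qed
  \<comment> \<open>0 occurs in the sorted list; any entry before it would be negative, but D
    contains no negative time.\<close>
  have t0: "t 0 = 0"
  proof -
    obtain i where i: "i < N" "0 = t i" using D(2) xs(1) by (auto simp: t_def N_def in_set_conv_nth)
    have "\<not> 0 < i"
    proof
      assume "0 < i"
      then have "t 0 < t i" using i(1) by (intro strict) auto
      then show False using tD[OF N] D(3) i(2) by auto
    qed
    then show ?thesis using i(2) by simp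
  qed
  have "X s \<omega> * indicator {0..<T} s = (\<Sum>j<N. X (t j) \<omega> * indicator {t j..<t (Suc j)} s)" for s \<omega>
  proof (cases "0 \<le> s \<and> s < T")
    case True
    then have l: "Max {u\<in>D. u \<le> s} \<in> D" "Max {u\<in>D. u \<le> s} \<le> s"
      "\<And>u. u \<in> D \<Longrightarrow> u \<le> s \<longleftrightarrow> u \<le> Max {u\<in>D. u \<le> s}"
      using last_point[OF D(1,2), of s] by auto
    obtain k where k: "k < N" "Max {u\<in>D. u \<le> s} = t k"
      using l(1) xs(1) by (auto simp: t_def N_def in_set_conv_nth)
    have sk: "t k \<le> s" "s < t (Suc k)"
    proof -
      show "t k \<le> s" using l(2) k(2) by simp
      show "s < t (Suc k)"
      proof (cases "Suc k < N")
        case True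
        then have "\<not> t (Suc k) \<le> t k" using strict[of k "Suc k"] by simp
        then show ?thesis using l(3)[OF tD[OF True]] k(2) by simp
      qed (use \<open>0 \<le> s \<and> s < T\<close> in \<open>simp add: t_def\<close>)
    qed
    have "X (t j) \<omega> * indicator {t j..<t (Suc j)} s = (if j = k then X s \<omega> else 0)" if "j < N" for j
    proof (cases "j = k")
      case True
      then show ?thesis
        using step_process_last_point[OF X, of s] \<open>0 \<le> s \<and> s < T\<close> sk k(2) by simp
    next
      case False
      then consider "j < k" | "k < j" by linarith
      then have "s \<notin> {t j..<t (Suc j)}"
      proof cases
        case 1
        then have "t (Suc j) \<le> t k" using strict[of "Suc j" k] k(1) by (cases "Suc j = k") auto
        then show ?thesis using sk by auto
      next
        case 2
        then have "t (Suc k) \<le> t j" using strict[of "Suc k" j] that by (cases "Suc k = j") auto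
        then show ?thesis using sk by auto
      qed
      then show ?thesis using False by simp
    qed
    then have "(\<Sum>j<N. X (t j) \<omega> * indicator {t j..<t (Suc j)} s) = (\<Sum>j<N. if j = k then X s \<omega> else 0)"
      by (intro sum.cong) auto
    then show ?thesis using k(1) True by simp
  next
    case False
    have "s \<notin> {t j..<t (Suc j)}" if "j < N" for j
    proof -
      have "0 \<le> t j" using tD[OF that] D(3) by auto
      moreover have "t (Suc j) \<le> T"
        using tD[of "Suc j"] D(3) by (cases "Suc j < N") (auto simp: t_def dest: subsetD)
      ultimately show ?thesis using False by auto
    qed
    then show ?thesis using False by simp
  qed
  then show ?thesis unfolding H0_G_def
    using t0 strict D(4)[OF tD]
    by (intro CollectI exI[of _ N] exI[of _ t] exI[of _ "\<lambda>j. X (t j)"])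
       (auto intro: cyl_imp_L_ip simp: t_def[of N] fun_eq_iff)
qed

lemma H0_G_jointly_measurable:
  fixes \<eta> :: "real \<Rightarrow> ('d::finite) path \<Rightarrow> real"
  assumes "\<eta> \<in> H0_G T" "0 < T"
  shows "jointly_measurable T \<eta>"
proof -
  obtain N t \<xi> where t: "t 0 = 0" "t N = T" "\<And>j. j < N \<Longrightarrow> t j < t (Suc j)"
    and \<xi>: "\<And>j. j < N \<Longrightarrow> \<xi> j \<in> L_ip (t j)"
    and \<eta>: "\<eta> = (\<lambda>s \<omega>. \<Sum>j<N. \<xi> j \<omega> * indicator {t j..<t (Suc j)} s)"
    using assms(1) unfolding H0_G_def by blast
  have t_nonneg: "0 \<le> t j" if "j < N" for j
    using that
  proof (induction j)
    case (Suc j)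
    then show ?case using t(3)[of j] by simp
  qed (simp add: t(1))
  have "\<xi> j \<in> borel_measurable borel" if "j < N" for j
    by (intro borel_measurable_continuous_onI cyl_continuous[of "t j"] L_ip_imp_cyl \<xi> t_nonneg that)
  then have "(\<lambda>p. \<Sum>j<N. \<xi> j (snd p) * indicator {t j..<t (Suc j)} (fst p :: real)) \<in> borel_measurable (borel \<Otimes>\<^sub>M borel)"
    by (intro borel_measurable_sum borel_measurable_times measurable_compose[OF measurable_snd]
        measurable_compose[OF measurable_fst]) auto
  then show ?thesis by (rule jointly_measurableI) (simp add: \<eta>)
qed

context compact_family
begin

text \<open>Cutting the step processes down to [0,T) puts them into \<open>H0_G\<close> and leaves
  \<open>Q\<close> unchanged; continuity of the square root at 0 turns convergence of
  \<open>Q\<close> into convergence of the norm.\<close>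

lemma H_G_I:
  assumes jm: "jointly_measurable T \<eta>"
    and approx: "\<And>e. 0 < e \<Longrightarrow> \<exists>D X. step_process T D X \<and> Q (\<lambda>s \<omega>. \<eta> s \<omega> - X s \<omega>) \<le> ennreal e"
  shows "\<eta> \<in> H_G \<P> 2 T"
proof -
  have "\<exists>h\<in>H0_G T. Q (\<lambda>s \<omega>. \<eta> s \<omega> - h s \<omega>) \<le> ennreal (1 / real (Suc n))" for n
  proof -
    obtain D X where X: "step_process T D X" "Q (\<lambda>s \<omega>. \<eta> s \<omega> - X s \<omega>) \<le> ennreal (1 / real (Suc n))"
      using approx[of "1 / real (Suc n)"] by auto
    have "Q (\<lambda>s \<omega>. \<eta> s \<omega> - X s \<omega> * indicator {0..<T} s) = Q (\<lambda>s \<omega>. \<eta> s \<omega> - X s \<omega>)"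
      by (rule Q_cong) simp
    with X step_process_imp_H0_G[OF X(1)] show ?thesis
      by (intro bexI[of _ "\<lambda>s \<omega>. X s \<omega> * indicator {0..<T} s"]) simp_all
  qed
  then have "\<forall>n. \<exists>h. h \<in> H0_G T \<and> Q (\<lambda>s \<omega>. \<eta> s \<omega> - h s \<omega>) \<le> ennreal (1 / real (Suc n))" by blast
  then obtain h where h: "\<And>n. h n \<in> H0_G T" "\<And>n. Q (\<lambda>s \<omega>. \<eta> s \<omega> - h n s \<omega>) \<le> ennreal (1 / real (Suc n))"
    by metis
  have "H_G_norm \<P> 2 T (\<lambda>s \<omega>. \<eta> s \<omega> - h n s \<omega>) \<le> ennreal ((1 / real (Suc n)) powr (1/2))" for n
    using ennreal_powr_mono[OF _ h(2)[of n], of "1/2"]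
    by (subst H_G_norm_eq) (simp_all add: ennreal_powr_ennreal jointly_measurable_diff jm H0_G_jointly_measurable h(1) T_pos)
  note le = this
  have "(\<lambda>n. ennreal ((1 / real (Suc n)) powr (1/2))) \<longlonglongrightarrow> ennreal (0 powr (1/2))"
    by (intro tendsto_ennrealI tendsto_powr' tendsto_const LIMSEQ_Suc[OF lim_1_over_n]) auto
  then have lim: "(\<lambda>n. ennreal ((1 / real (Suc n)) powr (1/2))) \<longlonglongrightarrow> 0" by simp
  have "(\<lambda>n. H_G_norm \<P> 2 T (\<lambda>s \<omega>. \<eta> s \<omega> - h n s \<omega>)) \<longlonglongrightarrow> 0"
    by (rule tendsto_sandwich[OF _ _ tendsto_const lim]) (use le in auto)
  then show ?thesis unfolding H_G_def using jm h(1) by blast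
qed

text \<open>The norm is the root of \<open>Q\<close>, so a member of the approximating sequence with
  norm below the root of e is taken.\<close>

lemma H_G_D:
  assumes "\<eta> \<in> H_G \<P> 2 T" "0 < e"
  shows "\<exists>D X. step_process T D X \<and> jointly_measurable T X \<and> Q (\<lambda>s \<omega>. \<eta> s \<omega> - X s \<omega>) \<le> ennreal e"
proof -
  obtain h where h: "\<And>n. h n \<in> H0_G T" and lim: "(\<lambda>n. H_G_norm \<P> 2 T (\<lambda>s \<omega>. \<eta> s \<omega> - h n s \<omega>)) \<longlonglongrightarrow> 0"
    and jm: "jointly_measurable T \<eta>"
    using assms(1) unfolding H_G_def by blast
  have "0 < ennreal (e powr (1/2))" using assms(2) by simp
  from order_tendstoD(2)[OF lim this]
  obtain n where n: "H_G_norm \<P> 2 T (\<lambda>s \<omega>. \<eta> s \<omega> - h n s \<omega>) < ennreal (e powr (1/2))"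
    by (auto simp: eventually_sequentially)
  have jmh: "jointly_measurable T (h n)" by (rule H0_G_jointly_measurable[OF h T_pos])
  have "Q (\<lambda>s \<omega>. \<eta> s \<omega> - h n s \<omega>) \<le> ennreal e"
    using n unfolding H_G_norm_eq[OF jointly_measurable_diff[OF jm jmh]]
    by (rule ennreal_powr_less_imp_le[OF _ assms(2), rotated]) simp
  then show ?thesis using H0_G_imp_step_process[OF h T_pos] jmh by blast
qed

lemma jointly_measurable_norm_vec:
  fixes X :: "real \<Rightarrow> 'd path \<Rightarrow> 'e::euclidean_space"
  assumes "\<And>b. b \<in> Basis \<Longrightarrow> jointly_measurable T (\<lambda>s \<omega>. X s \<omega> \<bullet> b)"
  shows "jointly_measurable T (\<lambda>s \<omega>. norm (X s \<omega>))"
proof -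
  have "(\<lambda>p. X (fst p) (snd p)) \<in> borel_measurable (restrict_space borel {0..T} \<Otimes>\<^sub>M borel)"
    by (subst borel_measurable_euclidean_space) (intro ballI assms[unfolded jointly_measurable_iff])
  then show ?thesis unfolding jointly_measurable_iff by measurable
qed

text \<open>The components are approximated separately, put on the union of their grids and
  reassembled. The squared Euclidean norm is the sum of the squared components, so the error e is
  shared equally among them.\<close>

lemma H_G_vec_D:
  fixes X :: "real \<Rightarrow> 'd path \<Rightarrow> 'e::euclidean_space"
  assumes X: "X \<in> H_G_vec \<P> 2 T" and e: "0 < e"
  shows "\<exists>D \<Xi>. step_process T D \<Xi> \<and> jointly_measurable T (\<lambda>s \<omega>. norm (X s \<omega> - \<Xi> s \<omega>)) \<and>
    Q (\<lambda>s \<omega>. norm (X s \<omega> - \<Xi> s \<omega>)) \<le> ennreal e"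
proof -
  define n where "n = real (DIM('e))"
  have n: "0 < n" by (simp add: n_def)
  have Xb: "(\<lambda>s \<omega>. X s \<omega> \<bullet> b) \<in> H_G \<P> 2 T" if "b \<in> Basis" for b
    using X that by (auto simp: H_G_vec_def)
  have "\<forall>b\<in>Basis. \<exists>D Y. step_process T D Y \<and> jointly_measurable T Y \<and> Q (\<lambda>s \<omega>. X s \<omega> \<bullet> b - Y s \<omega>) \<le> ennreal (e / n)"
    using H_G_D[OF Xb, of _ "e / n"] n e by simp
  from bchoice[OF this] obtain D where "\<forall>b\<in>Basis. \<exists>Y. step_process T (D b) Y \<and> jointly_measurable T Y \<and> Q (\<lambda>s \<omega>. X s \<omega> \<bullet> b - Y s \<omega>) \<le> ennreal (e / n)" ..
  from bchoice[OF this] obtain Y where DY: "\<And>b. b \<in> Basis \<Longrightarrow> step_process T (D b) (Y b)"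
    "\<And>b. b \<in> Basis \<Longrightarrow> jointly_measurable T (Y b)"
    "\<And>b. b \<in> Basis \<Longrightarrow> Q (\<lambda>s \<omega>. X s \<omega> \<bullet> b - Y b s \<omega>) \<le> ennreal (e / n)"
    by blast
  define D' where "D' = (\<Union>b\<in>Basis. D b)"
  define \<Xi> where "\<Xi> s \<omega> = (\<Sum>b\<in>Basis. Y b s \<omega> *\<^sub>R b)" for s \<omega>
  have "finite D'" using step_processD(1)[OF DY(1)] unfolding D'_def by (intro finite_UN_I) auto
  moreover have "D' \<subseteq> {0..<T}" using step_processD(3)[OF DY(1)] unfolding D'_def by (intro UN_least)
  ultimately have D': "finite D'" "D' \<subseteq> {0..<T}" .
  have Y: "step_process T D' (Y b)" if "b \<in> Basis" for b
    by (rule step_process_refine[OF DY(1)[OF that] _ D']) (use that in \<open>auto simp: D'_def\<close>)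
  have "0 \<in> D'" using Y[OF SOME_Basis] by (simp add: step_process_def)
  have step: "step_process T D' \<Xi>"
    unfolding step_process_def
  proof (intro conjI ballI allI impI)
    show "cyl t (\<Xi> t)" if "t \<in> D'" for t
      unfolding \<Xi>_def using step_processD(4)[OF Y that] by (intro cyl_sum cyl_scaleR) auto
    fix s s' assume *: "0 \<le> s \<and> s < T \<and> 0 \<le> s' \<and> s' < T \<and> (\<forall>t\<in>D'. (t \<le> s) = (t \<le> s'))"
    have "Y b s = Y b s'" if "b \<in> Basis" for b
      using * by (intro step_processD(5)[OF Y[OF that]]) auto
    then show "\<Xi> s = \<Xi> s'" by (simp add: \<Xi>_def fun_eq_iff)
  qed (use D' \<open>0 \<in> D'\<close> in auto)
  have comp: "(X s \<omega> - \<Xi> s \<omega>) \<bullet> b = X s \<omega> \<bullet> b - Y b s \<omega>" if "b \<in> Basis" for s \<omega> b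
    using that by (simp add: \<Xi>_def inner_diff_left inner_sum_left inner_Basis if_distrib cong: if_cong)
  have jm: "jointly_measurable T (\<lambda>s \<omega>. X s \<omega> \<bullet> b - Y b s \<omega>)" if "b \<in> Basis" for b
    using Xb[OF that] DY(2)[OF that] by (intro jointly_measurable_diff) (auto simp: H_G_def)
  have "Q (\<lambda>s \<omega>. norm (X s \<omega> - \<Xi> s \<omega>)) \<le> (\<Sum>b\<in>Basis. Q (\<lambda>s \<omega>. X s \<omega> \<bullet> b - Y b s \<omega>))"
  proof (rule Q_le_sum[OF _ jm])
    show "(norm (X s \<omega> - \<Xi> s \<omega>))\<^sup>2 \<le> (\<Sum>b\<in>Basis. (X s \<omega> \<bullet> b - Y b s \<omega>)\<^sup>2)" for s \<omega>
      unfolding power2_norm_eq_inner euclidean_inner[of "X s \<omega> - \<Xi> s \<omega>" "X s \<omega> - \<Xi> s \<omega>"]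
      by (rule eq_refl, rule sum.cong) (simp_all only: comp power2_eq_square)
  qed auto
  also have "\<dots> \<le> (\<Sum>b\<in>(Basis::'e set). ennreal (e / n))" by (intro sum_mono DY(3))
  also have "\<dots> = ennreal e"
    using n e by (simp add: n_def ennreal_of_nat_eq_real_of_nat ennreal_mult[symmetric])
  finally show ?thesis
    using step jm by (auto intro!: exI[of _ D'] exI[of _ \<Xi>] jointly_measurable_norm_vec simp: comp)
qed

end

section \<open>Uniformly continuous random fields\<close>

abbreviation uniformly_close ::
  "real \<Rightarrow> real \<Rightarrow> (real \<Rightarrow> ('d::finite) path \<Rightarrow> 'e::real_normed_vector \<Rightarrow> real) \<Rightarrow> real \<Rightarrow> real \<Rightarrow> bool" where
  "uniformly_close T N F e d \<equiv> \<forall>s\<in>{0..T}. \<forall>s'\<in>{0..T}. \<forall>\<omega> \<omega>' x x'. norm x \<le> N \<longrightarrow> norm x' \<le> N \<longrightarrow>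
     path_time_dist T s \<omega> s' \<omega>' + dist x x' < d \<longrightarrow> \<bar>F s \<omega> x - F s' \<omega>' x'\<bar> < e"

text \<open>Uniform in time and path but only local in x, as dictated by (A3), whose Lipschitz
  constant in z grows with z. Bounds and radii must not depend on the path, since the path space is
  not compact.\<close>

definition regular :: "real \<Rightarrow> (real \<Rightarrow> ('d::finite) path \<Rightarrow> 'e::real_normed_vector \<Rightarrow> real) \<Rightarrow> bool" where
  "regular T F \<longleftrightarrow> (\<forall>N. (\<exists>C. \<forall>s\<in>{0..T}. \<forall>\<omega> x. norm x \<le> N \<longrightarrow> \<bar>F s \<omega> x\<bar> \<le> C) \<and>
     (\<forall>e>0. \<exists>d>0. uniformly_close T N F e d))"

lemma regularI:
  assumes "\<And>N. \<exists>C. \<forall>s\<in>{0..T}. \<forall>\<omega> x. norm x \<le> N \<longrightarrow> \<bar>F s \<omega> x\<bar> \<le> C"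
    and "\<And>N e. 0 < e \<Longrightarrow> \<exists>d>0. uniformly_close T N F e d"
  shows "regular T F"
  unfolding regular_def using assms by simp

lemma regular_bounded:
  assumes "regular T F"
  obtains C where "0 \<le> C" "\<And>s \<omega> x. s \<in> {0..T} \<Longrightarrow> norm x \<le> N \<Longrightarrow> \<bar>F s \<omega> x\<bar> \<le> C"
proof -
  obtain C where C: "\<And>s \<omega> x. s \<in> {0..T} \<Longrightarrow> norm x \<le> N \<Longrightarrow> \<bar>F s \<omega> x\<bar> \<le> C"
    using assms unfolding regular_def by meson
  show ?thesis by (rule that[of "max C 0"]) (auto intro: order_trans[OF C])
qed

lemma regular_uniformly_continuous:
  assumes "regular T F" "0 < e"
  obtains d where "0 < d" "uniformly_close T N F e d"
  using assms unfolding regular_def by meson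

text \<open>Along polygons the field becomes a continuous function of the nodes, in the product
  topology, and of x. Only finitely many nodes enter, so their total displacement tends to
  0.\<close>

lemma continuous_on_regular_interp:
  fixes F :: "real \<Rightarrow> ('d::finite) path \<Rightarrow> 'e::real_normed_vector \<Rightarrow> real"
  assumes F: "regular T F" and T: "0 < T" and t: "t \<in> {0..T}"
  shows "continuous_on UNIV (\<lambda>p. F t (interp T n (fst p)) (snd p))"
  unfolding continuous_on_eq_continuous_at[OF open_UNIV]
proof
  fix p :: "(nat \<Rightarrow> real^'d) \<times> 'e"
  let ?g = "\<lambda>q. (\<Sum>k<n. norm (fst q (Suc k) - fst p (Suc k)) + norm (fst q k - fst p k)) + dist (snd q) (snd p)"
  have coord: "continuous_on UNIV (\<lambda>q::(nat \<Rightarrow> real^'d) \<times> 'e. fst q k)" for k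
    by (rule continuous_on_compose2[OF continuous_on_product_coordinates continuous_on_fst[OF continuous_on_id]]) auto
  have "continuous_on UNIV ?g" by (intro continuous_intros coord)
  then have "isCont ?g p" using continuous_on_eq_continuous_at[OF open_UNIV] by blast
  then have g: "?g \<midarrow>p\<rightarrow> 0" by (simp add: isCont_def)
  have "isCont (\<lambda>q::(nat \<Rightarrow> real^'d) \<times> 'e. norm (snd q)) p" by (intro continuous_intros)
  then have nrm: "(\<lambda>q. norm (snd q)) \<midarrow>p\<rightarrow> norm (snd p)" by (simp add: isCont_def)
  show "isCont (\<lambda>p. F t (interp T n (fst p)) (snd p)) p"
    unfolding isCont_def
  proof (rule tendstoI)
    fix e :: real assume "0 < e"
    obtain d where d: "0 < d" "uniformly_close T (norm (snd p) + 1) F e d"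
      by (rule regular_uniformly_continuous[OF F \<open>0 < e\<close>])
    note d = d(1) d(2)[rule_format]
    have "\<forall>\<^sub>F q in at p. ?g q < d" by (rule order_tendstoD(2)[OF g d(1)])
    moreover have "\<forall>\<^sub>F q in at p. norm (snd q) < norm (snd p) + 1"
      by (rule order_tendstoD(2)[OF nrm]) simp
    ultimately show "\<forall>\<^sub>F q in at p. dist (F t (interp T n (fst q)) (snd q)) (F t (interp T n (fst p)) (snd p)) < e"
    proof eventually_elim
      case (elim q)
      have "sup_dist T (stopped_path t (interp T n (fst q))) (stopped_path t (interp T n (fst p)))
          \<le> sup_dist T (interp T n (fst q)) (interp T n (fst p))"
        using T t by (intro sup_dist_stopped_path_le) auto
      also have "\<dots> \<le> (\<Sum>k<n. norm (fst q (Suc k) - fst p (Suc k)) + norm (fst q k - fst p k))"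
        by (rule sup_dist_interp_le[OF T])
      finally show ?case
        unfolding dist_real_def using elim t by (intro d(2)) auto
    qed
  qed
qed

text \<open>Evaluated at the last grid time and along the interpolated path, the field depends on
  countably many measurable quantities. Refining the grid gives pointwise convergence, since the
  oscillation of each path tends to 0.\<close>

lemma regular_jointly_measurable:
  fixes F :: "real \<Rightarrow> ('d::finite) path \<Rightarrow> 'e::euclidean_space \<Rightarrow> real"
  assumes F: "regular T F" and T: "0 < T"
    and X: "\<And>b. b \<in> Basis \<Longrightarrow> jointly_measurable T (\<lambda>s \<omega>. X s \<omega> \<bullet> b)"
  shows "jointly_measurable T (\<lambda>s \<omega>. F s \<omega> (X s \<omega>))"
proof -
  let ?M = "restrict_space borel {0..T} \<Otimes>\<^sub>M borel :: (real \<times> 'd path) measure"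
  \<comment> \<open>The cap keeps all grid times in [0,T]; it is inactive for s in [0,T].\<close>
  define k where "k n s = min n (nat \<lfloor>s * real n / T\<rfloor>)" for n :: nat and s :: real
  define u where "u n j p = F (real j * T / n) (interp T n (\<lambda>i. path_at (snd p) (min (real i * T / n) (real j * T / n))))
    (X (fst p) (snd p))" for n j :: nat and p
  have X': "(\<lambda>p. X (fst p) (snd p)) \<in> borel_measurable ?M"
    by (subst borel_measurable_euclidean_space) (intro ballI X[unfolded jointly_measurable_iff])
  have u: "u n (min n j) \<in> borel_measurable ?M" if "0 < n" for n j
  proof -
    define t where "t = real (min n j) * T / n"
    have "t \<in> {0..T}" using T that by (auto simp: t_def divide_le_eq mult.commute intro!: mult_left_mono)
    from continuous_on_regular_interp[OF F T this]
    have *: "(\<lambda>q. F t (interp T n (fst q)) (snd q)) \<in> borel_measurable borel"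
      by (rule borel_measurable_continuous_onI)
    have "(\<lambda>p. path_at (snd p) r) \<in> borel_measurable ?M" for r
      using measurable_compose[OF measurable_snd borel_measurable_continuous_onI[OF continuous_on_path_eval]] .
    then have "(\<lambda>p. (\<lambda>i::nat. path_at (snd p) (min (real i * T / n) t))) \<in> borel_measurable ?M"
      by (rule measurable_coordinatewise_then_product)
    from measurable_compose[OF borel_measurable_Pair[OF this X'] *] show ?thesis
      unfolding u_def t_def by simp
  qed
  have meas: "(\<lambda>p. u (Suc n) (k (Suc n) (fst p)) p) \<in> borel_measurable ?M" for n
    unfolding k_def
  proof (rule measurable_compose_countable[where f="\<lambda>j. u (Suc n) (min (Suc n) j)"])
    show "u (Suc n) (min (Suc n) j) \<in> borel_measurable ?M" for j by (rule u) simp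
    have "(\<lambda>s. nat \<lfloor>s * real (Suc n) / T\<rfloor>) \<in> borel \<rightarrow>\<^sub>M count_space UNIV" by measurable
    then show "(\<lambda>p. nat \<lfloor>fst p * real (Suc n) / T\<rfloor>) \<in> ?M \<rightarrow>\<^sub>M count_space UNIV"
      by (intro measurable_compose[OF measurable_fst] measurable_restrict_space1)
  qed
  have lim: "(\<lambda>n. u (Suc n) (k (Suc n) (fst p)) p) \<longlonglongrightarrow> F (fst p) (snd p) (X (fst p) (snd p))"
    if "p \<in> space ?M" for p
  proof -
    define s \<omega> where "s = fst p" and "\<omega> = snd p"
    have s: "0 \<le> s" "s \<le> T" using that by (auto simp: s_def space_pair_measure)
    have "(\<lambda>n. u (Suc n) (k (Suc n) s) p) \<longlonglongrightarrow> F s \<omega> (X s \<omega>)"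
    proof (rule LIMSEQ_I)
      fix e :: real assume "0 < e"
      \<comment> \<open>The point x stays fixed in the approximation, so the ball of radius equal to
        its norm is large enough.\<close>
      obtain d where d: "0 < d" "uniformly_close T (norm (X (fst p) \<omega>)) F e d"
        by (rule regular_uniformly_continuous[OF F \<open>0 < e\<close>])
      note d = d(1) d(2)[rule_format]
      \<comment> \<open>Twice the oscillation is then at most d / 4, and together with a time shift
        below d / 2 the total stays below d.\<close>
      obtain r where r: "0 < r" "osc T r \<omega> \<le> d / 8" using osc_tendsto_0[of T "d/8" \<omega>] T d(1) by auto
      have "(\<lambda>n. T / real (Suc n)) \<longlonglongrightarrow> 0" by (rule LIMSEQ_Suc[OF lim_const_over_n])
      then have "\<forall>\<^sub>F n in sequentially. T / real (Suc n) < min r (d/2)"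
        using r(1) d(1) by (intro order_tendstoD(2)) auto
      then obtain n0 where n0: "\<And>n. n \<ge> n0 \<Longrightarrow> T / real (Suc n) < min r (d/2)"
        by (auto simp: eventually_sequentially)
      have "norm (u (Suc n) (k (Suc n) s) p - F s \<omega> (X s \<omega>)) < e" if "n \<ge> n0" for n
      proof -
        let ?m = "Suc n"
        let ?t = "real (k ?m s) * T / ?m"
        have "s * ?m / T \<le> ?m" using s T by (simp add: divide_le_eq mult.commute mult_left_mono)
        then have kk: "k ?m s = nat \<lfloor>s * real ?m / T\<rfloor>"
          unfolding k_def by (intro min_absorb2) linarith
        have "?t \<le> s" "s \<le> (real (k ?m s) + 1) * T / ?m"
          unfolding kk using grid_point[of T ?m s] s T by simp_all
        then have t: "?t \<le> s" "s - ?t \<le> T / ?m" by (simp_all add: distrib_right add_divide_distrib)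
        have "0 \<le> ?t" using T by simp
        with s t have mem: "s \<in> {0..T}" "?t \<in> {0..T}" by auto
        have near: "\<bar>s - ?t\<bar> < r" "\<bar>s - ?t\<bar> < d/2" using t n0[OF that] by linarith+
        have "sup_dist T (stopped_path s \<omega>) (stopped_path ?t (interp T ?m (\<lambda>i. path_at \<omega> (min (real i * T / ?m) ?t))))
            \<le> 2 * osc T r \<omega>"
          using near(1) n0[OF that] by (intro sup_dist_stopped_interp_le[OF T _ _ mem]) linarith+
        then have "\<bar>F s \<omega> (X s \<omega>) - F ?t (interp T ?m (\<lambda>i. path_at \<omega> (min (real i * T / ?m) ?t))) (X s \<omega>)\<bar> < e"
          using near(2) r(2) d(1) by (intro d(2)[OF mem]) (auto simp: s_def)
        then show ?thesis by (simp add: u_def s_def \<omega>_def abs_minus_commute)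
      qed
      then show "\<exists>n0. \<forall>n\<ge>n0. norm (u (Suc n) (k (Suc n) s) p - F s \<omega> (X s \<omega>)) < e" by blast
    qed
    then show ?thesis by (simp add: s_def \<omega>_def)
  qed
  show ?thesis unfolding jointly_measurable_iff by (rule borel_measurable_LIMSEQ_real[OF lim meas])
qed

section \<open>Substitution of processes into random fields\<close>

context compact_family
begin

text \<open>Replacing the path by its piecewise linear interpolation on a grid makes the random field a
  uniformly continuous function of finitely many positions; the interpolation error is controlled by
  the oscillation of the path, which is small uniformly over the weakly compact family.\<close>

lemma uniformly_continuous_field_H_G:
  fixes F :: "real \<Rightarrow> 'd path \<Rightarrow> 'e::euclidean_space \<Rightarrow> real"
  assumes jm: "jointly_measurable T (\<lambda>s \<omega>. F s \<omega> (X s \<omega>))"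
    and bound: "\<And>s \<omega> x. s \<in> {0..T} \<Longrightarrow> \<bar>F s \<omega> x\<bar> \<le> M" and M: "0 \<le> M"
    and unif: "\<And>e. 0 < e \<Longrightarrow> \<exists>d>0. \<forall>s\<in>{0..T}. \<forall>s'\<in>{0..T}. \<forall>\<omega> \<omega>' x x'.
      path_time_dist T s \<omega> s' \<omega>' + dist x x' < d \<longrightarrow> \<bar>F s \<omega> x - F s' \<omega>' x'\<bar> < e"
    and X: "X \<in> H_G_vec \<P> 2 T"
  shows "(\<lambda>s \<omega>. F s \<omega> (X s \<omega>)) \<in> H_G \<P> 2 T"
proof (rule H_G_I[OF jm])
  fix e :: real assume e: "0 < e"
  \<comment> \<open>The error e is shared equally by three sources: a constant r, the oscillation of
    the path, and the approximation of \<open>X\<close>.\<close>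
  define r where "r = min 1 (e / (12 * T))"
  have r: "0 < r" "r \<le> 1" "T * (2 * r)\<^sup>2 \<le> e / 3"
  proof -
    show "0 < r" "r \<le> 1" using e T_pos by (auto simp: r_def)
    then have "r * r \<le> 1 * r" by (intro mult_right_mono) auto
    also have "\<dots> \<le> e / (12 * T)" by (simp add: r_def)
    finally have "12 * T * (r * r) \<le> e" using T_pos by (simp add: pos_le_divide_eq mult.commute)
    then show "T * (2 * r)\<^sup>2 \<le> e / 3" by (simp add: power2_eq_square)
  qed
  define e1 where "e1 = r / 4"
  have e1: "0 < e1" using r(1) by (simp add: e1_def)
  obtain d0 where d0: "0 < d0" "\<And>s s' \<omega> \<omega>' x x'. s \<in> {0..T} \<Longrightarrow> s' \<in> {0..T} \<Longrightarrow>
      path_time_dist T s \<omega> s' \<omega>' + dist x x' < d0 \<Longrightarrow> \<bar>F s \<omega> x - F s' \<omega>' x'\<bar> < e1"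
    using unif[OF e1] by blast
  \<comment> \<open>With d at most 1, an oscillation above 1 exceeds d even after its truncation at
    1.\<close>
  define d where "d = min 1 d0"
  have d: "0 < d" "d \<le> 1" "\<And>s s' \<omega> \<omega>' x x'. s \<in> {0..T} \<Longrightarrow> s' \<in> {0..T} \<Longrightarrow>
      path_time_dist T s \<omega> s' \<omega>' + dist x x' < d \<Longrightarrow> \<bar>F s \<omega> x - F s' \<omega>' x'\<bar> < e1"
    using d0 by (auto simp: d_def)
  \<comment> \<open>At distances beyond d the trivial bound 2 M on the increment of F is at most K
    times the distance.\<close>
  define K where "K = 2 * M / d"
  have K: "0 \<le> K" "K * d = 2 * M" using M d(1) by (auto simp: K_def)
  have Kpos: "0 < K\<^sup>2 + 1" by (simp add: add_nonneg_pos)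
  \<comment> \<open>Chosen so that the field 2 K |X - \<Xi>| contributes at most e / 3; adding 1 to
    the square of K covers K = 0.\<close>
  define e3 where "e3 = e / (12 * (K\<^sup>2 + 1))"
  have e3: "0 < e3" "(2 * K)\<^sup>2 * e3 \<le> e / 3"
  proof -
    show "0 < e3" using e Kpos by (simp add: e3_def)
    have "e3 * (12 * (K\<^sup>2 + 1)) = e" using Kpos by (simp add: e3_def)
    then show "(2 * K)\<^sup>2 * e3 \<le> e / 3" using \<open>0 < e3\<close> by (simp add: power_mult_distrib algebra_simps)
  qed
  obtain D \<Xi> where \<Xi>: "step_process T D \<Xi>" "jointly_measurable T (\<lambda>s \<omega>. norm (X s \<omega> - \<Xi> s \<omega>))"
    "Q (\<lambda>s \<omega>. norm (X s \<omega> - \<Xi> s \<omega>)) \<le> ennreal e3"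
    using H_G_vec_D[OF X e3(1)] by blast
  \<comment> \<open>Chosen so that the field 4 K min(1, osc) contributes at most e / 3; the factor
    16 is the square of 4.\<close>
  define e2 where "e2 = e / (48 * T * (K\<^sup>2 + 1))"
  have e2: "0 < e2" "T * (16 * K\<^sup>2 * e2) \<le> e / 3"
  proof -
    show "0 < e2" using e Kpos T_pos by (simp add: e2_def)
    have "e2 * (48 * T * (K\<^sup>2 + 1)) = e" using Kpos T_pos by (simp add: e2_def)
    moreover have "0 \<le> T * e2" using \<open>0 < e2\<close> by simp
    ultimately show "T * (16 * K\<^sup>2 * e2) \<le> e / 3" by (simp add: algebra_simps)
  qed
  have "0 < r / (2 * (K + 1))" using r(1) K(1) by simp
  then obtain \<delta> where \<delta>: "0 < \<delta>" "\<delta> \<le> r / (2 * (K + 1))"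
    "\<And>P. P \<in> \<P> \<Longrightarrow> (\<integral>\<^sup>+\<omega>. ennreal (min 1 (osc T \<delta> \<omega>)) \<partial>P) \<le> ennreal e2"
    using osc_small_uniformly[OF compact borel_prob T_nonneg e2(1)] by blast
  have K\<delta>: "K * \<delta> \<le> r / 2"
  proof -
    have "(K + 1) * \<delta> \<le> r / 2" using \<delta>(2) K(1) by (simp add: pos_le_divide_eq algebra_simps)
    then show ?thesis using \<delta>(1) by (simp add: distrib_right)
  qed
  obtain n0 :: nat where "T / \<delta> \<le> real n0" using real_arch_simple by blast
  then have "T / \<delta> \<le> real (Suc n0)" by simp
  moreover define n where "n = Suc n0"
  ultimately have n: "0 < n" "T / real n \<le> \<delta>"
    using \<delta>(1) by (auto simp: pos_divide_le_eq mult.commute)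
  \<comment> \<open>The union of both grids keeps \<Xi> a step process and has mesh at most
    \<delta>.\<close>
  define D' where "D' = D \<union> (\<lambda>k. real k * T / n) ` {..<n}"
  have grid: "real k * T / n \<in> {0..<T}" if "k < n" for k
    using that T_pos n(1) by (auto simp: pos_divide_less_eq mult.commute)
  have D': "finite D'" "D \<subseteq> D'" "D' \<subseteq> {0..<T}"
    using step_processD[OF \<Xi>(1)] grid by (auto simp: D'_def)
  have \<Xi>': "step_process T D' \<Xi>" by (rule step_process_refine[OF \<Xi>(1) D'(2,1,3)])
  note \<Xi>D = step_processD[OF \<Xi>']
  define I where "I t \<omega> = interp T n (\<lambda>k. path_at \<omega> (min (real k * T / n) t))" for t and \<omega> :: "'d path"
  have "\<exists>h. cyl t h \<and> (\<forall>\<omega>. \<bar>F t (I t \<omega>) (\<Xi> t \<omega>) - h \<omega>\<bar> \<le> e1)" if t: "t \<in> D'" for t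
  proof -
    have tT: "t \<in> {0..T}" using t D'(3) by auto
    obtain N S C where S: "\<And>\<omega>. norm (\<Xi> t \<omega>) \<le> N" "0 \<le> N" "finite S" "S \<subseteq> {0..t}" "0 \<le> C"
      "\<And>\<omega> \<omega>'. norm (\<Xi> t \<omega> - \<Xi> t \<omega>') \<le> C * pos_dist S \<omega> \<omega>'"
      by (rule cylE[OF \<Xi>D(4)[OF t]]) blast
    \<comment> \<open>The positions that determine \<Xi> at time t, together with the nodes of the
      stopped path; all of them lie in [0,t].\<close>
    define S' where "S' = S \<union> (\<lambda>k. min (real k * T / n) t) ` {..n}"
    have S': "finite S'" "S' \<subseteq> {0..t}" "S \<subseteq> S'" using S(3,4) tT T_pos by (auto simp: S'_def)
    show ?thesis
    proof (rule cyl_approx[OF _ S'(1,2) e1])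
      show "\<bar>F t (I t \<omega>) (\<Xi> t \<omega>)\<bar> \<le> M" for \<omega> by (rule bound[OF tT])
      \<comment> \<open>Lipschitz constant of the whole argument of F in these positions: 2 n from
        the polygon, C from \<Xi>, and 1 to make it positive.\<close>
      define L where "L = 2 * real n + C + 1"
      have L: "0 < L" using S(5) by (simp add: L_def)
      have "\<bar>F t (I t \<omega>) (\<Xi> t \<omega>) - F t (I t \<omega>') (\<Xi> t \<omega>')\<bar> < e1"
        if small: "pos_dist S' \<omega> \<omega>' < d / L" for \<omega> \<omega>'
      proof (rule d(3)[OF tT tT])
        define \<rho> where "\<rho> = pos_dist S' \<omega> \<omega>'"
        have \<rho>: "0 \<le> \<rho>" unfolding \<rho>_def by (intro sum_nonneg) auto
        have node: "norm (path_at \<omega> (min (real k * T / n) t) - path_at \<omega>' (min (real k * T / n) t)) \<le> \<rho>" if "k \<le> n" for k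
          unfolding \<rho>_def using S'(1) that
          by (intro member_le_sum[of "min (real k * T / n) t" S' "\<lambda>u. norm (path_at \<omega> u - path_at \<omega>' u)"])
             (auto simp: S'_def)
        have "sup_dist T (stopped_path t (I t \<omega>)) (stopped_path t (I t \<omega>')) \<le> sup_dist T (I t \<omega>) (I t \<omega>')"
          using tT by (intro sup_dist_stopped_path_le) auto
        also have "\<dots> \<le> (\<Sum>k<n. norm (path_at \<omega> (min (real (Suc k) * T / n) t) - path_at \<omega>' (min (real (Suc k) * T / n) t))
            + norm (path_at \<omega> (min (real k * T / n) t) - path_at \<omega>' (min (real k * T / n) t)))"
          unfolding I_def by (rule sup_dist_interp_le[OF T_pos])
        also have "\<dots> \<le> (\<Sum>k<n. \<rho> + \<rho>)"
        proof (rule sum_mono)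
          fix k assume "k \<in> {..<n}"
          then show "norm (path_at \<omega> (min (real (Suc k) * T / n) t) - path_at \<omega>' (min (real (Suc k) * T / n) t))
            + norm (path_at \<omega> (min (real k * T / n) t) - path_at \<omega>' (min (real k * T / n) t)) \<le> \<rho> + \<rho>"
            using node[of k] node[of "Suc k"] by simp
        qed
        also have "\<dots> = 2 * real n * \<rho>" by simp
        finally have 1: "sup_dist T (stopped_path t (I t \<omega>)) (stopped_path t (I t \<omega>')) \<le> 2 * real n * \<rho>" .
        have "pos_dist S \<omega> \<omega>' \<le> \<rho>"
          unfolding \<rho>_def using S' by (intro sum_mono2) auto
        then have "C * pos_dist S \<omega> \<omega>' \<le> C * \<rho>" using S(5) by (rule mult_left_mono)
        then have 2: "dist (\<Xi> t \<omega>) (\<Xi> t \<omega>') \<le> C * \<rho>" using S(6)[of \<omega> \<omega>'] by (simp add: dist_norm)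
        have "L * \<rho> < d" using small L by (simp add: \<rho>_def pos_less_divide_eq mult.commute)
        then show "path_time_dist T t (I t \<omega>) t (I t \<omega>') + dist (\<Xi> t \<omega>) (\<Xi> t \<omega>') < d"
          using 1 2 \<rho> by (simp add: L_def distrib_right)
      qed
      then show "\<exists>d>0. \<forall>\<omega> \<omega>'. pos_dist S' \<omega> \<omega>' < d
          \<longrightarrow> \<bar>F t (I t \<omega>) (\<Xi> t \<omega>) - F t (I t \<omega>') (\<Xi> t \<omega>')\<bar> < e1"
        using d(1) L by (intro exI[of _ "d / L"]) simp
    qed
  qed
  then have "\<forall>t\<in>D'. \<exists>h. cyl t h \<and> (\<forall>\<omega>. \<bar>F t (I t \<omega>) (\<Xi> t \<omega>) - h \<omega>\<bar> \<le> e1)" by blast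
  from bchoice[OF this] obtain h where h: "\<And>t. t \<in> D' \<Longrightarrow> cyl t (h t)"
    "\<And>t \<omega>. t \<in> D' \<Longrightarrow> \<bar>F t (I t \<omega>) (\<Xi> t \<omega>) - h t \<omega>\<bar> \<le> e1" by blast
  define l where "l s = Max {t\<in>D'. t \<le> s}" for s
  define Y where "Y s = h (l s)" for s
  have l_D': "l t = t" if "t \<in> D'" for t
    unfolding l_def by (rule Max_eqI) (use D'(1) that in auto)
  have Y: "step_process T D' Y"
    unfolding step_process_def
  proof (intro conjI ballI allI impI)
    show "cyl t (Y t)" if "t \<in> D'" for t using h(1)[OF that] by (simp add: Y_def l_D'[OF that])
    fix s s' assume "0 \<le> s \<and> s < T \<and> 0 \<le> s' \<and> s' < T \<and> (\<forall>t\<in>D'. (t \<le> s) = (t \<le> s'))"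
    then have "{t\<in>D'. t \<le> s} = {t\<in>D'. t \<le> s'}" by blast
    then show "Y s = Y s'" by (simp add: Y_def l_def)
  qed (use \<Xi>D in auto)
  \<comment> \<open>If the total distance q is below d, uniform continuity gives e1; otherwise the
    increment is at most 2 M = K d and d is bounded by the three distances. A further e1 comes from
    replacing the field at the grid time by its cylinder approximation, and e1 + e1 + K \<delta> is
    at most r.\<close>
  have err: "\<bar>F s \<omega> (X s \<omega>) - Y s \<omega>\<bar> \<le> r + 2 * K * min 1 (osc T \<delta> \<omega>) + K * norm (X s \<omega> - \<Xi> s \<omega>)"
    if s: "0 \<le> s" "s < T" for s \<omega>
  proof -
    have l: "l s \<in> D'" "l s \<le> s" "\<And>t. t \<in> D' \<Longrightarrow> t \<le> s \<longleftrightarrow> t \<le> l s"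
      unfolding l_def using last_point[OF \<Xi>D(1,2) s(1)] by blast+
    define k where "k = nat \<lfloor>s * n / T\<rfloor>"
    have "0 \<le> s * n / T" "s * n / T < n" using s T_pos n(1) by (auto simp: pos_divide_less_eq mult.commute)
    then have k: "k < n" unfolding k_def by linarith
    have "real k * T / n \<le> s" "s \<le> (real k + 1) * T / n"
      unfolding k_def by (fact grid_point[OF T_pos n(1) s(1)])+
    moreover from this have "real k * T / n \<le> l s" using l(3)[of "real k * T / n"] k by (auto simp: D'_def)
    ultimately have mesh: "\<bar>s - l s\<bar> \<le> \<delta>" using l(2) n(2) by (simp add: distrib_right add_divide_distrib)
    have mem: "s \<in> {0..T}" "l s \<in> {0..T}" using s l(1) D'(3) by auto
    define q where "q = path_time_dist T s \<omega> (l s) (I (l s) \<omega>) + dist (X s \<omega>) (\<Xi> s \<omega>)"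
    have osc: "0 \<le> osc T \<delta> \<omega>" using \<delta>(1) by (intro osc_nonneg) auto
    have q: "q \<le> \<delta> + 2 * osc T \<delta> \<omega> + norm (X s \<omega> - \<Xi> s \<omega>)"
      unfolding q_def I_def using mesh sup_dist_stopped_interp_le[OF T_pos n(1,2) mem mesh, of \<omega>]
      by (simp add: dist_norm)
    have \<Xi>l: "\<Xi> s = \<Xi> (l s)" unfolding l_def by (rule step_process_last_point[OF \<Xi>' s])
    have nonneg: "0 \<le> K * \<delta>" "0 \<le> K * norm (X s \<omega> - \<Xi> s \<omega>)" "0 \<le> K * min 1 (osc T \<delta> \<omega>)"
      using K(1) \<delta>(1) osc by (auto intro!: mult_nonneg_nonneg)
    have "\<bar>F s \<omega> (X s \<omega>) - F (l s) (I (l s) \<omega>) (\<Xi> s \<omega>)\<bar>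
        \<le> e1 + K * \<delta> + 2 * (K * min 1 (osc T \<delta> \<omega>)) + K * norm (X s \<omega> - \<Xi> s \<omega>)"
    proof (cases "q < d")
      case True
      then have "\<bar>F s \<omega> (X s \<omega>) - F (l s) (I (l s) \<omega>) (\<Xi> s \<omega>)\<bar> < e1"
        unfolding q_def by (rule d(3)[OF mem])
      then show ?thesis using nonneg by linarith
    next
      case False
      have "\<bar>F s \<omega> (X s \<omega>) - F (l s) (I (l s) \<omega>) (\<Xi> s \<omega>)\<bar> \<le> 2 * M"
        using bound[OF mem(1), of \<omega> "X s \<omega>"] bound[OF mem(2), of "I (l s) \<omega>" "\<Xi> s \<omega>"] by linarith
      also have "2 * M \<le> K * (\<delta> + 2 * min 1 (osc T \<delta> \<omega>) + norm (X s \<omega> - \<Xi> s \<omega>))"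
        unfolding K(2)[symmetric]
      proof (rule mult_left_mono[OF _ K(1)])
        show "d \<le> \<delta> + 2 * min 1 (osc T \<delta> \<omega>) + norm (X s \<omega> - \<Xi> s \<omega>)"
        proof (cases "osc T \<delta> \<omega> \<le> 1")
          case True
          then show ?thesis using False q by simp
        next
          case False
          then have "min 1 (osc T \<delta> \<omega>) = 1" by simp
          moreover have "0 \<le> norm (X s \<omega> - \<Xi> s \<omega>)" by simp
          ultimately show ?thesis using d(2) \<delta>(1) by linarith
        qed
      qed
      also have "\<dots> = K * \<delta> + 2 * (K * min 1 (osc T \<delta> \<omega>)) + K * norm (X s \<omega> - \<Xi> s \<omega>)"
        by (simp only: distrib_left mult.left_commute)
      finally show ?thesis using e1 by linarith
    qed
    moreover have "\<bar>F (l s) (I (l s) \<omega>) (\<Xi> s \<omega>) - Y s \<omega>\<bar> \<le> e1"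
      using h(2)[OF l(1)] by (simp add: Y_def \<Xi>l)
    moreover have "e1 + e1 + K * \<delta> \<le> r" using K\<delta> by (simp add: e1_def)
    ultimately show ?thesis unfolding mult.assoc by linarith
  qed
  \<comment> \<open>Each error term is doubled so that the square of their sum is at most the sum of
    the squares of the doubled terms.\<close>
  define \<zeta> where "\<zeta> i = (if i = (0::nat) then (\<lambda>s \<omega>. 2 * r)
    else if i = 1 then (\<lambda>s \<omega>. 4 * K * min 1 (osc T \<delta> \<omega>)) else (\<lambda>s \<omega>. 2 * K * norm (X s \<omega> - \<Xi> s \<omega>)))" for i
  have osc_meas: "(\<lambda>\<omega>::'d path. min 1 (osc T \<delta> \<omega>)) \<in> borel_measurable borel"
    using \<delta>(1) by (intro borel_measurable_continuous_onI continuous_intros continuous_on_osc) auto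
  have jm_norm: "jointly_measurable T (\<lambda>s \<omega>. c * norm (X s \<omega> - \<Xi> s \<omega>))" for c
    using \<Xi>(2) unfolding jointly_measurable_iff by (intro borel_measurable_times borel_measurable_const)
  have "Q (\<lambda>s \<omega>. F s \<omega> (X s \<omega>) - Y s \<omega>) \<le> (\<Sum>i\<in>{0,1,2}. Q (\<zeta> i))"
  proof (rule Q_le_sum)
    show "jointly_measurable T (\<zeta> i)" if "i \<in> {0,1,2}" for i
    proof -
      have "jointly_measurable T (\<lambda>s (\<omega>::'d path). 2 * r)" "jointly_measurable T (\<lambda>s (\<omega>::'d path). 4 * K * min 1 (osc T \<delta> \<omega>))"
        using osc_meas by (auto intro!: jointly_measurable_path_functional borel_measurable_times)
      then show ?thesis using jm_norm[of "2 * K"] by (simp add: \<zeta>_def)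
    qed
    fix s \<omega> assume s: "0 \<le> s" "s < T"
    define A B C where "A = r" and "B = 2 * K * min 1 (osc T \<delta> \<omega>)" and "C = K * norm (X s \<omega> - \<Xi> s \<omega>)"
    have "\<bar>F s \<omega> (X s \<omega>) - Y s \<omega>\<bar> \<le> A + B + C" using err[OF s] by (simp add: A_def B_def C_def)
    then have "(F s \<omega> (X s \<omega>) - Y s \<omega>)\<^sup>2 \<le> (A + B + C)\<^sup>2"
      by (metis abs_ge_zero power2_abs power_mono)
    also have "\<dots> \<le> (2 * A)\<^sup>2 + (2 * B)\<^sup>2 + (2 * C)\<^sup>2"
    proof -
      have "0 \<le> (A - B)\<^sup>2 + (A - C)\<^sup>2 + (B - C)\<^sup>2 + A\<^sup>2 + B\<^sup>2 + C\<^sup>2" by simp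
      then show ?thesis by (simp add: power2_eq_square algebra_simps)
    qed
    also have "\<dots> = (\<Sum>i\<in>{0,1,2}. (\<zeta> i s \<omega>)\<^sup>2)"
      by (simp add: \<zeta>_def A_def B_def C_def mult.assoc)
    finally show "(F s \<omega> (X s \<omega>) - Y s \<omega>)\<^sup>2 \<le> (\<Sum>i\<in>{0,1,2}. (\<zeta> i s \<omega>)\<^sup>2)" .
  qed auto
  also have "\<dots> = Q (\<lambda>s \<omega>. 2 * r) + (Q (\<lambda>s \<omega>. 4 * K * min 1 (osc T \<delta> \<omega>)) + Q (\<lambda>s \<omega>. 2 * K * norm (X s \<omega> - \<Xi> s \<omega>)))"
    by (simp add: \<zeta>_def)
  also have "\<dots> \<le> ennreal (e / 3) + (ennreal (e / 3) + ennreal (e / 3))"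
  proof (intro add_mono)
    show "Q (\<lambda>s \<omega>. 2 * r) \<le> ennreal (e / 3)"
      using Q_const_le[of "2 * r"] ennreal_leI[OF r(3)] by (rule order_trans)
    have "Q (\<lambda>s \<omega>. 4 * K * min 1 (osc T \<delta> \<omega>)) \<le> ennreal T * ennreal (16 * K\<^sup>2 * e2)"
    proof (rule Q_path_functional_le)
      show "(\<lambda>\<omega>::'d path. 4 * K * min 1 (osc T \<delta> \<omega>)) \<in> borel_measurable borel"
        using osc_meas by (intro borel_measurable_times) auto
      fix P assume P: "P \<in> \<P>"
      have "(\<integral>\<^sup>+\<omega>. ennreal ((4 * K * min 1 (osc T \<delta> \<omega>))\<^sup>2) \<partial>P) \<le> (\<integral>\<^sup>+\<omega>. ennreal (16 * K\<^sup>2) * ennreal (min 1 (osc T \<delta> \<omega>)) \<partial>P)"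
      proof (rule nn_integral_mono)
        fix \<omega>
        define v where "v = min 1 (osc T \<delta> \<omega>)"
        have v: "0 \<le> v" "v \<le> 1" using osc_nonneg[OF T_nonneg, of \<delta> \<omega>] \<delta>(1) by (auto simp: v_def)
        \<comment> \<open>Since v lies in [0,1], its square is at most v, and the bound on first
          moments from Dini's theorem is enough.\<close>
        then have "v * v \<le> v * 1" by (intro mult_left_mono)
        then have "16 * K\<^sup>2 * (v * v) \<le> 16 * K\<^sup>2 * v" by (intro mult_left_mono) auto
        then show "ennreal ((4 * K * min 1 (osc T \<delta> \<omega>))\<^sup>2) \<le> ennreal (16 * K\<^sup>2) * ennreal (min 1 (osc T \<delta> \<omega>))"
          unfolding v_def[symmetric] using v
          by (simp add: ennreal_mult[symmetric] power_mult_distrib power2_eq_square ennreal_leI mult.left_commute)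
      qed
      also have "\<dots> = ennreal (16 * K\<^sup>2) * (\<integral>\<^sup>+\<omega>. ennreal (min 1 (osc T \<delta> \<omega>)) \<partial>P)"
        using measurable_P[OF P osc_meas] by (intro nn_integral_cmult measurable_compose[OF _ measurable_ennreal])
      also have "\<dots> \<le> ennreal (16 * K\<^sup>2) * ennreal e2" using \<delta>(3)[OF P] by (rule mult_left_mono) simp
      finally show "(\<integral>\<^sup>+\<omega>. ennreal ((4 * K * min 1 (osc T \<delta> \<omega>))\<^sup>2) \<partial>P) \<le> ennreal (16 * K\<^sup>2 * e2)"
        using e2(1) by (simp add: ennreal_mult)
    qed
    also have "\<dots> \<le> ennreal (e / 3)"
      using e2 T_pos by (simp add: ennreal_mult[symmetric] ennreal_leI)
    finally show "Q (\<lambda>s \<omega>. 4 * K * min 1 (osc T \<delta> \<omega>)) \<le> ennreal (e / 3)" .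
    have "Q (\<lambda>s \<omega>. 2 * K * norm (X s \<omega> - \<Xi> s \<omega>)) \<le> ennreal ((2 * K)\<^sup>2) * Q (\<lambda>s \<omega>. norm (X s \<omega> - \<Xi> s \<omega>))"
      by (rule Q_cmult_le[OF \<Xi>(2)])
    also have "\<dots> \<le> ennreal ((2 * K)\<^sup>2) * ennreal e3" by (rule mult_left_mono[OF \<Xi>(3)]) simp
    also have "\<dots> \<le> ennreal (e / 3)"
      using e3 by (simp add: ennreal_mult[symmetric] ennreal_leI)
    finally show "Q (\<lambda>s \<omega>. 2 * K * norm (X s \<omega> - \<Xi> s \<omega>)) \<le> ennreal (e / 3)" .
  qed
  also have "\<dots> = ennreal e" using e by (simp add: ennreal_plus[symmetric] del: ennreal_plus)
  finally show "\<exists>D Y. step_process T D Y \<and> Q (\<lambda>s \<omega>. F s \<omega> (X s \<omega>) - Y s \<omega>) \<le> ennreal e"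
    using Y by blast
qed

lemma jointly_measurable_mult_left:
  "jointly_measurable T \<eta> \<Longrightarrow> jointly_measurable T (\<lambda>s \<omega>. a * \<eta> s \<omega>)"
  unfolding jointly_measurable_iff by (intro borel_measurable_times borel_measurable_const)

lemma Q_triangle:
  assumes "jointly_measurable T \<eta>" "jointly_measurable T \<zeta>"
  shows "Q (\<lambda>s \<omega>. \<eta> s \<omega> + \<zeta> s \<omega>) \<le> ennreal 4 * Q \<eta> + ennreal 4 * Q \<zeta>"
proof -
  define \<xi> where "\<xi> i = (if i then (\<lambda>s \<omega>. 2 * \<eta> s \<omega>) else (\<lambda>s \<omega>. 2 * \<zeta> s \<omega>))" for i
  have "Q (\<lambda>s \<omega>. \<eta> s \<omega> + \<zeta> s \<omega>) \<le> (\<Sum>i\<in>{True, False}. Q (\<xi> i))"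
  proof (rule Q_le_sum)
    show "jointly_measurable T (\<xi> i)" for i
      using assms by (simp add: \<xi>_def jointly_measurable_mult_left)
    fix s \<omega>
    have "0 \<le> (\<eta> s \<omega> - \<zeta> s \<omega>)\<^sup>2 + 2 * (\<eta> s \<omega>)\<^sup>2 + 2 * (\<zeta> s \<omega>)\<^sup>2" by simp
    then show "(\<eta> s \<omega> + \<zeta> s \<omega>)\<^sup>2 \<le> (\<Sum>i\<in>{True, False}. (\<xi> i s \<omega>)\<^sup>2)"
      by (simp add: \<xi>_def power2_eq_square algebra_simps)
  qed auto
  also have "\<dots> = Q (\<lambda>s \<omega>. 2 * \<eta> s \<omega>) + Q (\<lambda>s \<omega>. 2 * \<zeta> s \<omega>)" by (simp add: \<xi>_def)
  also have "\<dots> \<le> ennreal (2\<^sup>2) * Q \<eta> + ennreal (2\<^sup>2) * Q \<zeta>"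
    by (intro add_mono Q_cmult_le assms)
  finally show ?thesis by simp
qed

text \<open>Used for truncations in space and for limits in \<open>S_G\<close>. Each of the two
  errors e / 8 is multiplied by the factor 4 of \<open>Q_triangle\<close>.\<close>

lemma H_G_closed:
  assumes jm: "jointly_measurable T \<eta>"
    and approx: "\<And>e. 0 < e \<Longrightarrow> \<exists>\<zeta>\<in>H_G \<P> 2 T. Q (\<lambda>s \<omega>. \<eta> s \<omega> - \<zeta> s \<omega>) \<le> ennreal e"
  shows "\<eta> \<in> H_G \<P> 2 T"
proof (rule H_G_I[OF jm])
  fix e :: real assume e: "0 < e"
  obtain \<zeta> where \<zeta>: "\<zeta> \<in> H_G \<P> 2 T" "Q (\<lambda>s \<omega>. \<eta> s \<omega> - \<zeta> s \<omega>) \<le> ennreal (e/8)"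
    using approx[of "e/8"] e by auto
  obtain D Y where Y: "step_process T D Y" "jointly_measurable T Y" "Q (\<lambda>s \<omega>. \<zeta> s \<omega> - Y s \<omega>) \<le> ennreal (e/8)"
    using H_G_D[OF \<zeta>(1), of "e/8"] e by auto
  have jm\<zeta>: "jointly_measurable T \<zeta>" using \<zeta>(1) by (simp add: H_G_def)
  have "Q (\<lambda>s \<omega>. \<eta> s \<omega> - Y s \<omega>) = Q (\<lambda>s \<omega>. (\<eta> s \<omega> - \<zeta> s \<omega>) + (\<zeta> s \<omega> - Y s \<omega>))" by simp
  also have "\<dots> \<le> ennreal 4 * Q (\<lambda>s \<omega>. \<eta> s \<omega> - \<zeta> s \<omega>) + ennreal 4 * Q (\<lambda>s \<omega>. \<zeta> s \<omega> - Y s \<omega>)"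
    by (intro Q_triangle jointly_measurable_diff jm jm\<zeta> Y(2))
  also have "\<dots> \<le> ennreal 4 * ennreal (e/8) + ennreal 4 * ennreal (e/8)"
    by (intro add_mono mult_left_mono \<zeta>(2) Y(3)) auto
  also have "ennreal 4 * ennreal (e/8) = ennreal (e/2)"
    using e by (subst ennreal_mult[symmetric]) auto
  also have "ennreal (e/2) + ennreal (e/2) = ennreal e"
    using e by (subst ennreal_plus[symmetric]) auto
  finally show "\<exists>D X. step_process T D X \<and> Q (\<lambda>s \<omega>. \<eta> s \<omega> - X s \<omega>) \<le> ennreal e"
    using Y(1) by blast
qed

text \<open>The tail of an integrand is negligible because the approximating step processes are bounded.\<close>

lemma regular_H_G:
  fixes F :: "real \<Rightarrow> 'd path \<Rightarrow> 'e::euclidean_space \<Rightarrow> real"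
  assumes F: "regular T F"
    and growth: "\<And>s \<omega> x. s \<in> {0..T} \<Longrightarrow> \<bar>F s \<omega> x\<bar> \<le> C * (1 + norm x)"
    and X: "X \<in> H_G_vec \<P> 2 T"
  shows "(\<lambda>s \<omega>. F s \<omega> (X s \<omega>)) \<in> H_G \<P> 2 T"
proof -
  have jmX: "jointly_measurable T (\<lambda>s \<omega>. X s \<omega> \<bullet> b)" if "b \<in> Basis" for b
    using X that by (auto simp: H_G_vec_def H_G_def)
  have jm: "jointly_measurable T (\<lambda>s \<omega>. F s \<omega> (X s \<omega>))"
    by (rule regular_jointly_measurable[OF F T_pos jmX])
  have C: "0 \<le> C" using growth[of 0 undefined 0] by simp
  show ?thesis
  proof (rule H_G_closed[OF jm])
    fix e :: real assume e: "0 < e"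
    define c where "c = e / ((8 * C)\<^sup>2 + 1)"
    have "0 < (8 * C)\<^sup>2 + 1" by (simp add: add_nonneg_pos)
    then have c: "0 < c" "(8 * C)\<^sup>2 * c \<le> e"
      using e by (auto simp: c_def pos_divide_le_eq algebra_simps)
    obtain D \<Xi> where \<Xi>: "step_process T D \<Xi>" "jointly_measurable T (\<lambda>s \<omega>. norm (X s \<omega> - \<Xi> s \<omega>))"
      "Q (\<lambda>s \<omega>. norm (X s \<omega> - \<Xi> s \<omega>)) \<le> ennreal c"
      using H_G_vec_D[OF X c(1)] by blast
    note \<Xi>D = step_processD[OF \<Xi>(1)]
    have "\<forall>t\<in>D. \<exists>R. \<forall>\<omega>. norm (\<Xi> t \<omega>) \<le> R"
      using \<Xi>D(4) unfolding cyl_def bounded_iff by blast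
    from bchoice[OF this] obtain R0 where R0: "\<And>t \<omega>. t \<in> D \<Longrightarrow> norm (\<Xi> t \<omega>) \<le> R0 t" by blast
    define R where "R = Max (R0 ` D)"
    have R: "norm (\<Xi> s \<omega>) \<le> R" if "0 \<le> s" "s < T" for s \<omega>
    proof -
      have "Max {t\<in>D. t \<le> s} \<in> D" by (rule last_point(1)[OF \<Xi>D(1,2) that(1)])
      then show ?thesis
        unfolding step_process_last_point[OF \<Xi>(1) that] R_def
        using R0[OF \<open>Max {t\<in>D. t \<le> s} \<in> D\<close>, of \<omega>] \<Xi>D(1) by (intro Max.coboundedI order_trans[OF _ Max_ge]) auto
    qed
    \<comment> \<open>If |X| exceeds N >= 2 R while |\<Xi>| is at most R, then |X| is at most 2 |X -
      \<Xi>|: large values of X are part of the approximation error.\<close>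
    define N where "N = max 1 (2 * R)"
    have N: "1 \<le> N" "2 * R \<le> N" by (auto simp: N_def)
    \<comment> \<open>The projection onto the ball does not increase distances, so the truncated
      field is bounded and uniformly continuous on the whole space.\<close>
    define \<pi> where "\<pi> = (closest_point (cball 0 N) :: 'e \<Rightarrow> 'e)"
    have \<pi>_le: "norm (\<pi> x) \<le> N" for x
      using closest_point_in_set[of "cball (0::'e) N" x] N by (auto simp: \<pi>_def)
    have \<pi>_id: "\<pi> x = x" if "norm x \<le> N" for x
      unfolding \<pi>_def using that by (intro closest_point_self) auto
    have \<pi>_lip: "dist (\<pi> x) (\<pi> y) \<le> dist x y" for x y
      unfolding \<pi>_def using N by (intro closest_point_lipschitz) auto
    obtain M where M: "0 \<le> M" "\<And>s \<omega> x. s \<in> {0..T} \<Longrightarrow> norm x \<le> N \<Longrightarrow> \<bar>F s \<omega> x\<bar> \<le> M"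
      by (rule regular_bounded[OF F, of N]) blast
    have unif: "\<exists>d>0. \<forall>s\<in>{0..T}. \<forall>s'\<in>{0..T}. \<forall>\<omega> \<omega>' x x'.
      path_time_dist T s \<omega> s' \<omega>' + dist x x' < d \<longrightarrow> \<bar>F s \<omega> (\<pi> x) - F s' \<omega>' (\<pi> x')\<bar> < e'"
      if e': "0 < e'" for e'
    proof -
      obtain d where d: "0 < d" "uniformly_close T N F e' d"
        by (rule regular_uniformly_continuous[OF F e'])
      note d = d(1) d(2)[rule_format]
      show ?thesis
      proof (intro exI[of _ d] conjI ballI allI impI d(1))
        fix s s' and \<omega> \<omega>' :: "'d path" and x x' :: 'e assume s: "s \<in> {0..T}" "s' \<in> {0..T}"
          and "path_time_dist T s \<omega> s' \<omega>' + dist x x' < d"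
        then show "\<bar>F s \<omega> (\<pi> x) - F s' \<omega>' (\<pi> x')\<bar> < e'"
          using \<pi>_lip[of x x'] by (intro d(2) \<pi>_le) auto
      qed
    qed
    have "regular T (\<lambda>s \<omega> x. F s \<omega> (\<pi> x))"
      unfolding regular_def using M(2)[OF _ \<pi>_le] unif by meson
    then have jm\<pi>: "jointly_measurable T (\<lambda>s \<omega>. F s \<omega> (\<pi> (X s \<omega>)))"
      by (rule regular_jointly_measurable[OF _ T_pos jmX])
    have in_H_G: "(\<lambda>s \<omega>. F s \<omega> (\<pi> (X s \<omega>))) \<in> H_G \<P> 2 T"
      using uniformly_continuous_field_H_G[of "\<lambda>s \<omega> x. F s \<omega> (\<pi> x)" X M, OF jm\<pi> M(2)[OF _ \<pi>_le] M(1) unif X] .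
    \<comment> \<open>Outside the ball, 2 + |X| + |\<pi> X| is at most 4 |X|, because 1 <= N < |X|;
      hence at most 8 |X - \<Xi>|.\<close>
    have tail: "\<bar>F s \<omega> (X s \<omega>) - F s \<omega> (\<pi> (X s \<omega>))\<bar> \<le> 8 * C * norm (X s \<omega> - \<Xi> s \<omega>)"
      if s: "0 \<le> s" "s < T" for s \<omega>
    proof (cases "norm (X s \<omega>) \<le> N")
      case True
      then show ?thesis using C by (simp add: \<pi>_id)
    next
      case False
      have "norm (X s \<omega>) \<le> norm (X s \<omega> - \<Xi> s \<omega>) + norm (\<Xi> s \<omega>)"
        using norm_triangle_ineq[of "X s \<omega> - \<Xi> s \<omega>" "\<Xi> s \<omega>"] by simp
      then have *: "norm (X s \<omega>) \<le> 2 * norm (X s \<omega> - \<Xi> s \<omega>)"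
        using R[OF s, of \<omega>] N False by linarith
      have sT: "s \<in> {0..T}" using s by simp
      have "\<bar>F s \<omega> (X s \<omega>) - F s \<omega> (\<pi> (X s \<omega>))\<bar> \<le> C * (1 + norm (X s \<omega>)) + C * (1 + norm (\<pi> (X s \<omega>)))"
        using growth[OF sT, of \<omega> "X s \<omega>"] growth[OF sT, of \<omega> "\<pi> (X s \<omega>)"] by linarith
      also have "\<dots> = C * (2 + norm (X s \<omega>) + norm (\<pi> (X s \<omega>)))" by (simp add: algebra_simps)
      also have "\<dots> \<le> C * (8 * norm (X s \<omega> - \<Xi> s \<omega>))"
        using C * \<pi>_le[of "X s \<omega>"] N(1) False by (intro mult_left_mono) linarith+
      finally show ?thesis by simp
    qed
    have "Q (\<lambda>s \<omega>. F s \<omega> (X s \<omega>) - F s \<omega> (\<pi> (X s \<omega>))) \<le> ennreal e"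
    proof -
      have "Q (\<lambda>s \<omega>. F s \<omega> (X s \<omega>) - F s \<omega> (\<pi> (X s \<omega>))) \<le> Q (\<lambda>s \<omega>. 8 * C * norm (X s \<omega> - \<Xi> s \<omega>))"
        using tail C by (intro Q_mono) (simp add: abs_mult)
      also have "\<dots> \<le> ennreal ((8 * C)\<^sup>2) * Q (\<lambda>s \<omega>. norm (X s \<omega> - \<Xi> s \<omega>))"
        by (rule Q_cmult_le[OF \<Xi>(2)])
      also have "\<dots> \<le> ennreal ((8 * C)\<^sup>2) * ennreal c" by (rule mult_left_mono[OF \<Xi>(3)]) simp
      also have "\<dots> = ennreal ((8 * C)\<^sup>2 * c)" using c(1) by (intro ennreal_mult[symmetric]) auto
      also have "\<dots> \<le> ennreal e" using c(2) by (intro ennreal_leI)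
      finally show ?thesis .
    qed
    then show "\<exists>\<zeta>\<in>H_G \<P> 2 T. Q (\<lambda>s \<omega>. F s \<omega> (X s \<omega>) - \<zeta> s \<omega>) \<le> ennreal e"
      using in_H_G by (rule bexI)
  qed
qed

section \<open>Constant processes and the inclusion of \<open>S_G\<close> in
  \<open>H_G\<close>\<close>

lemma H_G_const: "(\<lambda>s \<omega>. c) \<in> H_G \<P> 2 T"
proof (rule H_G_I)
  show "jointly_measurable T (\<lambda>s (\<omega>::'d path). c)" by (rule jointly_measurable_path_functional) simp
  have "step_process T {0} (\<lambda>s (\<omega>::'d path). c)"
    using T_pos cyl_const[of 0 c] by (simp add: step_process_def)
  moreover have "Q (\<lambda>s (\<omega>::'d path). c - c) = 0"
    using Q_const_le[of 0] by simp
  ultimately show "\<exists>D X. step_process T D X \<and> Q (\<lambda>s (\<omega>::'d path). c - X s \<omega>) \<le> ennreal e" for e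
    by (intro exI[of _ "{0}"] exI[of _ "\<lambda>s \<omega>. c"]) simp
qed

text \<open>Such a process is a bounded field, Lipschitz in time and stopped path, with a dummy
  space variable at which the zero process is substituted.\<close>

lemma S0_G_imp_H_G:
  assumes "Y \<in> S0_G T"
  shows "Y \<in> H_G \<P> 2 T"
proof -
  obtain n t h where t: "\<And>i. i < (n::nat) \<Longrightarrow> t i \<in> {0..T}"
    and "bounded (range (\<lambda>(s, x). h s x))"
    and "\<exists>C. \<forall>s s' x x'. \<bar>h s x - h s' x'\<bar> \<le> C * (\<bar>s - s'\<bar> + (\<Sum>i<n. norm (x i - x' i)))"
    and Y: "Y = (\<lambda>s \<omega>. h s (\<lambda>i. path_at \<omega> (min (t i) s)))"
    using assms unfolding S0_G_def by blast
  then obtain M C where M: "\<And>s x. \<bar>h s x\<bar> \<le> M"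
    and C: "\<And>s s' x x'. \<bar>h s x - h s' x'\<bar> \<le> C * (\<bar>s - s'\<bar> + (\<Sum>i<n. norm (x i - x' i)))"
    unfolding bounded_iff by fastforce
  \<comment> \<open>The position at \<open>min (t i) s\<close> is that of the stopped path at
    \<open>t i\<close>, so each of the n terms is bounded by the distance of the stopped
    paths.\<close>
  define L where "L = \<bar>C\<bar> * (1 + real n) + 1"
  have L: "0 < L" by (simp add: L_def add_nonneg_pos)
  have lip: "\<bar>Y s \<omega> - Y s' \<omega>'\<bar> \<le> L * path_time_dist T s \<omega> s' \<omega>'" for s s' \<omega> \<omega>'
  proof -
    let ?q = "path_time_dist T s \<omega> s' \<omega>'"
    have q: "0 \<le> ?q" by (intro add_nonneg_nonneg sup_dist_nonneg) auto
    have "(\<Sum>i<n. norm (path_at \<omega> (min (t i) s) - path_at \<omega>' (min (t i) s'))) \<le> (\<Sum>i<n. ?q)"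
    proof (rule sum_mono)
      fix i assume "i \<in> {..<n}"
      then have "t i \<in> {0..T}" using t by simp
      then show "norm (path_at \<omega> (min (t i) s) - path_at \<omega>' (min (t i) s')) \<le> ?q"
        using dist_le_sup_dist[of "t i" T "stopped_path s \<omega>" "stopped_path s' \<omega>'"]
        by (simp add: path_at_stopped_path dist_norm)
    qed
    then have *: "\<bar>s - s'\<bar> + (\<Sum>i<n. norm (path_at \<omega> (min (t i) s) - path_at \<omega>' (min (t i) s'))) \<le> (1 + real n) * ?q"
      using sup_dist_nonneg[OF T_nonneg, of "stopped_path s \<omega>" "stopped_path s' \<omega>'"] by (simp add: distrib_right)
    have "\<bar>Y s \<omega> - Y s' \<omega>'\<bar> \<le> C * (\<bar>s - s'\<bar> + (\<Sum>i<n. norm (path_at \<omega> (min (t i) s) - path_at \<omega>' (min (t i) s'))))"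
      unfolding Y by (rule C)
    also have "\<dots> \<le> \<bar>C\<bar> * (\<bar>s - s'\<bar> + (\<Sum>i<n. norm (path_at \<omega> (min (t i) s) - path_at \<omega>' (min (t i) s'))))"
      by (intro mult_right_mono add_nonneg_nonneg sum_nonneg) auto
    also have "\<dots> \<le> \<bar>C\<bar> * ((1 + real n) * ?q)" by (rule mult_left_mono[OF *]) simp
    also have "\<dots> \<le> L * ?q" using q by (simp add: L_def algebra_simps)
    finally show ?thesis .
  qed
  have "regular T (\<lambda>s \<omega> (x::real). Y s \<omega>)"
  proof (rule regularI)
    show "\<exists>C. \<forall>s\<in>{0..T}. \<forall>\<omega> x. norm (x::real) \<le> N \<longrightarrow> \<bar>Y s \<omega>\<bar> \<le> C" for N
      using M unfolding Y by blast
    fix N e :: real assume e: "0 < e"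
    have "\<bar>Y s \<omega> - Y s' \<omega>'\<bar> < e"
      if "path_time_dist T s \<omega> s' \<omega>' + dist x x' < e / L"
      for s s' \<omega> \<omega>' and x x' :: real
    proof -
      have "L * path_time_dist T s \<omega> s' \<omega>' < e"
      proof -
        have "path_time_dist T s \<omega> s' \<omega>' < e / L"
          using that zero_le_dist[of x x'] by linarith
        then show ?thesis using L by (simp add: pos_less_divide_eq mult.commute)
      qed
      then show ?thesis using lip[of s \<omega> s' \<omega>'] by linarith
    qed
    then show "\<exists>d>0. uniformly_close T N (\<lambda>s \<omega> (x::real). Y s \<omega>) e d"
      using e L by (intro exI[of _ "e / L"]) simp
  qed
  then show ?thesis
  proof (rule regular_H_G[where C=M])
    have "0 \<le> M" using M[of 0 undefined] by linarith
    then show "\<bar>Y s \<omega>\<bar> \<le> M * (1 + norm x)" for s \<omega> and x :: real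
      using M[of s "\<lambda>i. path_at \<omega> (min (t i) s)"] by (simp add: Y distrib_left add_increasing2)
    show "(\<lambda>s \<omega>. 0::real) \<in> H_G_vec \<P> 2 T" using H_G_const by (simp add: H_G_vec_def)
  qed
qed

text \<open>The supremum over all times need not be measurable. The strict inequality yields, for
  each P, a measurable majorant with integral below c, which bounds the time integral pathwise up to
  the factor T.\<close>

lemma Q_le_upper_expectation:
  assumes "upper_expectation \<P> (\<lambda>\<omega>. SUP s\<in>{0..T}. ennreal (\<bar>D s \<omega>\<bar> powr 2)) < c"
  shows "Q D \<le> ennreal T * c"
proof (rule Q_leI)
  fix P assume P: "P \<in> \<P>"
  let ?X = "\<lambda>\<omega>. SUP s\<in>{0..T}. ennreal (\<bar>D s \<omega>\<bar> powr 2)"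
  have "(INF V\<in>{V \<in> borel_measurable P. \<forall>\<omega>. ?X \<omega> \<le> V \<omega>}. \<integral>\<^sup>+\<omega>. V \<omega> \<partial>P) < c"
    using assms unfolding upper_expectation_def by (rule le_less_trans[rotated]) (rule SUP_upper[OF P])
  then obtain V where V: "V \<in> borel_measurable P" "\<And>\<omega>. ?X \<omega> \<le> V \<omega>" "(\<integral>\<^sup>+\<omega>. V \<omega> \<partial>P) < c"
    unfolding INF_less_iff by blast
  have "(\<integral>\<^sup>+\<omega>. (\<integral>\<^sup>+s\<in>{0..T}. ennreal ((D s \<omega>)\<^sup>2) \<partial>lborel) \<partial>P) \<le> (\<integral>\<^sup>+\<omega>. ennreal T * V \<omega> \<partial>P)"
  proof (rule nn_integral_mono)
    fix \<omega>
    have "(\<integral>\<^sup>+s\<in>{0..T}. ennreal ((D s \<omega>)\<^sup>2) \<partial>lborel) \<le> (\<integral>\<^sup>+s. V \<omega> * indicator {0..T} s \<partial>lborel)"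
    proof (rule nn_integral_mono)
      fix s
      show "ennreal ((D s \<omega>)\<^sup>2) * indicator {0..T} s \<le> V \<omega> * indicator {0..T} s"
      proof (cases "s \<in> {0..T}")
        case True
        then have "ennreal (\<bar>D s \<omega>\<bar> powr 2) \<le> ?X \<omega>" by (rule SUP_upper)
        also have "\<dots> \<le> V \<omega>" by (rule V(2))
        finally show ?thesis using True by simp
      qed simp
    qed
    also have "\<dots> = V \<omega> * ennreal T" by (subst nn_integral_cmult_indicator) simp_all
    finally show "(\<integral>\<^sup>+s\<in>{0..T}. ennreal ((D s \<omega>)\<^sup>2) \<partial>lborel) \<le> ennreal T * V \<omega>" by (simp add: mult.commute)
  qed
  also have "\<dots> = ennreal T * (\<integral>\<^sup>+\<omega>. V \<omega> \<partial>P)" by (rule nn_integral_cmult[OF V(1)])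
  also have "\<dots> \<le> ennreal T * c" using V(3) by (intro mult_left_mono) auto
  finally show "(\<integral>\<^sup>+\<omega>. (\<integral>\<^sup>+s\<in>{0..T}. ennreal ((D s \<omega>)\<^sup>2) \<partial>lborel) \<partial>P) \<le> ennreal T * c" .
qed

lemma S_G_imp_H_G:
  assumes "Y \<in> S_G \<P> 2 T"
  shows "Y \<in> H_G \<P> 2 T"
proof -
  obtain h where h: "\<And>n. h n \<in> S0_G T" and lim: "(\<lambda>n. S_G_norm \<P> 2 T (\<lambda>s \<omega>. Y s \<omega> - h n s \<omega>)) \<longlonglongrightarrow> 0"
    and jm: "jointly_measurable T Y"
    using assms unfolding S_G_def by blast
  show ?thesis
  proof (rule H_G_closed[OF jm])
    fix e :: real assume e: "0 < e"
    \<comment> \<open>The factor 2 leaves room to pass from a bound by c to the strict bound by 2 c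
      required by \<open>Q_le_upper_expectation\<close>.\<close>
    define c where "c = e / (2 * T)"
    have c: "0 < c" using e T_pos by (simp add: c_def)
    then have "0 < ennreal (c powr (1/2))" by simp
    from order_tendstoD(2)[OF lim this]
    obtain n where n: "S_G_norm \<P> 2 T (\<lambda>s \<omega>. Y s \<omega> - h n s \<omega>) < ennreal (c powr (1/2))"
      by (auto simp: eventually_sequentially)
    have "upper_expectation \<P> (\<lambda>\<omega>. SUP s\<in>{0..T}. ennreal (\<bar>Y s \<omega> - h n s \<omega>\<bar> powr 2)) \<le> ennreal c"
      by (rule ennreal_powr_less_imp_le[OF _ c, of "1/2"]) (use n in \<open>simp_all add: S_G_norm_def\<close>)
    also have "ennreal c < ennreal (2 * c)" using c by (simp add: ennreal_less_iff)
    finally have "Q (\<lambda>s \<omega>. Y s \<omega> - h n s \<omega>) \<le> ennreal T * ennreal (2 * c)"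
      by (rule Q_le_upper_expectation)
    also have "\<dots> = ennreal e"
      using c T_pos by (subst ennreal_mult[symmetric]) (simp_all add: c_def)
    finally show "\<exists>\<zeta>\<in>H_G \<P> 2 T. Q (\<lambda>s \<omega>. Y s \<omega> - \<zeta> s \<omega>) \<le> ennreal e"
      using S0_G_imp_H_G[OF h] by (rule bexI)
  qed
qed

end

section \<open>Domination of G-BMO martingale generators\<close>

lemma sets_natural_filtration_subset: "sets (natural_filtration t :: ('d::finite) path measure) \<subseteq> sets borel"
proof -
  have "(\<lambda>\<omega>::'d path. path_at \<omega> s) -` A \<in> sets borel" if "A \<in> sets borel" for s A
    using measurable_sets[OF borel_measurable_continuous_onI[OF continuous_on_path_eval[of s]] that] by simp
  then have "{(\<lambda>\<omega>::'d path. path_at \<omega> s) -` A |s A. 0 \<le> s \<and> s \<le> t \<and> A \<in> sets borel} \<subseteq> sets borel"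
    by blast
  from sets.sigma_sets_subset[OF this] show ?thesis
    unfolding natural_filtration_def by (simp add: sets_measure_of)
qed

lemma space_natural_filtration: "space (natural_filtration t) = UNIV"
  using filtration.space_F[OF filtration_natural_filtration] .

text \<open>Since \<tau> never exceeds T, events of the stopped sigma-algebra belong to the
  sigma-algebra at time T.\<close>

lemma sets_stopped_sigma_subset:
  assumes "stopping_time natural_filtration \<tau>" "\<And>\<omega>. \<tau> \<omega> \<le> T"
  shows "sets (stopped_sigma \<tau>) \<subseteq> sets (borel :: ('d::finite) path measure)"
proof
  fix A :: "'d path set" assume "A \<in> sets (stopped_sigma \<tau>)"
  from filtration.sets_pre_sigmaD[OF filtration_natural_filtration assms(1) this, of T]
  have "A \<in> sets (natural_filtration T)" using assms(2) by simp
  then show "A \<in> sets borel" using sets_natural_filtration_subset by blast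
qed

context compact_family
begin

lemma H_G_vec_norm_measurable:
  fixes X :: "real \<Rightarrow> 'd path \<Rightarrow> 'e::euclidean_space"
  assumes "X \<in> H_G_vec \<P> 2 T"
  shows "jointly_measurable T (\<lambda>s \<omega>. norm (X s \<omega>))"
  using assms by (intro jointly_measurable_norm_vec) (auto simp: H_G_vec_def H_G_def)

text \<open>Conditional expectation is monotone and additive, so the bound for l follows from those
  for Z and Z' and from the length of the interval. The resulting constant c is the same for all
  measures and all stopping times.\<close>

lemma G_BMO_generator_dominated:
  fixes l :: "real \<Rightarrow> 'd path \<Rightarrow> 'k::euclidean_space" and Z :: "real \<Rightarrow> 'd path \<Rightarrow> 'm::euclidean_space"
    and Z' :: "real \<Rightarrow> 'd path \<Rightarrow> 'n::euclidean_space"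
  assumes l: "l \<in> H_G_vec \<P> 2 T"
    and Z: "G_BMO_generator \<P> T Z" and Z': "G_BMO_generator \<P> T Z'"
    and dom: "\<And>s \<omega>. s \<in> {0..T} \<Longrightarrow> norm (l s \<omega>) \<le> C * (1 + norm (Z s \<omega>) + norm (Z' s \<omega>))"
  shows "G_BMO_generator \<P> T l"
proof -
  define I where "I y \<tau> \<omega> = (\<integral>\<^sup>+s\<in>{\<tau> \<omega>..T}. ennreal ((y s \<omega>)\<^sup>2) \<partial>lborel)" for y :: "real \<Rightarrow> 'd path \<Rightarrow> real" and \<tau> \<omega>
  let ?ST = "{\<tau>. stopping_time natural_filtration \<tau> \<and> (\<forall>\<omega>::'d path. \<tau> \<omega> \<in> {0..T})}"
  define B where "B y = (SUP P\<in>\<P>. SUP \<tau>\<in>?ST. esssup P (nn_cond_exp P (stopped_sigma \<tau>) (I y \<tau>)))" for y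
  have jml: "jointly_measurable T (\<lambda>s \<omega>. norm (l s \<omega>))" by (rule H_G_vec_norm_measurable[OF l])
  have jmZ: "jointly_measurable T (\<lambda>s \<omega>. norm (Z s \<omega>))" "jointly_measurable T (\<lambda>s \<omega>. norm (Z' s \<omega>))"
    using Z Z' by (auto simp: G_BMO_generator_def intro: H_G_vec_norm_measurable)
  have fin: "B (\<lambda>s \<omega>. norm (Z s \<omega>)) < \<infinity>" "B (\<lambda>s \<omega>. norm (Z' s \<omega>)) < \<infinity>"
    using Z Z' unfolding G_BMO_generator_def B_def I_def by auto
  \<comment> \<open>The 3 comes from (1 + a + b)^2 <= 3 (1 + a^2 + b^2).\<close>
  define K where "K = 3 * C\<^sup>2"
  have K: "0 \<le> K" by (simp add: K_def)
  define c where "c = ennreal K * (ennreal T + (B (\<lambda>s \<omega>. norm (Z s \<omega>)) + B (\<lambda>s \<omega>. norm (Z' s \<omega>))))"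
  have square: "(norm (l s \<omega>))\<^sup>2 \<le> K * (1 + ((norm (Z s \<omega>))\<^sup>2 + (norm (Z' s \<omega>))\<^sup>2))" if "s \<in> {0..T}" for s \<omega>
  proof -
    let ?a = "norm (Z s \<omega>)" and ?b = "norm (Z' s \<omega>)"
    have "(norm (l s \<omega>))\<^sup>2 \<le> (C * (1 + ?a + ?b))\<^sup>2" by (rule power_mono[OF dom[OF that]]) simp
    also have "\<dots> = C\<^sup>2 * (1 + ?a + ?b)\<^sup>2" by (rule power_mult_distrib)
    also have "\<dots> \<le> C\<^sup>2 * (3 * (1 + (?a\<^sup>2 + ?b\<^sup>2)))"
    proof (rule mult_left_mono)
      have "0 \<le> (1 - ?a)\<^sup>2 + (1 - ?b)\<^sup>2 + (?a - ?b)\<^sup>2" by simp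
      then show "(1 + ?a + ?b)\<^sup>2 \<le> 3 * (1 + (?a\<^sup>2 + ?b\<^sup>2))" by (simp add: power2_eq_square algebra_simps)
    qed simp
    finally show ?thesis by (simp only: K_def mult_ac)
  qed
  have "esssup P (nn_cond_exp P (stopped_sigma \<tau>) (I (\<lambda>s \<omega>. norm (l s \<omega>)) \<tau>)) \<le> c"
    if P: "P \<in> \<P>" and \<tau>: "\<tau> \<in> ?ST" for P \<tau>
  proof -
    interpret prob_space P by (rule prob_space_P[OF P])
    have setsP: "sets P = sets borel" using borel_prob P by (auto simp: borel_probabilities_def)
    then have spaceP: "space P = UNIV" using sets_eq_imp_space_eq by fastforce
    have sub: "subalgebra P (stopped_sigma \<tau>)"
      unfolding subalgebra_def setsP spaceP
      using \<tau> sets_stopped_sigma_subset[of \<tau> T] filtration.space_pre_sigma[OF filtration_natural_filtration, of \<tau>] by auto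
    interpret finite_measure_subalgebra P "stopped_sigma \<tau>" by unfold_locales (rule sub)
    have "\<tau> \<in> borel_measurable borel"
      using \<tau> sets_natural_filtration_subset
      by (intro measurable_stopping_time[of natural_filtration]) (auto simp: space_natural_filtration)
    then have I_meas: "I y \<tau> \<in> borel_measurable P" if "jointly_measurable T y" for y
    proof -
      \<comment> \<open>The clamp of time is invisible here because \<tau> takes values in
        [0,T].\<close>
      have "(\<integral>\<^sup>+s. ennreal ((y (max 0 (min T s)) \<omega>)\<^sup>2) * indicator {\<tau> \<omega>..T} s \<partial>lborel) = I y \<tau> \<omega>" for \<omega>
      proof -
        have "0 \<le> \<tau> \<omega>" using \<tau> by simp
        then show ?thesis unfolding I_def
          by (intro nn_integral_cong) (auto simp: indicator_def max_def min_def)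
      qed
      then show ?thesis
        using borel_measurable_time_integral[OF T_nonneg that \<open>\<tau> \<in> borel_measurable borel\<close>]
        by (intro measurable_P[OF P]) simp
    qed
    let ?l = "\<lambda>s \<omega>. norm (l s \<omega>)" and ?Z = "\<lambda>s \<omega>. norm (Z s \<omega>)" and ?Z' = "\<lambda>s \<omega>. norm (Z' s \<omega>)"
    note [measurable] = I_meas[OF jml] I_meas[OF jmZ(1)] I_meas[OF jmZ(2)]
    let ?E = "nn_cond_exp P (stopped_sigma \<tau>)"
    have slice: "(\<lambda>s. ennreal ((y s \<omega>)\<^sup>2) * indicator {\<tau> \<omega>..T} s) \<in> borel_measurable borel"
      if "jointly_measurable T y" for y \<omega>
    proof -
      have "(\<lambda>s. (ennreal ((y s \<omega>)\<^sup>2) * indicator {0..T} s) * indicator {\<tau> \<omega>..T} s) \<in> borel_measurable borel"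
        using borel_measurable_time_slice[OF T_nonneg that, of \<omega>] by measurable
      also have "(\<lambda>s. (ennreal ((y s \<omega>)\<^sup>2) * indicator {0..T} s) * indicator {\<tau> \<omega>..T} s)
          = (\<lambda>s. ennreal ((y s \<omega>)\<^sup>2) * indicator {\<tau> \<omega>..T} s)"
      proof -
        have "0 \<le> \<tau> \<omega>" using \<tau> by simp
        then show ?thesis by (auto simp: indicator_def)
      qed
      finally show ?thesis .
    qed
    have I_le: "I ?l \<tau> \<omega> \<le> ennreal K * (ennreal T + (I ?Z \<tau> \<omega> + I ?Z' \<tau> \<omega>))" for \<omega>
    proof -
      have \<tau>0: "0 \<le> \<tau> \<omega>" "\<tau> \<omega> \<le> T" using \<tau> by auto
      have "I ?l \<tau> \<omega> \<le> (\<integral>\<^sup>+s. ennreal K * (indicator {\<tau> \<omega>..T} s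
          + (ennreal ((?Z s \<omega>)\<^sup>2) * indicator {\<tau> \<omega>..T} s + ennreal ((?Z' s \<omega>)\<^sup>2) * indicator {\<tau> \<omega>..T} s)) \<partial>lborel)"
        unfolding I_def
      proof (rule nn_integral_mono)
        fix s
        show "ennreal ((?l s \<omega>)\<^sup>2) * indicator {\<tau> \<omega>..T} s \<le> ennreal K * (indicator {\<tau> \<omega>..T} s
          + (ennreal ((?Z s \<omega>)\<^sup>2) * indicator {\<tau> \<omega>..T} s + ennreal ((?Z' s \<omega>)\<^sup>2) * indicator {\<tau> \<omega>..T} s))"
        proof (cases "s \<in> {\<tau> \<omega>..T}")
          case True
          then have "s \<in> {0..T}" using \<tau>0 by auto
          from ennreal_leI[OF square[OF this, of \<omega>]] True K show ?thesis
            by (simp add: ennreal_mult ennreal_plus)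
        qed simp
      qed
      also have "\<dots> = ennreal K * (emeasure lborel {\<tau> \<omega>..T} + (I ?Z \<tau> \<omega> + I ?Z' \<tau> \<omega>))"
        unfolding I_def using slice[OF jmZ(1), of \<omega>] slice[OF jmZ(2), of \<omega>]
        by (simp add: nn_integral_cmult nn_integral_add)
      also have "\<dots> \<le> ennreal K * (ennreal T + (I ?Z \<tau> \<omega> + I ?Z' \<tau> \<omega>))"
        using \<tau>0 by (intro mult_left_mono add_right_mono) (auto intro: ennreal_leI)
      finally show ?thesis .
    qed
    have "AE \<omega> in P. ?E (I ?l \<tau>) \<omega> \<le> ?E (\<lambda>\<omega>. ennreal K * (ennreal T + (I ?Z \<tau> \<omega> + I ?Z' \<tau> \<omega>))) \<omega>"
      using I_le by (intro nn_cond_exp_mono) auto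
    moreover have "AE \<omega> in P. ennreal K * ?E (\<lambda>\<omega>. ennreal T + (I ?Z \<tau> \<omega> + I ?Z' \<tau> \<omega>)) \<omega>
        = ?E (\<lambda>\<omega>. ennreal K * (ennreal T + (I ?Z \<tau> \<omega> + I ?Z' \<tau> \<omega>))) \<omega>"
      by (rule nn_cond_exp_prod) auto
    moreover have "AE \<omega> in P. ?E (\<lambda>\<omega>. ennreal T) \<omega> + ?E (\<lambda>\<omega>. I ?Z \<tau> \<omega> + I ?Z' \<tau> \<omega>) \<omega>
        = ?E (\<lambda>\<omega>. ennreal T + (I ?Z \<tau> \<omega> + I ?Z' \<tau> \<omega>)) \<omega>"
      by (rule nn_cond_exp_sum) auto
    moreover have "AE \<omega> in P. ennreal T = ?E (\<lambda>\<omega>. ennreal T) \<omega>"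
      by (rule nn_cond_exp_F_meas) auto
    moreover have "AE \<omega> in P. ?E (I ?Z \<tau>) \<omega> + ?E (I ?Z' \<tau>) \<omega> = ?E (\<lambda>\<omega>. I ?Z \<tau> \<omega> + I ?Z' \<tau> \<omega>) \<omega>"
      by (rule nn_cond_exp_sum) auto
    moreover have "AE \<omega> in P. ?E (I y \<tau>) \<omega> \<le> B y" for y
    proof -
      have "esssup P (?E (I y \<tau>)) \<le> B y"
        unfolding B_def by (rule order_trans[OF SUP_upper[OF \<tau>] SUP_upper[OF P]])
      then show ?thesis using esssup_AE[where M=P and f="?E (I y \<tau>)"] by (auto elim: eventually_mono intro: order_trans)
    qed
    note this[of ?Z] this[of ?Z']
    ultimately have "AE \<omega> in P. ?E (I ?l \<tau>) \<omega> \<le> c"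
    proof eventually_elim
      case (elim \<omega>)
      have "?E (I ?l \<tau>) \<omega> \<le> ennreal K * (ennreal T + (?E (I ?Z \<tau>) \<omega> + ?E (I ?Z' \<tau>) \<omega>))"
        using elim(1-5) by simp
      also have "\<dots> \<le> c" unfolding c_def by (intro mult_left_mono add_mono elim) auto
      finally show ?case .
    qed
    then show ?thesis by (intro esssup_I) auto
  qed
  then have "B (\<lambda>s \<omega>. norm (l s \<omega>)) \<le> c" unfolding B_def by (intro SUP_least)
  also have "c < \<infinity>" using fin by (auto simp: c_def ennreal_mult_less_top)
  finally show ?thesis using l unfolding G_BMO_generator_def B_def I_def by auto
qed

end

section \<open>Closure properties of uniformly continuous random fields\<close>

text \<open>On a closed ball, which is compact in finite dimension, u is bounded and uniformly
  continuous.\<close>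

lemma regular_compose:
  fixes u :: "'e::euclidean_space \<Rightarrow> 'f::euclidean_space" and F :: "real \<Rightarrow> ('d::finite) path \<Rightarrow> 'f \<Rightarrow> real"
  assumes F: "regular T F" and u: "continuous_on UNIV u" and T: "0 \<le> T"
  shows "regular T (\<lambda>s \<omega> x. F s \<omega> (u x))"
proof (rule regularI)
  fix N :: real
  have cont: "continuous_on (cball 0 N) u" by (rule continuous_on_subset[OF u]) auto
  then have "bounded (u ` cball 0 N)"
    by (intro compact_imp_bounded compact_continuous_image) auto
  then have "\<exists>N'. \<forall>x\<in>cball 0 N. norm (u x) \<le> N'"
    unfolding bounded_iff by simp
  then obtain N' where N': "\<And>x. norm x \<le> N \<Longrightarrow> norm (u x) \<le> N'"
    unfolding Ball_def mem_cball_0 by blast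
  obtain C where "\<And>s \<omega> x. s \<in> {0..T} \<Longrightarrow> norm x \<le> N' \<Longrightarrow> \<bar>F s \<omega> x\<bar> \<le> C"
    by (rule regular_bounded[OF F, of N']) blast
  then show "\<exists>C. \<forall>s\<in>{0..T}. \<forall>\<omega> x. norm x \<le> N \<longrightarrow> \<bar>F s \<omega> (u x)\<bar> \<le> C" using N' by blast
  fix e :: real assume e: "0 < e"
  obtain d where d: "0 < d" "uniformly_close T N' F e d"
    by (rule regular_uniformly_continuous[OF F e])
  note d = d(1) d(2)[rule_format]
  have "uniformly_continuous_on (cball 0 N) u"
    by (rule compact_uniformly_continuous[OF cont]) auto
  then obtain r where r: "0 < r" "\<And>x x'. norm x \<le> N \<Longrightarrow> norm x' \<le> N \<Longrightarrow> dist x' x < r \<Longrightarrow> dist (u x') (u x) < d / 2"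
    unfolding uniformly_continuous_on_def using d(1) by (metis half_gt_zero mem_cball_0)
  show "\<exists>d>0. uniformly_close T N (\<lambda>s \<omega> x. F s \<omega> (u x)) e d"
  proof (intro exI[of _ "min r (d/2)"] conjI ballI allI impI)
    show "0 < min r (d/2)" using r(1) d(1) by simp
    fix s s' and \<omega> \<omega>' :: "'d path" and x x' :: 'e
    assume s: "s \<in> {0..T}" "s' \<in> {0..T}" and x: "norm x \<le> N" "norm x' \<le> N"
      and small: "path_time_dist T s \<omega> s' \<omega>' + dist x x' < min r (d/2)"
    have "0 \<le> sup_dist T (stopped_path s \<omega>) (stopped_path s' \<omega>')" by (rule sup_dist_nonneg[OF T])
    then have "dist x x' < r" "path_time_dist T s \<omega> s' \<omega>' < d / 2"
      using small zero_le_dist[of x x'] by linarith+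
    then show "\<bar>F s \<omega> (u x) - F s' \<omega>' (u x')\<bar> < e"
      using r(2)[OF x(2,1)] by (intro d(2) s N' x) auto
  qed
qed

lemma regular_continuous:
  fixes u :: "'e::euclidean_space \<Rightarrow> real"
  assumes u: "continuous_on UNIV u" and T: "0 \<le> T"
  shows "regular T (\<lambda>s \<omega>. u)"
proof -
  have "regular T (\<lambda>s \<omega> x :: real. x)"
  proof (rule regularI)
    show "\<exists>C. \<forall>s\<in>{0..T}. \<forall>\<omega> x. norm x \<le> N \<longrightarrow> \<bar>x :: real\<bar> \<le> C" for N by (intro exI[of _ N]) simp
    fix N e :: real assume "0 < e"
    have "\<bar>x - x'\<bar> < e" if "path_time_dist T s \<omega> s' \<omega>' + dist x x' < e" for s s' \<omega> \<omega>' and x x' :: real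
      using that sup_dist_nonneg[OF T, of "stopped_path s \<omega>" "stopped_path s' \<omega>'"] unfolding dist_real_def by linarith
    then show "\<exists>d>0. uniformly_close T N (\<lambda>s \<omega> x. x) e d" using \<open>0 < e\<close> by blast
  qed
  from regular_compose[OF this u T] show ?thesis .
qed

text \<open>For x in a ball the pair of values stays in a fixed compact set, on which \<phi> is
  uniformly continuous. This covers products, which would not preserve global uniform
  continuity.\<close>

lemma regular_combine:
  fixes \<phi> :: "real \<times> real \<Rightarrow> real"
  assumes F: "regular T F" and H: "regular T H" and \<phi>: "continuous_on UNIV \<phi>"
  shows "regular T (\<lambda>s \<omega> x. \<phi> (F s \<omega> x, H s \<omega> x))"
proof (rule regularI)
  fix N :: real
  obtain C where C: "0 \<le> C" "\<And>s \<omega> x. s \<in> {0..T} \<Longrightarrow> norm x \<le> N \<Longrightarrow> \<bar>F s \<omega> x\<bar> \<le> C"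
    by (rule regular_bounded[OF F, of N]) blast
  obtain C' where C': "0 \<le> C'" "\<And>s \<omega> x. s \<in> {0..T} \<Longrightarrow> norm x \<le> N \<Longrightarrow> \<bar>H s \<omega> x\<bar> \<le> C'"
    by (rule regular_bounded[OF H, of N]) blast
  define K where "K = cball (0 :: real \<times> real) (C + C')"
  have mem: "(F s \<omega> x, H s \<omega> x) \<in> K" if "s \<in> {0..T}" "norm x \<le> N" for s \<omega> x
    using norm_Pair_le[of "F s \<omega> x" "H s \<omega> x"] C(2)[OF that, of \<omega>] C'(2)[OF that, of \<omega>] by (simp add: K_def)
  have cont: "continuous_on K \<phi>" by (rule continuous_on_subset[OF \<phi>]) auto
  have "bounded (\<phi> ` K)"
    unfolding K_def by (intro compact_imp_bounded compact_continuous_image cont[unfolded K_def]) auto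
  then show "\<exists>C. \<forall>s\<in>{0..T}. \<forall>\<omega> x. norm x \<le> N \<longrightarrow> \<bar>\<phi> (F s \<omega> x, H s \<omega> x)\<bar> \<le> C"
    unfolding bounded_iff using mem by (metis image_eqI real_norm_def)
  fix e :: real assume e: "0 < e"
  have "uniformly_continuous_on K \<phi>"
    by (rule compact_uniformly_continuous[OF cont]) (simp add: K_def)
  then obtain r where r: "0 < r" "\<And>p p'. p \<in> K \<Longrightarrow> p' \<in> K \<Longrightarrow> dist p' p < r \<Longrightarrow> dist (\<phi> p') (\<phi> p) < e"
    unfolding uniformly_continuous_on_def using e by metis
  then have r2: "0 < r/2" by simp
  obtain d where d: "0 < d" "uniformly_close T N F (r/2) d"
    by (rule regular_uniformly_continuous[OF F r2])
  note d = d(1) d(2)[rule_format]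
  obtain d' where d': "0 < d'" "uniformly_close T N H (r/2) d'"
    by (rule regular_uniformly_continuous[OF H r2])
  note d' = d'(1) d'(2)[rule_format]
  have "\<bar>\<phi> (F s \<omega> x, H s \<omega> x) - \<phi> (F s' \<omega>' x', H s' \<omega>' x')\<bar> < e"
    if *: "s \<in> {0..T}" "s' \<in> {0..T}" "norm x \<le> N" "norm x' \<le> N"
      "path_time_dist T s \<omega> s' \<omega>' + dist x x' < min d d'" for s s' \<omega> \<omega>' x x'
  proof -
    have "dist (F s \<omega> x, H s \<omega> x) (F s' \<omega>' x', H s' \<omega>' x') \<le> \<bar>F s \<omega> x - F s' \<omega>' x'\<bar> + \<bar>H s \<omega> x - H s' \<omega>' x'\<bar>"
      using norm_Pair_le[of "F s \<omega> x - F s' \<omega>' x'" "H s \<omega> x - H s' \<omega>' x'"] by (simp add: dist_norm)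
    also have "\<dots> < r"
      using d(2)[OF *(1-4), of \<omega> \<omega>'] d'(2)[OF *(1-4), of \<omega> \<omega>'] *(5) unfolding min_less_iff_conj by linarith
    finally show ?thesis using r(2)[OF mem[OF *(2,4)] mem[OF *(1,3)]] by (simp add: dist_real_def)
  qed
  then show "\<exists>d>0. uniformly_close T N (\<lambda>s \<omega> x. \<phi> (F s \<omega> x, H s \<omega> x)) e d"
    using d(1) d'(1) by (intro exI[of _ "min d d'"]) simp
qed

lemma regular_add: "regular T F \<Longrightarrow> regular T H \<Longrightarrow> regular T (\<lambda>s \<omega> x. F s \<omega> x + H s \<omega> x)"
  using regular_combine[of T F H "\<lambda>p. fst p + snd p"] by (simp add: continuous_intros)

lemma regular_mult: "regular T F \<Longrightarrow> regular T H \<Longrightarrow> regular T (\<lambda>s \<omega> x. F s \<omega> x * H s \<omega> x)"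
  using regular_combine[of T F H "\<lambda>p. fst p * snd p"] by (simp add: continuous_intros)

lemma regular_diff: "regular T F \<Longrightarrow> regular T H \<Longrightarrow> regular T (\<lambda>s \<omega> x. F s \<omega> x - H s \<omega> x)"
  using regular_combine[of T F H "\<lambda>p. fst p - snd p"] by (simp add: continuous_intros)

lemma modulus_of_continuity_small:
  assumes "modulus_of_continuity w" "0 < e"
  shows "\<exists>d>0. \<forall>q. 0 \<le> q \<longrightarrow> q < d \<longrightarrow> w q < e"
proof -
  have "\<forall>\<^sub>F q in at_right 0. w q < e"
    using assms by (intro order_tendstoD(2)) (auto simp: modulus_of_continuity_def)
  then obtain d where d: "0 < d" "\<And>q. 0 < q \<Longrightarrow> q < d \<Longrightarrow> w q < e"
    unfolding eventually_at_right_field by auto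
  \<comment> \<open>The limit from the right says nothing about the point 0 itself.\<close>
  have "w 0 < e" using assms by (simp add: modulus_of_continuity_def)
  then have "w q < e" if "0 \<le> q" "q < d" for q using that d(2)[of q] by (cases "q = 0") auto
  then show ?thesis using d(1) by blast
qed

text \<open>(A0) and (A2) control time and path, (A3) controls (y, z) with a Lipschitz constant
  depending on the ball; (A1) with (A3) gives local boundedness.\<close>

lemma regular_coefficient:
  fixes h :: "'d::finite coefficient"
  assumes h: "assumptions_A M\<^sub>0 L\<^sub>y L\<^sub>z h" and L: "0 \<le> L\<^sub>y" "0 \<le> L\<^sub>z" and T: "0 < T"
  shows "regular T (\<lambda>s \<omega> p. h s \<omega> (fst p) (snd p))"
proof (rule regularI)
  have A0: "h t \<omega> y z = h t (stopped_path t \<omega>) y z" if "t \<in> {0..T}" for t \<omega> y z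
    using h T that unfolding assumptions_A_def A0_def by blast
  have A1: "\<bar>h t \<omega> 0 0\<bar> \<le> M\<^sub>0" if "t \<in> {0..T}" for t \<omega>
    using h T that unfolding assumptions_A_def A1_def by blast
  obtain w where w: "modulus_of_continuity w" and "A2 w h" using h unfolding assumptions_A_def by blast
  then have A2: "\<bar>h t \<omega> y z - h t' \<omega>' y z\<bar> \<le> w (\<bar>t - t'\<bar> + sup_dist T \<omega> \<omega>')"
    if "t \<in> {0..T}" "t' \<in> {0..T}" for t t' \<omega> \<omega>' y z
    using T that unfolding A2_def by blast
  have A3: "\<bar>h t \<omega> y z - h t \<omega> y' z'\<bar> \<le> L\<^sub>y * \<bar>y - y'\<bar> + L\<^sub>z * (1 + norm z + norm z') * norm (z - z')"
    if "t \<in> {0..T}" for t \<omega> y y' z z'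
    using h T that unfolding assumptions_A_def A3_def by blast
  fix N :: real
  have "\<bar>h s \<omega> (fst p) (snd p)\<bar> \<le> M\<^sub>0 + L\<^sub>y * N + L\<^sub>z * (1 + N) * N"
    if s: "s \<in> {0..T}" and p: "norm p \<le> N" for s \<omega> and p :: "real \<times> (real^'d)"
  proof -
    have n: "norm (fst p) \<le> N" "norm (snd p) \<le> N"
      using norm_fst_le[of "fst p" "snd p"] norm_snd_le[of "snd p" "fst p"] p by simp_all
    have "0 \<le> N" using n(2) norm_ge_zero order_trans by blast
    have "L\<^sub>y * \<bar>fst p\<bar> \<le> L\<^sub>y * N" using n(1) L by (intro mult_left_mono) auto
    moreover have "L\<^sub>z * (1 + norm (snd p)) * norm (snd p) \<le> L\<^sub>z * (1 + N) * N"
      using n(2) L \<open>0 \<le> N\<close> by (intro mult_mono mult_nonneg_nonneg) auto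
    ultimately show ?thesis using A3[OF s, of \<omega> "fst p" "snd p" 0 0] A1[OF s, of \<omega>] by simp
  qed
  then show "\<exists>C. \<forall>s\<in>{0..T}. \<forall>\<omega> p. norm p \<le> N \<longrightarrow> \<bar>h s \<omega> (fst p) (snd p)\<bar> \<le> C" by blast
  fix e :: real assume e: "0 < e"
  obtain d1 where d1: "0 < d1" "\<And>q. 0 \<le> q \<Longrightarrow> q < d1 \<Longrightarrow> w q < e/2"
    using modulus_of_continuity_small[OF w, of "e/2"] e by auto
  \<comment> \<open>Lipschitz constant on the ball of radius N. The absolute value is taken because
    N is an arbitrary real.\<close>
  define K where "K = L\<^sub>y + L\<^sub>z * (1 + 2 * \<bar>N\<bar>) + 1"
  have K: "0 < K" using L by (simp add: K_def add_nonneg_pos)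
  have "\<bar>h s \<omega> (fst p) (snd p) - h s' \<omega>' (fst p') (snd p')\<bar> < e"
    if s: "s \<in> {0..T}" "s' \<in> {0..T}" and p: "norm p \<le> N" "norm p' \<le> N"
      and small: "path_time_dist T s \<omega> s' \<omega>' + dist p p' < min d1 (e / (2 * K))"
    for s s' \<omega> \<omega>' and p p' :: "real \<times> (real^'d)"
  proof -
    define q where "q = path_time_dist T s \<omega> s' \<omega>'"
    have q: "0 \<le> q" unfolding q_def using T by (intro add_nonneg_nonneg sup_dist_nonneg) auto
    have qd: "q < d1" "dist p p' < e / (2 * K)" using small q zero_le_dist[of p p']
      unfolding q_def[symmetric] min_less_iff_conj by linarith+
    have n: "norm (snd p) \<le> \<bar>N\<bar>" "norm (snd p') \<le> \<bar>N\<bar>"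
      using norm_snd_le[of "snd p" "fst p"] norm_snd_le[of "snd p'" "fst p'"] p by simp_all
    have dpq: "\<bar>fst p - fst p'\<bar> \<le> dist p p'" "norm (snd p - snd p') \<le> dist p p'"
      using dist_fst_le[of p p'] dist_snd_le[of p p'] by (auto simp: dist_norm)
    \<comment> \<open>By (A0) both values may be computed along the stopped paths, so (A2) gives the
      modulus exactly in q.\<close>
    have "\<bar>h s \<omega> (fst p) (snd p) - h s' \<omega>' (fst p) (snd p)\<bar> \<le> w q"
      unfolding A0[OF s(1), of \<omega>] A0[OF s(2), of \<omega>'] q_def by (rule A2[OF s])
    also have "w q < e/2" by (rule d1(2)[OF q qd(1)])
    finally have 1: "\<bar>h s \<omega> (fst p) (snd p) - h s' \<omega>' (fst p) (snd p)\<bar> < e/2" .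
    have "L\<^sub>y * \<bar>fst p - fst p'\<bar> \<le> L\<^sub>y * dist p p'" using dpq L by (intro mult_left_mono) auto
    moreover have "L\<^sub>z * (1 + norm (snd p) + norm (snd p')) * norm (snd p - snd p') \<le> L\<^sub>z * (1 + 2 * \<bar>N\<bar>) * dist p p'"
      using n dpq L by (intro mult_mono mult_left_mono mult_nonneg_nonneg) auto
    moreover have "K * dist p p' = L\<^sub>y * dist p p' + L\<^sub>z * (1 + 2 * \<bar>N\<bar>) * dist p p' + dist p p'"
      by (simp add: K_def algebra_simps)
    moreover have "K * dist p p' < e/2"
      using qd(2) K by (simp add: pos_less_divide_eq algebra_simps)
    ultimately have "\<bar>h s' \<omega>' (fst p) (snd p) - h s' \<omega>' (fst p') (snd p')\<bar> < e/2"
      using A3[OF s(2), of \<omega>' "fst p" "snd p" "fst p'" "snd p'"] zero_le_dist[of p p'] by linarith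
    with 1 show ?thesis by linarith
  qed
  then show "\<exists>d>0. uniformly_close T N (\<lambda>s \<omega> p. h s \<omega> (fst p) (snd p)) e d"
    using d1(1) e K by (intro exI[of _ "min d1 (e / (2 * K))"]) auto
qed

section \<open>Convexity of the generator\<close>

lemma trace_quadratic:
  "trace (\<theta> ** transpose \<theta> ** A) = (\<Sum>i\<in>UNIV. \<Sum>k\<in>UNIV. (\<Sum>l\<in>UNIV. \<theta> $ i $ l * \<theta> $ k $ l) * A $ k $ i)"
  for \<theta> A :: "real^'d::finite^'d"
  by (simp add: trace_def matrix_matrix_mult_def transpose_def)

context
  fixes \<Theta> :: "(real^'d::finite^'d) set" and G :: "real^'d^'d \<Rightarrow> real"
  assumes G: "nondegenerate_generator \<Theta> G"
begin

lemma generator_eq: "G A = 1/2 * (SUP \<theta>\<in>\<Theta>. trace (\<theta> ** transpose \<theta> ** A))"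
  using G unfolding nondegenerate_generator_def by blast

lemma generator_nonempty: "\<Theta> \<noteq> {}"
  using G unfolding nondegenerate_generator_def by blast

text \<open>The trace is a polynomial in the entries of \<theta>, and \<Theta> is compact.\<close>

lemma bdd_above_generator: "bdd_above ((\<lambda>\<theta>. trace (\<theta> ** transpose \<theta> ** A)) ` \<Theta>)"
proof -
  have "compact \<Theta>"
    using G unfolding nondegenerate_generator_def by (simp add: compact_eq_bounded_closed)
  moreover have "continuous_on \<Theta> (\<lambda>\<theta>. trace (\<theta> ** transpose \<theta> ** A))"
    unfolding trace_quadratic by (intro continuous_intros)
  ultimately show ?thesis
    by (intro bounded_imp_bdd_above compact_imp_bounded compact_continuous_image)
qed

lemma trace_le_generator: "\<theta> \<in> \<Theta> \<Longrightarrow> trace (\<theta> ** transpose \<theta> ** A) \<le> 2 * G A"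
  unfolding generator_eq by (simp add: cSUP_upper[OF _ bdd_above_generator])

lemma generator_le: "(\<And>\<theta>. \<theta> \<in> \<Theta> \<Longrightarrow> trace (\<theta> ** transpose \<theta> ** A) \<le> 2 * c) \<Longrightarrow> G A \<le> c"
  unfolding generator_eq using cSUP_least[OF generator_nonempty, of "\<lambda>\<theta>. trace (\<theta> ** transpose \<theta> ** A)" "2 * c"] by simp

text \<open>G is a supremum of linear functionals.\<close>

lemma generator_sublinear:
  assumes "0 \<le> p" "0 \<le> q"
  shows "G (\<chi> i j. p * A $ i $ j + q * B $ i $ j) \<le> p * G A + q * G B"
proof (rule generator_le)
  fix \<theta> assume \<theta>: "\<theta> \<in> \<Theta>"
  have "trace (\<theta> ** transpose \<theta> ** (\<chi> i j. p * A $ i $ j + q * B $ i $ j))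
      = p * trace (\<theta> ** transpose \<theta> ** A) + q * trace (\<theta> ** transpose \<theta> ** B)"
    unfolding trace_quadratic
    by (simp add: sum_distrib_left distrib_left sum.distrib mult.left_commute)
  also have "\<dots> \<le> p * (2 * G A) + q * (2 * G B)"
    by (intro add_mono mult_left_mono trace_le_generator \<theta> assms)
  finally show "trace (\<theta> ** transpose \<theta> ** (\<chi> i j. p * A $ i $ j + q * B $ i $ j)) \<le> 2 * (p * G A + q * G B)"
    by simp
qed

text \<open>The trace against the matrix of ones is the sum of the squared column sums of \<theta>.
  It follows that the denominator in (L) is at least 1, so (L) can be multiplied out.\<close>

lemma generator_minus_ones_nonpos: "G (- (\<chi> i j. 1)) \<le> 0"
proof (rule generator_le)
  fix \<theta> assume "\<theta> \<in> \<Theta>"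
  have "(\<Sum>l\<in>UNIV. (\<Sum>i\<in>UNIV. \<theta> $ i $ l) * (\<Sum>k\<in>UNIV. \<theta> $ k $ l))
      = (\<Sum>l\<in>UNIV. \<Sum>i\<in>UNIV. \<Sum>k\<in>UNIV. \<theta> $ i $ l * \<theta> $ k $ l)"
    by (simp add: sum_product)
  also have "\<dots> = (\<Sum>i\<in>UNIV. \<Sum>l\<in>UNIV. \<Sum>k\<in>UNIV. \<theta> $ i $ l * \<theta> $ k $ l)"
    by (rule sum.swap)
  also have "\<dots> = (\<Sum>i\<in>UNIV. \<Sum>k\<in>UNIV. \<Sum>l\<in>UNIV. \<theta> $ i $ l * \<theta> $ k $ l)"
    by (intro sum.cong refl sum.swap)
  finally have "trace (\<theta> ** transpose \<theta> ** (- (\<chi> i j. 1)))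
      = - (\<Sum>l\<in>UNIV. (\<Sum>i\<in>UNIV. \<theta> $ i $ l) * (\<Sum>k\<in>UNIV. \<theta> $ k $ l))"
    unfolding trace_quadratic by (simp add: sum_negf)
  also have "\<dots> \<le> 0" by (simp add: sum_nonneg)
  finally show "trace (\<theta> ** transpose \<theta> ** (- (\<chi> i j. 1))) \<le> 2 * 0" by simp
qed

end

section \<open>Linearisation of a coefficient\<close>

text \<open>\<open>cut \<epsilon> x\<close> replaces \<open>1 / x\<close>; it is continuous, agrees with \<open>1 / x\<close> for \<open>\<bar>x\<bar> \<ge> \<epsilon>\<close>, and
  \<open>x * cut \<epsilon> x \<in> [0,1]\<close> is the weight with which the difference quotient enters.\<close>

definition cut :: "real \<Rightarrow> real \<Rightarrow> real" where
  "cut \<epsilon> x = x / (max \<bar>x\<bar> \<epsilon>)\<^sup>2"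

type_synonym 'd point = "real \<times> real \<times> (real^'d) \<times> (real^'d)"

text \<open>With the weight p = (y - y') \<open>cut \<epsilon> (y - y')\<close>, the first term is p
  times the difference quotient and the second is (1 - p) times -\<kappa>. At y = y' the value is
  -\<kappa>; later \<kappa> is \<open>L\<^sub>y\<close>.\<close>

definition slope_y :: "real \<Rightarrow> real \<Rightarrow> ('d::finite) coefficient \<Rightarrow> real \<Rightarrow> real \<Rightarrow> real^'d \<Rightarrow> real \<Rightarrow> 'd path \<Rightarrow> real" where
  "slope_y \<epsilon> \<kappa> h y y' z s \<omega> = (h s \<omega> y z - h s \<omega> y' z) * cut \<epsilon> (y - y') - \<kappa> * (1 - (y - y') * cut \<epsilon> (y - y'))"

text \<open>Only the inner product with z - z' matters, so one vector along z - z' takes the place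
  of a telescoping sum over coordinates.\<close>

definition slope_z :: "real \<Rightarrow> ('d::finite) coefficient \<Rightarrow> real \<Rightarrow> real^'d \<Rightarrow> real^'d \<Rightarrow> real \<Rightarrow> 'd path \<Rightarrow> real^'d" where
  "slope_z \<epsilon> h y' z z' s \<omega> = ((h s \<omega> y' z - h s \<omega> y' z') / (max (norm (z - z')) \<epsilon>)\<^sup>2) *\<^sub>R (z - z')"

definition remainder :: "real \<Rightarrow> real \<Rightarrow> ('d::finite) coefficient \<Rightarrow> real \<Rightarrow> real \<Rightarrow> real^'d \<Rightarrow> real^'d \<Rightarrow> real \<Rightarrow> 'd path \<Rightarrow> real" where
  "remainder \<epsilon> \<kappa> h y y' z z' s \<omega> =
     (1 - (y - y') * cut \<epsilon> (y - y')) * (h s \<omega> y z - h s \<omega> y' z + \<kappa> * (y - y'))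
     + (1 - (norm (z - z'))\<^sup>2 / (max (norm (z - z')) \<epsilon>)\<^sup>2) * (h s \<omega> y' z - h s \<omega> y' z')"

text \<open>The increment is split at (y', z) and each part is divided according to its weight; the
  complementary parts, and the default term of \<open>slope_y\<close>, form the remainder.\<close>

lemma coefficient_linearisation:
  "h s \<omega> y z - h s \<omega> y' z' = slope_y \<epsilon> \<kappa> h y y' z s \<omega> * (y - y') + slope_z \<epsilon> h y' z z' s \<omega> \<bullet> (z - z')
     + remainder \<epsilon> \<kappa> h y y' z z' s \<omega>"
proof -
  have "slope_z \<epsilon> h y' z z' s \<omega> \<bullet> (z - z') = (norm (z - z'))\<^sup>2 / (max (norm (z - z')) \<epsilon>)\<^sup>2 * (h s \<omega> y' z - h s \<omega> y' z')"
    by (simp add: slope_z_def power2_norm_eq_inner)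
  then show ?thesis
    unfolding slope_y_def remainder_def by (simp add: algebra_simps)
qed

text \<open>The weight shared by both cut-offs. The last claim, the source of the order \<epsilon>
  of the remainder, holds because the complementary weight vanishes for x >= \<epsilon> and is at
  most 1 below.\<close>

lemma square_div_max_square:
  fixes x \<epsilon> :: real
  assumes "0 < \<epsilon>" "0 \<le> x"
  shows "0 \<le> x\<^sup>2 / (max x \<epsilon>)\<^sup>2" "x\<^sup>2 / (max x \<epsilon>)\<^sup>2 \<le> 1" "\<epsilon> \<le> x \<Longrightarrow> x\<^sup>2 / (max x \<epsilon>)\<^sup>2 = 1"
    "(1 - x\<^sup>2 / (max x \<epsilon>)\<^sup>2) * x \<le> \<epsilon>"
proof -
  show 0: "0 \<le> x\<^sup>2 / (max x \<epsilon>)\<^sup>2" by simp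
  have "x\<^sup>2 \<le> (max x \<epsilon>)\<^sup>2" using assms by (intro power_mono) auto
  then show "x\<^sup>2 / (max x \<epsilon>)\<^sup>2 \<le> 1" using assms by (simp add: divide_le_eq_1)
  show 1: "x\<^sup>2 / (max x \<epsilon>)\<^sup>2 = 1" if "\<epsilon> \<le> x" using assms that by (simp add: max_absorb1)
  show "(1 - x\<^sup>2 / (max x \<epsilon>)\<^sup>2) * x \<le> \<epsilon>"
  proof (cases "\<epsilon> \<le> x")
    case True
    then show ?thesis using 1 assms by simp
  next
    case False
    have "(1 - x\<^sup>2 / (max x \<epsilon>)\<^sup>2) * x \<le> 1 * x" using 0 assms by (intro mult_right_mono) auto
    then show ?thesis using False by simp
  qed
qed

lemma mult_cut: "x * cut \<epsilon> x = \<bar>x\<bar>\<^sup>2 / (max \<bar>x\<bar> \<epsilon>)\<^sup>2"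
  by (simp add: cut_def power2_eq_square)

context
  fixes h :: "'d::finite coefficient" and M\<^sub>0 L\<^sub>y L\<^sub>z T \<epsilon> :: real
  assumes h: "assumptions_A M\<^sub>0 L\<^sub>y L\<^sub>z h" and L: "0 < L\<^sub>y" "0 < L\<^sub>z" and T: "0 < T" and \<epsilon>: "0 < \<epsilon>"
begin

lemma coefficient_diff_le:
  assumes "s \<in> {0..T}"
  shows "\<bar>h s \<omega> y z - h s \<omega> y' z\<bar> \<le> L\<^sub>y * \<bar>y - y'\<bar>"
    and "\<bar>h s \<omega> y' z - h s \<omega> y' z'\<bar> \<le> L\<^sub>z * (1 + norm z + norm z') * norm (z - z')"
proof -
  have A3: "\<bar>h s \<omega> y z - h s \<omega> y' z'\<bar> \<le> L\<^sub>y * \<bar>y - y'\<bar> + L\<^sub>z * (1 + norm z + norm z') * norm (z - z')" for y y' z z'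
    using h T assms unfolding assumptions_A_def A3_def by blast
  show "\<bar>h s \<omega> y z - h s \<omega> y' z\<bar> \<le> L\<^sub>y * \<bar>y - y'\<bar>" using A3[of y z y' z] by simp
  show "\<bar>h s \<omega> y' z - h s \<omega> y' z'\<bar> \<le> L\<^sub>z * (1 + norm z + norm z') * norm (z - z')" using A3[of y' z y' z'] by simp
qed

text \<open>A convex combination of a difference quotient and -\<open>L\<^sub>y\<close>, both
  bounded by \<open>L\<^sub>y\<close>.\<close>

lemma abs_slope_y_le:
  assumes s: "s \<in> {0..T}"
  shows "\<bar>slope_y \<epsilon> L\<^sub>y h y y' z s \<omega>\<bar> \<le> L\<^sub>y"
proof -
  define p where "p = (y - y') * cut \<epsilon> (y - y')"
  have p: "0 \<le> p" "p \<le> 1" unfolding p_def mult_cut using square_div_max_square[OF \<epsilon>, of "\<bar>y - y'\<bar>"] by auto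
  have "\<bar>(h s \<omega> y z - h s \<omega> y' z) * cut \<epsilon> (y - y')\<bar> \<le> L\<^sub>y * \<bar>y - y'\<bar> * \<bar>cut \<epsilon> (y - y')\<bar>"
    unfolding abs_mult by (rule mult_right_mono[OF coefficient_diff_le(1)[OF s]]) simp
  also have "\<dots> = L\<^sub>y * p" using p(1) by (simp add: p_def abs_mult[symmetric])
  finally have "\<bar>slope_y \<epsilon> L\<^sub>y h y y' z s \<omega>\<bar> \<le> L\<^sub>y * p + \<bar>L\<^sub>y * (1 - p)\<bar>"
    unfolding slope_y_def p_def[symmetric] by linarith
  also have "\<dots> = L\<^sub>y" using p L by (simp add: abs_mult algebra_simps)
  finally show ?thesis .
qed

lemma norm_slope_z_le:
  assumes s: "s \<in> {0..T}"
  shows "norm (slope_z \<epsilon> h y' z z' s \<omega>) \<le> L\<^sub>z * (1 + norm z + norm z')"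
proof -
  let ?K = "L\<^sub>z * (1 + norm z + norm z')" and ?x = "norm (z - z')"
  have K: "0 \<le> ?K" using L by (intro mult_nonneg_nonneg add_nonneg_nonneg) auto
  have "norm (slope_z \<epsilon> h y' z z' s \<omega>) = \<bar>h s \<omega> y' z - h s \<omega> y' z'\<bar> * (?x / (max ?x \<epsilon>)\<^sup>2)"
    by (simp add: slope_z_def)
  also have "\<dots> \<le> (?K * ?x) * (?x / (max ?x \<epsilon>)\<^sup>2)"
    by (rule mult_right_mono[OF coefficient_diff_le(2)[OF s]]) simp
  also have "\<dots> = ?K * (?x\<^sup>2 / (max ?x \<epsilon>)\<^sup>2)" by (simp add: power2_eq_square)
  also have "\<dots> \<le> ?K * 1" by (rule mult_left_mono[OF square_div_max_square(2)[OF \<epsilon>] K]) simp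
  finally show ?thesis by simp
qed

text \<open>The two \<open>L\<^sub>y\<close> stem from the increment of h and from the default term;
  the complementary weights turn the increments of y and z into \<epsilon>.\<close>

lemma abs_remainder_le:
  assumes s: "s \<in> {0..T}"
  shows "\<bar>remainder \<epsilon> L\<^sub>y h y y' z z' s \<omega>\<bar> \<le> 2 * L\<^sub>y * \<epsilon> + L\<^sub>z * (1 + norm z + norm z') * \<epsilon>"
proof -
  let ?K = "L\<^sub>z * (1 + norm z + norm z')" and ?x = "norm (z - z')" and ?y = "\<bar>y - y'\<bar>"
  have K: "0 \<le> ?K" using L by (intro mult_nonneg_nonneg add_nonneg_nonneg) auto
  define p q where "p = 1 - (y - y') * cut \<epsilon> (y - y')" and "q = 1 - ?x\<^sup>2 / (max ?x \<epsilon>)\<^sup>2"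
  have p: "0 \<le> p" "p * ?y \<le> \<epsilon>"
    unfolding p_def mult_cut using square_div_max_square(2,4)[OF \<epsilon>, of ?y] by auto
  have q: "0 \<le> q" "q * ?x \<le> \<epsilon>"
    unfolding q_def using square_div_max_square(2,4)[OF \<epsilon>, of ?x] by auto
  have "\<bar>h s \<omega> y z - h s \<omega> y' z + L\<^sub>y * (y - y')\<bar> \<le> 2 * L\<^sub>y * ?y"
    using coefficient_diff_le(1)[OF s, of \<omega> y z y'] L by (intro order_trans[OF abs_triangle_ineq]) (simp add: abs_mult)
  then have "\<bar>p * (h s \<omega> y z - h s \<omega> y' z + L\<^sub>y * (y - y'))\<bar> \<le> p * (2 * L\<^sub>y * ?y)"
    using p(1) by (simp add: abs_mult mult_left_mono)
  also have "\<dots> = 2 * L\<^sub>y * (p * ?y)" by simp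
  also have "\<dots> \<le> 2 * L\<^sub>y * \<epsilon>" using L by (intro mult_left_mono p(2)) simp
  finally have 1: "\<bar>p * (h s \<omega> y z - h s \<omega> y' z + L\<^sub>y * (y - y'))\<bar> \<le> 2 * L\<^sub>y * \<epsilon>" .
  have "\<bar>q * (h s \<omega> y' z - h s \<omega> y' z')\<bar> \<le> q * (?K * ?x)"
    unfolding abs_mult using q(1) coefficient_diff_le(2)[OF s, of \<omega> y' z z'] by (simp add: mult_left_mono)
  also have "\<dots> = ?K * (q * ?x)" by simp
  also have "\<dots> \<le> ?K * \<epsilon>" by (intro mult_left_mono q(2) K)
  finally show ?thesis
    using 1 unfolding remainder_def p_def[symmetric] q_def[symmetric] by linarith
qed

text \<open>Everything is built by sums and products from h at continuous functions of the point and
  from deterministic quotients whose denominators are at least the square of \<epsilon>.\<close>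

lemma regular_linearisation:
  fixes y y' :: "'d point \<Rightarrow> real" and z z' :: "'d point \<Rightarrow> real^'d"
  defines "y \<equiv> fst" and "y' \<equiv> (\<lambda>x. fst (snd x))" and "z \<equiv> (\<lambda>x. fst (snd (snd x)))" and "z' \<equiv> (\<lambda>x. snd (snd (snd x)))"
  shows "regular T (\<lambda>s \<omega> x. slope_y \<epsilon> \<kappa> h (y x) (y' x) (z x) s \<omega>)"
    and "regular T (\<lambda>s \<omega> x. slope_z \<epsilon> h (y' x) (z x) (z' x) s \<omega> \<bullet> e)"
    and "regular T (\<lambda>s \<omega> x. remainder \<epsilon> \<kappa> h (y x) (y' x) (z x) (z' x) s \<omega>)"
proof -
  note coeff = regular_compose[OF regular_coefficient[OF h less_imp_le[OF L(1)] less_imp_le[OF L(2)] T] _ less_imp_le[OF T]]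
  note cont = regular_continuous[OF _ less_imp_le[OF T]]
  let ?y = "\<lambda>x :: 'd point. fst x"
  let ?y' = "\<lambda>x :: 'd point. fst (snd x)"
  let ?z = "\<lambda>x :: 'd point. fst (snd (snd x))"
  let ?z' = "\<lambda>x :: 'd point. snd (snd (snd x))"
  have 1: "regular T (\<lambda>s \<omega> x. h s \<omega> (?y x) (?z x))"
    using coeff[of "\<lambda>x. (?y x, ?z x)"] by (simp add: continuous_intros)
  have 2: "regular T (\<lambda>s \<omega> x. h s \<omega> (?y' x) (?z x))"
    using coeff[of "\<lambda>x. (?y' x, ?z x)"] by (simp add: continuous_intros)
  have 3: "regular T (\<lambda>s \<omega> x. h s \<omega> (?y' x) (?z' x))"
    using coeff[of "\<lambda>x. (?y' x, ?z' x)"] by (simp add: continuous_intros)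
  have c: "continuous_on UNIV (\<lambda>x. cut \<epsilon> (?y x - ?y' x))"
    unfolding cut_def using \<epsilon> by (intro continuous_intros) (auto simp: max_def)
  have n: "continuous_on UNIV (\<lambda>x. u x / (max (norm (?z x - ?z' x)) \<epsilon>)\<^sup>2)"
    if "continuous_on UNIV u" for u :: "'d point \<Rightarrow> real"
    using \<epsilon> that by (intro continuous_intros) (auto simp: max_def)
  show "regular T (\<lambda>s \<omega> x. slope_y \<epsilon> \<kappa> h (y x) (y' x) (z x) s \<omega>)"
    unfolding y_def y'_def z_def slope_y_def by (intro regular_diff regular_mult 1 2 cont continuous_intros c)
  have "regular T (\<lambda>s \<omega> x. (h s \<omega> (?y' x) (?z x) - h s \<omega> (?y' x) (?z' x)) * (((?z x - ?z' x) \<bullet> e) / (max (norm (?z x - ?z' x)) \<epsilon>)\<^sup>2))"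
    by (intro regular_diff regular_mult 2 3 cont n continuous_intros)
  then show "regular T (\<lambda>s \<omega> x. slope_z \<epsilon> h (y' x) (z x) (z' x) s \<omega> \<bullet> e)"
    unfolding y'_def z_def z'_def slope_z_def by simp
  show "regular T (\<lambda>s \<omega> x. remainder \<epsilon> \<kappa> h (y x) (y' x) (z x) (z' x) s \<omega>)"
    unfolding y_def y'_def z_def z'_def remainder_def
    by (intro regular_add regular_diff regular_mult 1 2 3 cont n continuous_intros c)
qed

end

section \<open>The linearised coefficients along processes\<close>

context compact_family
begin

lemma H_G_vec_real: "(\<lambda>s \<omega>. X s \<omega> :: real) \<in> H_G_vec \<P> 2 T \<longleftrightarrow> X \<in> H_G \<P> 2 T"
  by (simp add: H_G_vec_def)

lemma H_G_vec_Pair: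
  assumes "X \<in> H_G_vec \<P> 2 T" "Y \<in> H_G_vec \<P> 2 T"
  shows "(\<lambda>s \<omega>. (X s \<omega>, Y s \<omega>)) \<in> H_G_vec \<P> 2 T"
  using assms by (auto simp: H_G_vec_def Basis_prod_def)

lemma H_G_vec_const: "(\<lambda>s \<omega>. c) \<in> H_G_vec \<P> 2 T"
  by (simp add: H_G_vec_def H_G_const)

text \<open>The four processes are substituted jointly as one vector process; the bounds on slopes
  and remainder supply the linear growth.\<close>

lemma linearisation_H_G:
  fixes h :: "'d coefficient"
  assumes h: "assumptions_A M\<^sub>0 L\<^sub>y L\<^sub>z h" and L: "0 < L\<^sub>y" "0 < L\<^sub>z" and \<epsilon>: "0 < \<epsilon>"
    and X: "Y \<in> H_G \<P> 2 T" "Y' \<in> H_G \<P> 2 T" "Z \<in> H_G_vec \<P> 2 T" "Z' \<in> H_G_vec \<P> 2 T"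
  shows "(\<lambda>s \<omega>. slope_y \<epsilon> L\<^sub>y h (Y s \<omega>) (Y' s \<omega>) (Z s \<omega>) s \<omega>) \<in> H_G \<P> 2 T"
    and "(\<lambda>s \<omega>. slope_z \<epsilon> h (Y' s \<omega>) (Z s \<omega>) (Z' s \<omega>) s \<omega>) \<in> H_G_vec \<P> 2 T"
    and "(\<lambda>s \<omega>. remainder \<epsilon> L\<^sub>y h (Y s \<omega>) (Y' s \<omega>) (Z s \<omega>) (Z' s \<omega>) s \<omega>) \<in> H_G \<P> 2 T"
proof -
  note reg = regular_linearisation[OF h L T_pos \<epsilon>]
  have P: "(\<lambda>s \<omega>. (Y s \<omega>, Y' s \<omega>, Z s \<omega>, Z' s \<omega>)) \<in> H_G_vec \<P> 2 T"
    using X by (intro H_G_vec_Pair) (simp_all add: H_G_vec_real)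
  have n: "1 + norm (fst (snd (snd x))) + norm (snd (snd (snd x))) \<le> 2 * (1 + norm x)"
    for x :: "'d point"
  proof -
    have "norm (fst (snd (snd x))) \<le> norm (snd (snd x))" "norm (snd (snd (snd x))) \<le> norm (snd (snd x))"
      using norm_fst_le[of "fst (snd (snd x))" "snd (snd (snd x))"] norm_snd_le[of "snd (snd (snd x))" "fst (snd (snd x))"]
      by simp_all
    moreover have "norm (snd (snd x)) \<le> norm (snd x)" using norm_snd_le[of "snd (snd x)" "fst (snd x)"] by simp
    moreover have "norm (snd x) \<le> norm x" using norm_snd_le[of "snd x" "fst x"] by simp
    ultimately show ?thesis unfolding distrib_left mult_1_right by linarith
  qed
  have g: "L\<^sub>z * (1 + norm (fst (snd (snd x))) + norm (snd (snd (snd x)))) \<le> 2 * L\<^sub>z * (1 + norm x)"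
    for x :: "'d point"
    using mult_left_mono[OF n[of x], of L\<^sub>z] L by simp
  have one: "c \<le> c * (1 + norm x)" if "0 \<le> c" for c :: real and x :: "'d point"
    using that by (simp add: distrib_left)
  have "\<bar>slope_y \<epsilon> L\<^sub>y h (fst x) (fst (snd x)) (fst (snd (snd x))) s \<omega>\<bar> \<le> L\<^sub>y * (1 + norm x)"
    if "s \<in> {0..T}" for s \<omega> and x :: "'d point"
    using abs_slope_y_le[OF h L T_pos \<epsilon> that] one[of L\<^sub>y x] L(1) by (meson less_imp_le order_trans)
  from regular_H_G[OF reg(1) this P]
  show "(\<lambda>s \<omega>. slope_y \<epsilon> L\<^sub>y h (Y s \<omega>) (Y' s \<omega>) (Z s \<omega>) s \<omega>) \<in> H_G \<P> 2 T" by simp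
  show "(\<lambda>s \<omega>. slope_z \<epsilon> h (Y' s \<omega>) (Z s \<omega>) (Z' s \<omega>) s \<omega>) \<in> H_G_vec \<P> 2 T"
    unfolding H_G_vec_def
  proof (intro CollectI ballI)
    fix e :: "real^'d" assume e: "e \<in> Basis"
    have "\<bar>slope_z \<epsilon> h (fst (snd x)) (fst (snd (snd x))) (snd (snd (snd x))) s \<omega> \<bullet> e\<bar> \<le> 2 * L\<^sub>z * (1 + norm x)"
      if "s \<in> {0..T}" for s \<omega> and x :: "'d point"
      by (rule order_trans[OF Basis_le_norm[OF e] order_trans[OF norm_slope_z_le[OF h L T_pos \<epsilon> that] g]])
    from regular_H_G[OF reg(2) this P]
    show "(\<lambda>s \<omega>. slope_z \<epsilon> h (Y' s \<omega>) (Z s \<omega>) (Z' s \<omega>) s \<omega> \<bullet> e) \<in> H_G \<P> 2 T" by simp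
  qed
  have "\<bar>remainder \<epsilon> L\<^sub>y h (fst x) (fst (snd x)) (fst (snd (snd x))) (snd (snd (snd x))) s \<omega>\<bar>
      \<le> (2 * L\<^sub>y * \<epsilon> + 2 * L\<^sub>z * \<epsilon>) * (1 + norm x)" if "s \<in> {0..T}" for s \<omega> x
  proof -
    have "L\<^sub>z * (1 + norm (fst (snd (snd x))) + norm (snd (snd (snd x)))) * \<epsilon> \<le> 2 * L\<^sub>z * (1 + norm x) * \<epsilon>"
      using g \<epsilon> by (intro mult_right_mono) auto
    moreover have "2 * L\<^sub>y * \<epsilon> \<le> 2 * L\<^sub>y * \<epsilon> * (1 + norm x)" using L \<epsilon> by (intro one) auto
    moreover have "2 * L\<^sub>y * \<epsilon> * (1 + norm x) + 2 * L\<^sub>z * (1 + norm x) * \<epsilon> = (2 * L\<^sub>y * \<epsilon> + 2 * L\<^sub>z * \<epsilon>) * (1 + norm x)"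
      by (simp add: algebra_simps)
    ultimately show ?thesis
      by (intro order_trans[OF abs_remainder_le[OF h L T_pos \<epsilon> that]]) (metis add_mono)
  qed
  from regular_H_G[OF reg(3) this P]
  show "(\<lambda>s \<omega>. remainder \<epsilon> L\<^sub>y h (Y s \<omega>) (Y' s \<omega>) (Z s \<omega>) (Z' s \<omega>) s \<omega>) \<in> H_G \<P> 2 T" by simp
qed

end

section \<open>Assembly of the linearisation for f and g\<close>

lemma assumptions_A_cong:
  assumes h: "assumptions_A M\<^sub>0 L\<^sub>y L\<^sub>z h" and eq: "\<And>t. 0 \<le> t \<Longrightarrow> k t = h t"
  shows "assumptions_A M\<^sub>0 L\<^sub>y L\<^sub>z k"
proof -
  have A2: "A2 w k" if "A2 w h" for w using that eq unfolding A2_def by auto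
  have "A0 k"
    unfolding A0_def
  proof (intro allI impI ballI)
    fix T t :: real and \<omega> y z assume t: "0 < T" "t \<in> {0..T}"
    then have "k t = h t" using eq by simp
    then show "k t \<omega> y z = k t (stopped_path t \<omega>) y z"
      using h t unfolding assumptions_A_def A0_def by metis
  qed
  moreover have "A1 M\<^sub>0 k" using h eq unfolding assumptions_A_def A1_def by auto
  moreover have "A3 L\<^sub>y L\<^sub>z k" using h eq unfolding assumptions_A_def A3_def by auto
  ultimately show ?thesis using A2 h unfolding assumptions_A_def by blast
qed

theorem lemma4p4:
  fixes \<Theta> :: "(real^'d::finite^'d) set" and G :: "real^'d^'d \<Rightarrow> real"
    and \<P> :: "'d path measure set"
    and f :: "'d coefficient" and g :: "'d \<Rightarrow> 'd \<Rightarrow> 'd coefficient"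
    and M\<^sub>0 L\<^sub>y L\<^sub>z \<mu> T \<epsilon> :: real
  assumes "nondegenerate_generator \<Theta> G"
    and "represents_G_expectation G \<P>"
    and "\<And>i j t \<omega> y z. 0 \<le> t \<Longrightarrow> g i j t \<omega> y z = g j i t \<omega> y z"
    and "M\<^sub>0 > 0" and "L\<^sub>y > 0" and "L\<^sub>z > 0"
    and "assumptions_A M\<^sub>0 L\<^sub>y L\<^sub>z f"
    and "\<And>i j. assumptions_A M\<^sub>0 L\<^sub>y L\<^sub>z (g i j)"
    and "\<mu> > 0" and "assumption_M G \<mu> f g"
    and "L\<^sub>y \<ge> \<mu> / (1 - 2 * G (- (\<chi> i j. 1)))"
    and "T > 0" and "\<epsilon> > 0"
  shows "\<exists>(a :: real \<Rightarrow> real \<Rightarrow> real^'d \<Rightarrow> real \<Rightarrow> 'd path \<Rightarrow> real)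
      (c :: 'd \<Rightarrow> 'd \<Rightarrow> real \<Rightarrow> real \<Rightarrow> real^'d \<Rightarrow> real \<Rightarrow> 'd path \<Rightarrow> real)
      (m :: real \<Rightarrow> real \<Rightarrow> real^'d \<Rightarrow> real^'d \<Rightarrow> real \<Rightarrow> 'd path \<Rightarrow> real)
      (n :: 'd \<Rightarrow> 'd \<Rightarrow> real \<Rightarrow> real \<Rightarrow> real^'d \<Rightarrow> real^'d \<Rightarrow> real \<Rightarrow> 'd path \<Rightarrow> real)
      (b :: real \<Rightarrow> real^'d \<Rightarrow> real^'d \<Rightarrow> real \<Rightarrow> 'd path \<Rightarrow> real^'d)
      (d :: 'd \<Rightarrow> 'd \<Rightarrow> real \<Rightarrow> real^'d \<Rightarrow> real^'d \<Rightarrow> real \<Rightarrow> 'd path \<Rightarrow> real^'d).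
    (\<forall>y y' z z'. a y y' z \<in> H_G \<P> 2 T \<and> m y y' z z' \<in> H_G \<P> 2 T \<and> b y' z z' \<in> H_G_vec \<P> 2 T \<and>
       (\<forall>i j. c i j y y' z \<in> H_G \<P> 2 T \<and> n i j y y' z z' \<in> H_G \<P> 2 T \<and>
          d i j y' z z' \<in> H_G_vec \<P> 2 T)) \<and>
    (\<forall>i j y y' z. c i j y y' z = c j i y y' z) \<and>
    (\<forall>s\<in>{0..T}. \<forall>\<omega> y y' z z'.
       f s \<omega> y z - f s \<omega> y' z' = a y y' z s \<omega> * (y - y') + b y' z z' s \<omega> \<bullet> (z - z') + m y y' z z' s \<omega> \<and>
       (\<forall>i j. g i j s \<omega> y z - g i j s \<omega> y' z'
          = c i j y y' z s \<omega> * (y - y') + d i j y' z z' s \<omega> \<bullet> (z - z') + n i j y y' z z' s \<omega>)) \<and>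
    (\<forall>s\<in>{0..T}. \<forall>\<omega> y y' z z'.
       \<bar>a y y' z s \<omega>\<bar> \<le> L\<^sub>y \<and>
       norm (b y' z z' s \<omega>) \<le> 2 * real CARD('d) * L\<^sub>z * (1 + norm z + norm z') \<and>
       \<bar>m y y' z z' s \<omega>\<bar> \<le> 2 * L\<^sub>y * \<epsilon> + 4 * real CARD('d) * L\<^sub>z * (1 + norm z + norm z') * \<epsilon> \<and>
       (\<forall>i j. \<bar>c i j y y' z s \<omega>\<bar> \<le> L\<^sub>y \<and>
          norm (d i j y' z z' s \<omega>) \<le> 2 * real CARD('d) * L\<^sub>z * (1 + norm z + norm z') \<and>
          \<bar>n i j y y' z z' s \<omega>\<bar>
            \<le> 2 * L\<^sub>y * \<epsilon> + 4 * real CARD('d) * L\<^sub>z * (1 + norm z + norm z') * \<epsilon>) \<and>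
       a y y' z s \<omega> + 2 * G (\<chi> i j. c i j y y' z s \<omega>) \<le> - \<mu>) \<and>
    (\<forall>Y Y' Z Z'. Y \<in> S_G \<P> 2 T \<and> Y' \<in> S_G \<P> 2 T \<and>
        G_BMO_generator \<P> T Z \<and> G_BMO_generator \<P> T Z' \<longrightarrow>
       (\<lambda>s \<omega>. a (Y s \<omega>) (Y' s \<omega>) (Z s \<omega>) s \<omega>) \<in> H_G \<P> 2 T \<and>
       (\<lambda>s \<omega>. m (Y s \<omega>) (Y' s \<omega>) (Z s \<omega>) (Z' s \<omega>) s \<omega>) \<in> H_G \<P> 2 T \<and>
       (\<lambda>s \<omega>. b (Y' s \<omega>) (Z s \<omega>) (Z' s \<omega>) s \<omega>) \<in> H_G_vec \<P> 2 T \<and>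
       G_BMO_generator \<P> T (\<lambda>s \<omega>. b (Y' s \<omega>) (Z s \<omega>) (Z' s \<omega>) s \<omega>) \<and>
       G_BMO_generator \<P> T (\<lambda>s \<omega>. m (Y s \<omega>) (Y' s \<omega>) (Z s \<omega>) (Z' s \<omega>) s \<omega>) \<and>
       (\<forall>i j.
          (\<lambda>s \<omega>. c i j (Y s \<omega>) (Y' s \<omega>) (Z s \<omega>) s \<omega>) \<in> H_G \<P> 2 T \<and>
          (\<lambda>s \<omega>. n i j (Y s \<omega>) (Y' s \<omega>) (Z s \<omega>) (Z' s \<omega>) s \<omega>) \<in> H_G \<P> 2 T \<and>
          (\<lambda>s \<omega>. d i j (Y' s \<omega>) (Z s \<omega>) (Z' s \<omega>) s \<omega>) \<in> H_G_vec \<P> 2 T \<and>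
          G_BMO_generator \<P> T (\<lambda>s \<omega>. d i j (Y' s \<omega>) (Z s \<omega>) (Z' s \<omega>) s \<omega>) \<and>
          G_BMO_generator \<P> T (\<lambda>s \<omega>. n i j (Y s \<omega>) (Y' s \<omega>) (Z s \<omega>) (Z' s \<omega>) s \<omega>)))"
proof -
  note f = assms(7)
  note L = assms(5,6)
  note T = assms(12)
  note \<epsilon> = assms(13)
  interpret compact_family \<P> T
    using assms(2) T by unfold_locales (auto simp: represents_G_expectation_def)
  \<comment> \<open>Symmetry of g is given at nonnegative times only, but the processes c are to be
    symmetric as functions of all real times; freezing g at time 0 for negative times achieves
    this.\<close>
  define g0 where "g0 i j = (\<lambda>s. g i j (max 0 s))" for i j
  have g0_eq: "g0 i j s = g i j s" if "s \<in> {0..T}" for i j s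
    using that by (simp add: g0_def)
  have g0_sym: "g0 i j = g0 j i" for i j
    using assms(3) by (intro ext) (simp add: g0_def)
  have g0: "assumptions_A M\<^sub>0 L\<^sub>y L\<^sub>z (g0 i j)" for i j
    using assms(8)[of i j] by (rule assumptions_A_cong) (simp add: g0_def)
  define u where "u = 1 - 2 * G (- (\<chi> i j. 1))"
  have u: "0 < u" using generator_minus_ones_nonpos[OF assms(1)] by (simp add: u_def)
  have \<mu>: "\<mu> \<le> L\<^sub>y * u" using assms(11) u by (simp add: u_def pos_divide_le_eq)
  have gen: "slope_y \<epsilon> L\<^sub>y f y y' z s \<omega> + 2 * G (\<chi> i j. slope_y \<epsilon> L\<^sub>y (g0 i j) y y' z s \<omega>) \<le> - \<mu>"
    if s: "s \<in> {0..T}" for y y' z s \<omega>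
  proof -
    define x where "x = y - y'"
    \<comment> \<open>With x = y - y', the weight of the difference quotient is q x^2, and r is
      \<open>L\<^sub>y\<close> times the complementary weight. Thus the slope of f is q x times its
      increment minus r, and the matrix of slopes of g is q D - r J with J the matrix of
      ones.\<close>
    define q where "q = 1 / (max \<bar>x\<bar> \<epsilon>)\<^sup>2"
    define r where "r = (1 - x * cut \<epsilon> x) * L\<^sub>y"
    define D where "D = (\<chi> i j. x * (g i j s \<omega> y z - g i j s \<omega> y' z))"
    have q: "0 \<le> q" "cut \<epsilon> x = q * x" by (simp_all add: q_def cut_def)
    have "x * cut \<epsilon> x \<le> 1" unfolding mult_cut by (rule square_div_max_square(2)[OF \<epsilon>]) simp
    then have r: "0 \<le> r" "r * u \<ge> (1 - q * x\<^sup>2) * \<mu>"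
      using L(1) mult_left_mono[OF \<mu>, of "1 - x * cut \<epsilon> x"]
      by (simp_all add: r_def q(2) power2_eq_square mult.assoc mult.left_commute)
    have "(\<chi> i j. slope_y \<epsilon> L\<^sub>y (g0 i j) y y' z s \<omega>) = (\<chi> i j. q * D $ i $ j + r * (- (\<chi> i j. 1) :: real^'d^'d) $ i $ j)"
      by (simp add: vec_eq_iff slope_y_def g0_eq[OF s] x_def[symmetric] D_def q(2) r_def algebra_simps)
    then have "G (\<chi> i j. slope_y \<epsilon> L\<^sub>y (g0 i j) y y' z s \<omega>) \<le> q * G D + r * G (- (\<chi> i j. 1))"
      using generator_sublinear[OF assms(1) q(1) r(1), of D "- (\<chi> i j. 1)"] by simp
    moreover have "slope_y \<epsilon> L\<^sub>y f y y' z s \<omega> = q * (x * (f s \<omega> y z - f s \<omega> y' z)) - r"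
      by (simp add: slope_y_def x_def[symmetric] q(2) r_def algebra_simps)
    moreover have "q * (x * (f s \<omega> y z - f s \<omega> y' z) + 2 * G D) \<le> q * (- \<mu> * x\<^sup>2)"
    proof (rule mult_left_mono[OF _ q(1)])
      show "x * (f s \<omega> y z - f s \<omega> y' z) + 2 * G D \<le> - \<mu> * x\<^sup>2"
        using assms(10)[unfolded assumption_M_def, rule_format, of s y y' \<omega> z] s
        unfolding D_def x_def power2_abs by simp
    qed
    moreover have "r * u = r - 2 * (r * G (- (\<chi> i j. 1)))" by (simp add: u_def algebra_simps)
    \<comment> \<open>(M), multiplied by q, contributes -q x^2 \<mu>, and (L) contributes -(1 - q
      x^2) \<mu>; the weights add up to 1.\<close>
    ultimately have "slope_y \<epsilon> L\<^sub>y f y y' z s \<omega> + 2 * G (\<chi> i j. slope_y \<epsilon> L\<^sub>y (g0 i j) y y' z s \<omega>)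
        \<le> q * (- \<mu> * x\<^sup>2) - r * u"
      unfolding distrib_left by linarith
    also have "\<dots> \<le> q * (- \<mu> * x\<^sup>2) - (1 - q * x\<^sup>2) * \<mu>" using r(2) by simp
    also have "\<dots> = - \<mu>" by (simp add: algebra_simps)
    finally show ?thesis .
  qed
  \<comment> \<open>The quotient along z - z' has the constant \<open>L\<^sub>z\<close>; the stated
    one follows from 2 d >= 1.\<close>
  have K: "L\<^sub>z * (1 + norm z + norm z') \<le> 2 * real CARD('d) * L\<^sub>z * (1 + norm z + norm z')" for z z' :: "real^'d"
  proof -
    have "1 \<le> CARD('d)" using zero_less_card_finite[where 'a='d] by linarith
    then have "1 \<le> 2 * real CARD('d)" by linarith
    then have "1 * (L\<^sub>z * (1 + norm z + norm z')) \<le> (2 * real CARD('d)) * (L\<^sub>z * (1 + norm z + norm z'))"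
      using L by (intro mult_right_mono mult_nonneg_nonneg add_nonneg_nonneg) auto
    then show ?thesis by (simp only: mult_1 mult.assoc)
  qed
  have slope_z_le: "norm (slope_z \<epsilon> h y' z z' s \<omega>) \<le> 2 * real CARD('d) * L\<^sub>z * (1 + norm z + norm z')"
    if "s \<in> {0..T}" "assumptions_A M\<^sub>0 L\<^sub>y L\<^sub>z h" for h :: "'d coefficient" and y' z z' s \<omega>
    using norm_slope_z_le[OF that(2) L T \<epsilon> that(1), of y' z z' \<omega>] K[of z z'] by linarith
  have remainder_le: "\<bar>remainder \<epsilon> L\<^sub>y h y y' z z' s \<omega>\<bar> \<le> 2 * L\<^sub>y * \<epsilon> + 4 * real CARD('d) * L\<^sub>z * (1 + norm z + norm z') * \<epsilon>"
    if "s \<in> {0..T}" "assumptions_A M\<^sub>0 L\<^sub>y L\<^sub>z h" for h :: "'d coefficient" and y y' z z' s \<omega>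
  proof -
    let ?k = "2 * real CARD('d) * L\<^sub>z * (1 + norm z + norm z')"
    have "0 \<le> ?k" using L by (intro mult_nonneg_nonneg add_nonneg_nonneg) auto
    then have "L\<^sub>z * (1 + norm z + norm z') \<le> 2 * ?k" using K[of z z'] by linarith
    then have "L\<^sub>z * (1 + norm z + norm z') * \<epsilon> \<le> 2 * ?k * \<epsilon>" using \<epsilon> by (intro mult_right_mono) auto
    moreover have "2 * ?k * \<epsilon> = 4 * real CARD('d) * L\<^sub>z * (1 + norm z + norm z') * \<epsilon>" by simp
    ultimately show ?thesis using abs_remainder_le[OF that(2) L T \<epsilon> that(1), of y y' z z' \<omega>] by linarith
  qed
  \<comment> \<open>Fixed arguments are constant processes, so membership of the families is a case
    of the substitution result.\<close>
  have const: "slope_y \<epsilon> L\<^sub>y h y y' z \<in> H_G \<P> 2 T" "slope_z \<epsilon> h y' z z' \<in> H_G_vec \<P> 2 T"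
    "remainder \<epsilon> L\<^sub>y h y y' z z' \<in> H_G \<P> 2 T"
    if h: "assumptions_A M\<^sub>0 L\<^sub>y L\<^sub>z h" for h :: "'d coefficient" and y y' z z'
    using linearisation_H_G[OF h L \<epsilon> H_G_const[of y] H_G_const[of y'] H_G_vec_const[of z] H_G_vec_const[of z']] by auto
  have process: "(\<lambda>s \<omega>. slope_y \<epsilon> L\<^sub>y h (Y s \<omega>) (Y' s \<omega>) (Z s \<omega>) s \<omega>) \<in> H_G \<P> 2 T"
      "(\<lambda>s \<omega>. slope_z \<epsilon> h (Y' s \<omega>) (Z s \<omega>) (Z' s \<omega>) s \<omega>) \<in> H_G_vec \<P> 2 T"
      "(\<lambda>s \<omega>. remainder \<epsilon> L\<^sub>y h (Y s \<omega>) (Y' s \<omega>) (Z s \<omega>) (Z' s \<omega>) s \<omega>) \<in> H_G \<P> 2 T"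
      "G_BMO_generator \<P> T (\<lambda>s \<omega>. slope_z \<epsilon> h (Y' s \<omega>) (Z s \<omega>) (Z' s \<omega>) s \<omega>)"
      "G_BMO_generator \<P> T (\<lambda>s \<omega>. remainder \<epsilon> L\<^sub>y h (Y s \<omega>) (Y' s \<omega>) (Z s \<omega>) (Z' s \<omega>) s \<omega>)"
    if h: "assumptions_A M\<^sub>0 L\<^sub>y L\<^sub>z h" and YZ: "Y \<in> S_G \<P> 2 T" "Y' \<in> S_G \<P> 2 T" "G_BMO_generator \<P> T Z" "G_BMO_generator \<P> T Z'"
    for h :: "'d coefficient" and Y Y' Z Z'
  proof -
    have "Z \<in> H_G_vec \<P> 2 T" "Z' \<in> H_G_vec \<P> 2 T" using YZ by (auto simp: G_BMO_generator_def)
    note mem = linearisation_H_G[OF h L \<epsilon> S_G_imp_H_G[OF YZ(1)] S_G_imp_H_G[OF YZ(2)] this]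
    show "(\<lambda>s \<omega>. slope_y \<epsilon> L\<^sub>y h (Y s \<omega>) (Y' s \<omega>) (Z s \<omega>) s \<omega>) \<in> H_G \<P> 2 T"
      "(\<lambda>s \<omega>. slope_z \<epsilon> h (Y' s \<omega>) (Z s \<omega>) (Z' s \<omega>) s \<omega>) \<in> H_G_vec \<P> 2 T"
      "(\<lambda>s \<omega>. remainder \<epsilon> L\<^sub>y h (Y s \<omega>) (Y' s \<omega>) (Z s \<omega>) (Z' s \<omega>) s \<omega>) \<in> H_G \<P> 2 T" by (fact mem)+
    show "G_BMO_generator \<P> T (\<lambda>s \<omega>. slope_z \<epsilon> h (Y' s \<omega>) (Z s \<omega>) (Z' s \<omega>) s \<omega>)"
      by (rule G_BMO_generator_dominated[OF mem(2) YZ(3,4) norm_slope_z_le[OF h L T \<epsilon>]])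
    \<comment> \<open>For the BMO property the constant part 2 \<open>L\<^sub>y\<close> \<epsilon>
      is absorbed into the factor in front of 1 + |Z| + |Z'|.\<close>
    have "norm (remainder \<epsilon> L\<^sub>y h (Y s \<omega>) (Y' s \<omega>) (Z s \<omega>) (Z' s \<omega>) s \<omega>)
        \<le> (2 * L\<^sub>y * \<epsilon> + L\<^sub>z * \<epsilon>) * (1 + norm (Z s \<omega>) + norm (Z' s \<omega>))" if s: "s \<in> {0..T}" for s \<omega>
    proof -
      define v where "v = norm (Z s \<omega>) + norm (Z' s \<omega>)"
      have "0 \<le> 2 * L\<^sub>y * \<epsilon> * v" using L \<epsilon> by (simp add: v_def)
      then have "2 * L\<^sub>y * \<epsilon> + L\<^sub>z * (1 + v) * \<epsilon> \<le> (2 * L\<^sub>y * \<epsilon> + L\<^sub>z * \<epsilon>) * (1 + v)" by (simp add: algebra_simps)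
      then show ?thesis
        using abs_remainder_le[OF h L T \<epsilon> s, of "Y s \<omega>" "Y' s \<omega>" "Z s \<omega>" "Z' s \<omega>" \<omega>] by (simp add: v_def add.assoc)
    qed
    then show "G_BMO_generator \<P> T (\<lambda>s \<omega>. remainder \<epsilon> L\<^sub>y h (Y s \<omega>) (Y' s \<omega>) (Z s \<omega>) (Z' s \<omega>) s \<omega>)"
      by (intro G_BMO_generator_dominated[OF _ YZ(3,4)]) (auto simp: H_G_vec_real mem(3))
  qed
  show ?thesis
  proof (rule exI[of _ "slope_y \<epsilon> L\<^sub>y f"], rule exI[of _ "\<lambda>i j. slope_y \<epsilon> L\<^sub>y (g0 i j)"],
      rule exI[of _ "remainder \<epsilon> L\<^sub>y f"], rule exI[of _ "\<lambda>i j. remainder \<epsilon> L\<^sub>y (g0 i j)"],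
      rule exI[of _ "slope_z \<epsilon> f"], rule exI[of _ "\<lambda>i j. slope_z \<epsilon> (g0 i j)"], intro conjI allI ballI impI; (elim conjE)?)
    fix s \<omega> y y' z z' assume s: "s \<in> {0..T}"
    show "f s \<omega> y z - f s \<omega> y' z' = slope_y \<epsilon> L\<^sub>y f y y' z s \<omega> * (y - y') + slope_z \<epsilon> f y' z z' s \<omega> \<bullet> (z - z')
        + remainder \<epsilon> L\<^sub>y f y y' z z' s \<omega>"
      by (rule coefficient_linearisation)
    show "g i j s \<omega> y z - g i j s \<omega> y' z' = slope_y \<epsilon> L\<^sub>y (g0 i j) y y' z s \<omega> * (y - y')
        + slope_z \<epsilon> (g0 i j) y' z z' s \<omega> \<bullet> (z - z') + remainder \<epsilon> L\<^sub>y (g0 i j) y y' z z' s \<omega>" for i j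
      using coefficient_linearisation[of "g0 i j" s \<omega> y z y' z'] by (simp add: g0_eq[OF s])
  qed (fact const[OF f] const[OF g0] process[OF f] process[OF g0] slope_z_le[OF _ f] slope_z_le[OF _ g0]
      remainder_le[OF _ f] remainder_le[OF _ g0] abs_slope_y_le[OF f L T \<epsilon>] abs_slope_y_le[OF g0 L T \<epsilon>] gen
      arg_cong[where f="slope_y \<epsilon> L\<^sub>y", OF g0_sym, THEN fun_cong, THEN fun_cong, THEN fun_cong])+
qed

end
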